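(* Let $X$ be a (horizontal Niebrzydowski) tribracket, $R$ a commutative ring with identity, and $V=(x,y)$ an $X$-module over $R$. Then the tribracket module multiset enhancement $\Phi_X^{V,M}$ and its polynomial form $\Phi_X^{V}$ are invariants of oriented knots and links: if $L$ and $L'$ are oriented link diagrams in the plane representing the same oriented knot or link (equivalently, related by a finite sequence of planar isotopies and oriented Reidemeister moves), then $$\Phi_X^{V,M}(L)=\Phi_X^{V,M}(L')\quad\text{and}\quad \Phi_X^{V}(L)=\Phi_X^{V}(L').$$
   Context: **Tribracket.** A (horizontal Niebrzydowski) tribracket is a set $X$ with a map $[\ ,\ ,\ ]:X\times X\times X\to X$ such that (i) in the equation $[a,b,c]=d$, any three of the four elements $a,b,c,d\in X$ uniquely determine the fourth (so for all $b,c,d$ there is a unique $a$ with $[a,b,c]=d$, for all $a,c,d$ there is a unique such $b$, and for all $a,b,d$ there is a unique such $c$); and (ii) for all $a,b,c,d\in X$, $$[b,[a,b,c],[a,b,d]]=[c,[a,b,c],[a,c,d]]=[d,[a,b,d],[a,c,d]].$$ **$X$-colorings.** The regions of an oriented link diagram $L$ are the connected components of the complement of $L$ in the plane. Near each crossing there are four quadrants, each lying to the left or to the right of the oriented over-strand and to the left or to the right of the oriented under-strand. Call $\rho_1$ the region in the quadrant to the left of both strands, $\rho_2$ the region in the quadrant to the right of the over-strand and left of the under-strand, $\rho_3$ the region in the quadrant to the left of the over-strand and right of the under-strand, and $\rho_4$ the region in the quadrant to the right of both strands. This is used for crossings of both signs. An $X$-coloring of $L$ is a map $f$ from the set of regions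 of $L$ to $X$ such that at every crossing $[f(\rho_1),f(\rho_2),f(\rho_3)]=f(\rho_4)$. The set of $X$-colorings of $L$ is denoted $\mathcal{C}_X(L)$. It is a known consequence of axioms (i) and (ii) that, for every oriented Reidemeister move from $L$ to $L'$, each $X$-coloring of $L$ agrees outside the neighborhood of the move with exactly one $X$-coloring of $L'$. **$X$-module.** An $X$-module (tribracket module) structure $V=(x,y)$ on a commutative ring $R$ with identity is a choice of units $x_{a,b,c},y_{a,b,c}\in R^\times$ for each $(a,b,c)\in X^3$ such that for all $a,b,c,d\in X$ \begin{align*} x_{c,[a,b,c],[a,c,d]}\,x_{a,b,c} &= x_{d,[a,b,d],[a,c,d]}\,x_{a,b,d}\\ &= x_{b,[a,b,c],[a,b,d]}\,x_{a,b,c}+y_{b,[a,b,c],[a,b,d]}\,x_{a,b,d}-x_{b,[a,b,c],[a,b,d]}\,y_{b,[a,b,c],[a,b,d]},\\ y_{c,[a,b,c],[a,c,d]}\,y_{a,c,d} &= y_{b,[a,b,c],[a,b,d]}\,y_{a,b,d}\\ &= x_{d,[a,b,d],[a,c,d]}\,y_{a,b,d}+y_{d,[a,b,d],[a,c,d]}\,y_{a,c,d}-x_{d,[a,b,d],[a,c,d]}\,y_{d,[a,b,d],[a,c,d]},\\ x_{b,[a,b,c],[a,b,d]}\,y_{a,b,c} &= y_{d,[a,b,d],[a,c,d]}\,x_{a,c,d}\\ &= x_{c,[a,b,c],[a,c,d]}\,y_{a,b,c}+y_{c,[a,b,c],[a,c,d]}\,x_{a,c,d}-x_{c,[a,b,c],[a,c,d]}\,y_{c,[a,b,c],[a,c,d]},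 \end{align*} and \begin{align*} &x_{c,[a,b,c],[a,c,d]}\,x_{a,b,c}\,y_{a,b,c}+y_{c,[a,b,c],[a,c,d]}\,x_{a,c,d}\,y_{a,c,d}\\ &\quad= x_{b,[a,b,c],[a,b,d]}\,x_{a,b,c}\,y_{a,b,c}+y_{b,[a,b,c],[a,b,d]}\,x_{a,b,d}\,y_{a,b,d}\\ &\quad= x_{d,[a,b,d],[a,c,d]}\,x_{a,b,d}\,y_{a,b,d}+y_{d,[a,b,d],[a,c,d]}\,x_{a,c,d}\,y_{a,c,d}. \end{align*} **The matrix $A_f$.** For $f\in\mathcal{C}_X(L)$, consider the homogeneous linear system over $R$ with one variable $s(\rho)$ for each region $\rho$ of $L$ and one equation (the sticker coloring equation) for each crossing: with $\rho_1$ the region in the quadrant to the left of both strands, $\rho_2$ the region in the quadrant to the right of the over-strand and left of the under-strand, $\rho_3$ the region in the quadrant to the left of the over-strand and right of the under-strand, $\rho_4$ the region in the quadrant to the right of both strands, and $a=f(\rho_1)$, $b=f(\rho_2)$, $c=f(\rho_3)$, $$-x_{a,b,c}\,y_{a,b,c}\,s(\rho_1)+x_{a,b,c}\,s(\rho_2)+y_{a,b,c}\,s(\rho_3)-s(\rho_4)=0.$$ $A_f$ is the coefficient matrix of this system, so $\mathrm{Ker}\,A_f$ is the $R$-module of all maps $s$ from the regions of $L$ to $R$ satisfying all these equations. **The enhancements.** The tribracket module multiset enhancement is the multiset (indexed by $f\in\mathcal{C}_X(L)$, counted with multiplicity) $$\Phi_X^{V,M}(L)=\{|\mathrm{Ker}\,A_f|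 : f\in\mathcal{C}_X(L)\}\ \text{ if } R \text{ is finite},\qquad \Phi_X^{V,M}(L)=\{\mathrm{rank}(\mathrm{Ker}\,A_f) : f\in\mathcal{C}_X(L)\}\ \text{ if } R \text{ is infinite}.$$ Here the rank of an $R$-module is the supremum of the cardinalities of its $R$-linearly independent subsets. The polynomial form is obtained from the multiset by turning elements into exponents of a formal variable $u$ and multiplicities into coefficients: $$\Phi_X^{V}(L)=\sum_{f\in\mathcal{C}_X(L)}u^{|\mathrm{Ker}\,A_f|}\ \text{ if } R \text{ is finite},\qquad \Phi_X^{V}(L)=\sum_{f\in\mathcal{C}_X(L)}u^{\mathrm{rank}(\mathrm{Ker}\,A_f)}\ \text{ if } R \text{ is infinite}.$$ (If $X$ is infinite, multiplicities are understood as cardinals and the sum is just formal notation for the multiset; if $X$ is finite it is a genuine polynomial.) *)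

theory Defs
  imports
    "HOL-Analysis.Analysis"
    "HOL-Algebra.Ring"
    "HOL-Library.Equipollence"
    "HOL-Library.Extended_Nat"
    "HOL-Library.FuncSet"
    "HOL-Computational_Algebra.Polynomial"
begin

section \<open>Tribrackets and tribracket modules\<close>

locale tribracket =
  fixes X :: "'x set" and br :: "'x \<Rightarrow> 'x \<Rightarrow> 'x \<Rightarrow> 'x"
  assumes closed: "\<lbrakk>a \<in> X; b \<in> X; c \<in> X\<rbrakk> \<Longrightarrow> br a b c \<in> X"
    and unique_fst: "\<lbrakk>b \<in> X; c \<in> X; d \<in> X\<rbrakk> \<Longrightarrow> \<exists>!a. a \<in> X \<and> br a b c = d"
    and unique_snd: "\<lbrakk>a \<in> X; c \<in> X; d \<in> X\<rbrakk> \<Longrightarrow> \<exists>!b. b \<in> X \<and> br a b c = d"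
    and unique_trd: "\<lbrakk>a \<in> X; b \<in> X; d \<in> X\<rbrakk> \<Longrightarrow> \<exists>!c. c \<in> X \<and> br a b c = d"
    and exchange1: "\<lbrakk>a \<in> X; b \<in> X; c \<in> X; d \<in> X\<rbrakk> \<Longrightarrow>
          br b (br a b c) (br a b d) = br c (br a b c) (br a c d)"
    and exchange2: "\<lbrakk>a \<in> X; b \<in> X; c \<in> X; d \<in> X\<rbrakk> \<Longrightarrow>
          br c (br a b c) (br a c d) = br d (br a b d) (br a c d)"

locale tribracket_module = tribracket X br + cring R
  for X :: "'x set" and br :: "'x \<Rightarrow> 'x \<Rightarrow> 'x \<Rightarrow> 'x"
    and R :: "('r, 'm) ring_scheme" (structure) +
  fixes x y :: "'x \<Rightarrow> 'x \<Rightarrow> 'x \<Rightarrow> 'r"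
  assumes x_unit: "\<lbrakk>a \<in> X; b \<in> X; c \<in> X\<rbrakk> \<Longrightarrow> x a b c \<in> Units R"
    and y_unit: "\<lbrakk>a \<in> X; b \<in> X; c \<in> X\<rbrakk> \<Longrightarrow> y a b c \<in> Units R"
    and xx1: "\<lbrakk>a \<in> X; b \<in> X; c \<in> X; d \<in> X\<rbrakk> \<Longrightarrow>
          x c (br a b c) (br a c d) \<otimes> x a b c
            = x d (br a b d) (br a c d) \<otimes> x a b d"
    and xx2: "\<lbrakk>a \<in> X; b \<in> X; c \<in> X; d \<in> X\<rbrakk> \<Longrightarrow>
          x d (br a b d) (br a c d) \<otimes> x a b d
            = x b (br a b c) (br a b d) \<otimes> x a b c
              \<oplus> y b (br a b c) (br a b d) \<otimes> x a b d
              \<ominus> x b (br a b c) (br a b d) \<otimes> y b (br a b c) (br a b d)"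
    and yy1: "\<lbrakk>a \<in> X; b \<in> X; c \<in> X; d \<in> X\<rbrakk> \<Longrightarrow>
          y c (br a b c) (br a c d) \<otimes> y a c d
            = y b (br a b c) (br a b d) \<otimes> y a b d"
    and yy2: "\<lbrakk>a \<in> X; b \<in> X; c \<in> X; d \<in> X\<rbrakk> \<Longrightarrow>
          y b (br a b c) (br a b d) \<otimes> y a b d
            = x d (br a b d) (br a c d) \<otimes> y a b d
              \<oplus> y d (br a b d) (br a c d) \<otimes> y a c d
              \<ominus> x d (br a b d) (br a c d) \<otimes> y d (br a b d) (br a c d)"
    and xy1: "\<lbrakk>a \<in> X; b \<in> X; c \<in> X; d \<in> X\<rbrakk> \<Longrightarrow>
          x b (br a b c) (br a b d) \<otimes> y a b c
            = y d (br a b d) (br a c d) \<otimes> x a c d"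
    and xy2: "\<lbrakk>a \<in> X; b \<in> X; c \<in> X; d \<in> X\<rbrakk> \<Longrightarrow>
          y d (br a b d) (br a c d) \<otimes> x a c d
            = x c (br a b c) (br a c d) \<otimes> y a b c
              \<oplus> y c (br a b c) (br a c d) \<otimes> x a c d
              \<ominus> x c (br a b c) (br a c d) \<otimes> y c (br a b c) (br a c d)"
    and xxy1: "\<lbrakk>a \<in> X; b \<in> X; c \<in> X; d \<in> X\<rbrakk> \<Longrightarrow>
          x c (br a b c) (br a c d) \<otimes> x a b c \<otimes> y a b c
            \<oplus> y c (br a b c) (br a c d) \<otimes> x a c d \<otimes> y a c d
          = x b (br a b c) (br a b d) \<otimes> x a b c \<otimes> y a b c
            \<oplus> y b (br a b c) (br a b d) \<otimes> x a b d \<otimes> y a b d"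
    and xxy2: "\<lbrakk>a \<in> X; b \<in> X; c \<in> X; d \<in> X\<rbrakk> \<Longrightarrow>
          x b (br a b c) (br a b d) \<otimes> x a b c \<otimes> y a b c
            \<oplus> y b (br a b c) (br a b d) \<otimes> x a b d \<otimes> y a b d
          = x d (br a b d) (br a c d) \<otimes> x a b d \<otimes> y a b d
            \<oplus> y d (br a b d) (br a c d) \<otimes> x a c d \<otimes> y a c d"


section \<open>Oriented link diagrams\<close>

text \<open>
  The plane is the complex plane with its standard orientation. A diagram is stored independently
  of parametrizations: \<open>(p, u) \<in> tangents D\<close> says that a strand runs through the point \<open>p\<close> with
  oriented unit tangent \<open>u\<close>, and \<open>(p, u) \<in> overs D\<close> says that moreover \<open>p\<close> is a crossing and that
  this strand is the over-strand there.
\<close>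

record diagram =
  tangents :: "(complex \<times> complex) set"
  overs :: "(complex \<times> complex) set"

definition curve_point :: "('i \<Rightarrow> real \<Rightarrow> complex) \<Rightarrow> 'i \<times> real \<Rightarrow> complex" where
  "curve_point k q = k (fst q) (snd q)"

definition curve_tangent :: "('i \<Rightarrow> real \<Rightarrow> complex) \<Rightarrow> 'i \<times> real \<Rightarrow> complex" where
  "curve_tangent k q = sgn (vector_derivative (k (fst q)) (at (snd q)))"

text \<open>
  The curves \<open>t \<mapsto> (k i t, h i t)\<close> in space (with height \<open>h\<close>), projected to the plane, where the
  parameters \<open>(i, t)\<close> range over \<open>P\<close>.
\<close>

definition projection ::
  "('i \<times> real) set \<Rightarrow> ('i \<Rightarrow> real \<Rightarrow> complex) \<Rightarrow> ('i \<Rightarrow> real \<Rightarrow> real) \<Rightarrow> diagram" where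
  "projection P k h =
     \<lparr>tangents = {(curve_point k q, curve_tangent k q) | q. q \<in> P},
      overs = {(curve_point k q, curve_tangent k q) | q. q \<in> P \<and>
        (\<exists>r\<in>P. curve_point k r = curve_point k q \<and> h (fst r) (snd r) < h (fst q) (snd q))}\<rparr>"

definition parallel :: "complex \<Rightarrow> complex \<Rightarrow> bool" where
  "parallel u v \<longleftrightarrow> Im (cnj u * v) = 0"

text \<open>
  An oriented link diagram with \<open>n\<close> components: a regular projection of \<open>n\<close> disjoint simple closed
  curves in space. Its plane curves are \<open>C\<^sup>1\<close> immersed closed curves (of period \<open>1\<close>) whose only
  multiple points are finitely many transverse double points.
\<close>

definition link_diagram :: "diagram \<Rightarrow> bool" where
  "link_diagram D \<longleftrightarrow>
    (\<exists>(n::nat) k h. let P = {..<n} \<times> {0..<1} in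
       D = projection P k h \<and>
       (\<forall>i<n. k i C1_differentiable_on UNIV \<and> continuous_on UNIV (h i) \<and>
          (\<forall>t. k i (t + 1) = k i t \<and> h i (t + 1) = h i t \<and>
               vector_derivative (k i) (at t) \<noteq> 0)) \<and>
       finite {curve_point k q | q. q \<in> P \<and> (\<exists>r\<in>P. r \<noteq> q \<and> curve_point k r = curve_point k q)} \<and>
       (\<forall>q\<in>P. \<forall>r\<in>P. r \<noteq> q \<and> curve_point k r = curve_point k q \<longrightarrow>
          \<not> parallel (curve_tangent k q) (curve_tangent k r) \<and>
          h (fst q) (snd q) \<noteq> h (fst r) (snd r) \<and>
          (\<forall>s\<in>P. curve_point k s = curve_point k q \<longrightarrow> s = q \<or> s = r)))"


section \<open>Planar isotopy and Reidemeister moves\<close>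

text \<open>Ambient isotopies of the plane through \<open>C\<^sup>1\<close> diffeomorphisms.\<close>

definition ambient_isotopy :: "(real \<Rightarrow> complex \<Rightarrow> complex) \<Rightarrow> bool" where
  "ambient_isotopy H \<longleftrightarrow>
     (\<forall>z. H 0 z = z) \<and>
     (\<forall>t\<in>{0..1}. bij (H t)) \<and>
     continuous_on ({0..1} \<times> UNIV) (\<lambda>(t, z). H t z) \<and>
     (\<exists>H'. (\<forall>t\<in>{0..1}. \<forall>z. (H t has_derivative H' t z) (at z) \<and> bij (H' t z)) \<and>
           (\<forall>w. continuous_on ({0..1} \<times> UNIV) (\<lambda>(t, z). H' t z w)))"

definition transport :: "(complex \<Rightarrow> complex) \<Rightarrow> complex \<times> complex \<Rightarrow> complex \<times> complex" where
  "transport g = (\<lambda>(p, u). (g p, sgn (frechet_derivative g (at p) u)))"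

definition planar_isotopic :: "diagram \<Rightarrow> diagram \<Rightarrow> bool" where
  "planar_isotopic D D' \<longleftrightarrow>
     (\<exists>H. ambient_isotopy H \<and>
          tangents D' = transport (H 1) ` tangents D \<and> overs D' = transport (H 1) ` overs D)"

text \<open>
  Up to planar isotopy, every Reidemeister move takes place inside one fixed rectangle, where it
  replaces one fixed local picture by another one.
\<close>

definition move_box :: "complex set" where
  "move_box = {z. \<bar>Re z\<bar> \<le> 2 \<and> \<bar>Im z\<bar> \<le> 3}"

definition restrict_diagram :: "complex set \<Rightarrow> diagram \<Rightarrow> diagram" where
  "restrict_diagram B D =
     \<lparr>tangents = tangents D \<inter> (B \<times> UNIV), overs = overs D \<inter> (B \<times> UNIV)\<rparr>"

definition local_picture ::
  "nat \<Rightarrow> (nat \<Rightarrow> real \<Rightarrow> complex) \<Rightarrow> (nat \<Rightarrow> real \<Rightarrow> real) \<Rightarrow> diagram" where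
  "local_picture m k h = projection {(i, t). i < m \<and> k i t \<in> move_box} k h"

definition local_move :: "diagram \<Rightarrow> diagram \<Rightarrow> diagram \<Rightarrow> diagram \<Rightarrow> bool" where
  "local_move T T' D D' \<longleftrightarrow>
     restrict_diagram (- move_box) D = restrict_diagram (- move_box) D' \<and>
     restrict_diagram move_box D = T \<and> restrict_diagram move_box D' = T'"

text \<open>A \<open>C\<^sup>1\<close> bump function, supported in \<open>[-1, 1]\<close> with maximum \<open>bump 0 = 1\<close>.\<close>

definition bump :: "real \<Rightarrow> real" where
  "bump t = (max 0 (1 - t\<^sup>2))\<^sup>2"

text \<open>
  The signs \<open>\<sigma>\<close> run through all orientations of the strands. In the first move the kink has its
  double point at the parameters \<open>t = 1/2\<close> and \<open>t = - 1/2\<close>, and \<open>\<epsilon>\<close> decides which of the two passages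
  is the upper one. Kinks on the other side of the strand arise by rotating the plane.
\<close>

definition reidemeister1 :: "diagram \<Rightarrow> diagram \<Rightarrow> bool" where
  "reidemeister1 D D' \<longleftrightarrow>
     (\<exists>\<sigma>\<in>{1, -1}. \<exists>\<epsilon>\<in>{1, -1}.
        local_move
          (local_picture 1 (\<lambda>_ t. Complex (\<sigma> * t) 0) (\<lambda>_ t. \<epsilon> * t))
          (local_picture 1 (\<lambda>_ t. Complex ((\<sigma> * t) ^ 3 - \<sigma> * t / 4) (bump (\<sigma> * t))) (\<lambda>_ t. \<epsilon> * t))
          D D')"

text \<open>The height \<open>h i\<close> is the (constant) level of the \<open>i\<close>-th strand.\<close>

definition reidemeister2 :: "diagram \<Rightarrow> diagram \<Rightarrow> bool" where
  "reidemeister2 D D' \<longleftrightarrow>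
     (\<exists>\<sigma> (h :: nat \<Rightarrow> real). (\<forall>i<2. \<sigma> i \<in> {1, -1}) \<and> inj_on h {..<2} \<and>
        (let picture = (\<lambda>c. local_picture 2 (\<lambda>i t. ([\<lambda>t. Complex t 0, c] ! i) (\<sigma> i * t)) (\<lambda>i t. h i))
         in local_move (picture (\<lambda>t. Complex t 1)) (picture (\<lambda>t. Complex t (1 - 2 * bump t))) D D'))"

text \<open>
  A third strand moves across the crossing at the origin of two diagonal strands; it may be the
  top, the middle or the bottom strand.
\<close>

definition reidemeister3 :: "diagram \<Rightarrow> diagram \<Rightarrow> bool" where
  "reidemeister3 D D' \<longleftrightarrow>
     (\<exists>\<sigma> (h :: nat \<Rightarrow> real). (\<forall>i<3. \<sigma> i \<in> {1, -1}) \<and> inj_on h {..<3} \<and>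
        (let picture = (\<lambda>c. local_picture 3
               (\<lambda>i t. ([\<lambda>t. Complex t t, \<lambda>t. Complex t (- t), c] ! i) (\<sigma> i * t)) (\<lambda>i t. h i))
         in local_move (picture (\<lambda>t. Complex t (bump t))) (picture (\<lambda>t. Complex t (- bump t))) D D'))"

definition diagram_step :: "diagram \<Rightarrow> diagram \<Rightarrow> bool" where
  "diagram_step D D' \<longleftrightarrow> link_diagram D \<and> link_diagram D' \<and>
     (planar_isotopic D D' \<or> reidemeister1 D D' \<or> reidemeister2 D D' \<or> reidemeister3 D D')"

definition link_equivalent :: "diagram \<Rightarrow> diagram \<Rightarrow> bool" where
  "link_equivalent = equivclp diagram_step"


section \<open>Regions and colorings\<close>

definition regions :: "diagram \<Rightarrow> complex set set" where
  "regions D = components (- fst ` tangents D)"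

definition left_of :: "complex \<Rightarrow> complex set" where
  "left_of u = {w. Im (cnj u * w) > 0}"

definition right_of :: "complex \<Rightarrow> complex set" where
  "right_of u = {w. Im (cnj u * w) < 0}"

text \<open>
  \<open>u\<close> and \<open>v\<close> are the directions of the over- and the under-strand at the crossing \<open>p\<close>.
\<close>

definition is_crossing :: "diagram \<Rightarrow> complex \<Rightarrow> complex \<Rightarrow> complex \<Rightarrow> bool" where
  "is_crossing D p u v \<longleftrightarrow> (p, u) \<in> overs D \<and> (p, v) \<in> tangents D - overs D"

text \<open>
  The region into which one moves when starting at \<open>p\<close> in any of the directions in \<open>Q\<close>, where \<open>Q\<close> is
  one of the four open sectors between the tangent lines at a crossing \<open>p\<close>. At a crossing of a link
  diagram every sector has exactly one such region.
\<close>

definition quadrant_region :: "diagram \<Rightarrow> complex \<Rightarrow> complex set \<Rightarrow> complex set \<Rightarrow> bool" where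
  "quadrant_region D p Q \<rho> \<longleftrightarrow> \<rho> \<in> regions D \<and>
     (\<forall>w\<in>Q. \<forall>\<^sub>F e in at_right (0::real). p + of_real e * w \<in> \<rho>)"

definition regions_at_crossing ::
  "diagram \<Rightarrow> complex set \<Rightarrow> complex set \<Rightarrow> complex set \<Rightarrow> complex set \<Rightarrow> bool" where
  "regions_at_crossing D \<rho>1 \<rho>2 \<rho>3 \<rho>4 \<longleftrightarrow>
     (\<exists>p u v. is_crossing D p u v \<and>
        quadrant_region D p (left_of u \<inter> left_of v) \<rho>1 \<and>
        quadrant_region D p (right_of u \<inter> left_of v) \<rho>2 \<and>
        quadrant_region D p (left_of u \<inter> right_of v) \<rho>3 \<and>
        quadrant_region D p (right_of u \<inter> right_of v) \<rho>4)"

definition colorings ::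
  "'x set \<Rightarrow> ('x \<Rightarrow> 'x \<Rightarrow> 'x \<Rightarrow> 'x) \<Rightarrow> diagram \<Rightarrow> (complex set \<Rightarrow> 'x) set" where
  "colorings X br D =
     {f \<in> regions D \<rightarrow>\<^sub>E X. \<forall>\<rho>1 \<rho>2 \<rho>3 \<rho>4.
        regions_at_crossing D \<rho>1 \<rho>2 \<rho>3 \<rho>4 \<longrightarrow> br (f \<rho>1) (f \<rho>2) (f \<rho>3) = f \<rho>4}"


section \<open>The enhancements\<close>

text \<open>The kernel of the coefficient matrix of the sticker coloring equations of \<open>f\<close>.\<close>

definition sticker_kernel ::
  "('r, 'm) ring_scheme \<Rightarrow> ('x \<Rightarrow> 'x \<Rightarrow> 'x \<Rightarrow> 'r) \<Rightarrow> ('x \<Rightarrow> 'x \<Rightarrow> 'x \<Rightarrow> 'r) \<Rightarrow>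
   diagram \<Rightarrow> (complex set \<Rightarrow> 'x) \<Rightarrow> (complex set \<Rightarrow> 'r) set" where
  "sticker_kernel R x y D f =
     {s \<in> regions D \<rightarrow>\<^sub>E carrier R. \<forall>\<rho>1 \<rho>2 \<rho>3 \<rho>4.
        regions_at_crossing D \<rho>1 \<rho>2 \<rho>3 \<rho>4 \<longrightarrow>
        (let xabc = x (f \<rho>1) (f \<rho>2) (f \<rho>3); yabc = y (f \<rho>1) (f \<rho>2) (f \<rho>3) in
          (\<ominus>\<^bsub>R\<^esub> (xabc \<otimes>\<^bsub>R\<^esub> yabc \<otimes>\<^bsub>R\<^esub> s \<rho>1)) \<oplus>\<^bsub>R\<^esub> xabc \<otimes>\<^bsub>R\<^esub> s \<rho>2
            \<oplus>\<^bsub>R\<^esub> yabc \<otimes>\<^bsub>R\<^esub> s \<rho>3 \<ominus>\<^bsub>R\<^esub> s \<rho>4 = \<zero>\<^bsub>R\<^esub>)}"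

text \<open>Linear independence of a set of functions from \<open>A\<close> to \<open>R\<close>, with pointwise operations.\<close>

definition linearly_independent ::
  "('r, 'm) ring_scheme \<Rightarrow> 'a set \<Rightarrow> ('a \<Rightarrow> 'r) set \<Rightarrow> bool" where
  "linearly_independent R A S \<longleftrightarrow>
     (\<forall>F c. finite F \<and> F \<subseteq> S \<and> c \<in> F \<rightarrow> carrier R \<and>
        (\<forall>\<rho>\<in>A. (\<Oplus>\<^bsub>R\<^esub>s\<in>F. c s \<otimes>\<^bsub>R\<^esub> s \<rho>) = \<zero>\<^bsub>R\<^esub>) \<longrightarrow> (\<forall>s\<in>F. c s = \<zero>\<^bsub>R\<^esub>))"

definition ecard :: "'a set \<Rightarrow> enat" where
  "ecard S = (if finite S then enat (card S) else \<infinity>)"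

definition module_rank ::
  "('r, 'm) ring_scheme \<Rightarrow> 'a set \<Rightarrow> ('a \<Rightarrow> 'r) set \<Rightarrow> enat" where
  "module_rank R A M = (SUP S\<in>{S. S \<subseteq> M \<and> linearly_independent R A S}. ecard S)"

definition kernel_size ::
  "('r, 'm) ring_scheme \<Rightarrow> ('x \<Rightarrow> 'x \<Rightarrow> 'x \<Rightarrow> 'r) \<Rightarrow> ('x \<Rightarrow> 'x \<Rightarrow> 'x \<Rightarrow> 'r) \<Rightarrow>
   diagram \<Rightarrow> (complex set \<Rightarrow> 'x) \<Rightarrow> enat" where
  "kernel_size R x y D f =
     (if finite (carrier R) then ecard (sticker_kernel R x y D f)
      else module_rank R (regions D) (sticker_kernel R x y D f))"

text \<open>
  Since \<open>X\<close> may be infinite, multiplicities are cardinals, represented by equipollence classes: a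
  multiset is the function assigning to each potential element its multiplicity.
\<close>

definition cardinal :: "'a set \<Rightarrow> 'a set set" where
  "cardinal A = {B. B \<approx> A}"

definition multiset_enhancement ::
  "'x set \<Rightarrow> ('x \<Rightarrow> 'x \<Rightarrow> 'x \<Rightarrow> 'x) \<Rightarrow> ('r, 'm) ring_scheme \<Rightarrow>
   ('x \<Rightarrow> 'x \<Rightarrow> 'x \<Rightarrow> 'r) \<Rightarrow> ('x \<Rightarrow> 'x \<Rightarrow> 'x \<Rightarrow> 'r) \<Rightarrow>
   diagram \<Rightarrow> enat \<Rightarrow> (complex set \<Rightarrow> 'x) set set" where
  "multiset_enhancement X br R x y D =
     (\<lambda>m. cardinal {f \<in> colorings X br D. kernel_size R x y D f = m})"

text \<open>
  A genuine polynomial if \<open>X\<close> is finite; the exponents are then finite because a link diagram has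
  only finitely many regions.
\<close>

definition polynomial_enhancement ::
  "'x set \<Rightarrow> ('x \<Rightarrow> 'x \<Rightarrow> 'x \<Rightarrow> 'x) \<Rightarrow> ('r, 'm) ring_scheme \<Rightarrow>
   ('x \<Rightarrow> 'x \<Rightarrow> 'x \<Rightarrow> 'r) \<Rightarrow> ('x \<Rightarrow> 'x \<Rightarrow> 'x \<Rightarrow> 'r) \<Rightarrow> diagram \<Rightarrow> int poly" where
  "polynomial_enhancement X br R x y D =
     (\<Sum>f\<in>colorings X br D. Polynomial.monom 1 (the_enat (kernel_size R x y D f)))"

end

theory Submission
  imports Defs "HOL-Algebra.Multiplicative_Group"
begin

text \<open>
  The sticker coloring equation turns \<open>X \<times> R\<close> into a tribracket whose colorings are the pairs of an
  \<open>X\<close>-coloring \<open>f\<close> and an element of the kernel of \<open>A\<^sub>f\<close>. It therefore suffices to show, for every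
  tribracket, that the colorings of two diagrams related by a planar isotopy or by a Reidemeister
  move correspond to each other by agreeing away from the move: for \<open>X\<close> this is a bijection between
  the colorings, and for \<open>X \<times> R\<close> it yields linear bijections between the kernels, which preserve
  cardinality and rank.

  Within the rectangle of a move every region is labelled, mostly by the sides of the strands on
  which it lies, and a coloring becomes an assignment of colors to labels that satisfies one equation
  per crossing. So each move reduces to a statement about finitely many equations. For the third
  move the labels are the corners of a cube and the crossings are three of its faces, and
  the exchange axioms say that the three faces at one corner can be traded for the three faces at the
  opposite one.
\<close>

section \<open>Cubes of faces in a tribracket\<close>

text \<open>"Agreeing away from the move" cannot be a bijection of regions: a region may enter the
  rectangle in several places, a second move may split one region or join two, and a first move
  creates a disc without a counterpart. So the correspondence is a relation between regions, and a
  coloring is treated as a locally constant function on the complement of the curve. Such a function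
  can be cut along the rectangle, changed inside and glued, with no knowledge of how the regions
  close up outside. The same relation has to serve \<open>X\<close> and \<open>X \<times> R\<close>:
  only then do the \<open>X\<close>-coordinates of transferred pairs match the chosen coloring, so
  that kernel elements over \<open>f\<close> go to kernel elements over \<open>f'\<close>. Agreement
  is preserved by linear combinations, which is why the bijection of kernels preserves rank. The
  difficulty with isotopies is that colorings distinguish left from right and that quadrants are
  defined by straight rays: an isotopy bends the rays, and its final diffeomorphism must be shown to
  have positive Jacobian determinant.\<close>

context tribracket
begin

lemma cancel_fst: "\<lbrakk>br a b c = br a' b c; a \<in> X; a' \<in> X; b \<in> X; c \<in> X\<rbrakk> \<Longrightarrow> a = a'"
  using unique_fst closed by metis

lemma cancel_snd: "\<lbrakk>br a b c = br a b' c; a \<in> X; b \<in> X; b' \<in> X; c \<in> X\<rbrakk> \<Longrightarrow> b = b'"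
  using unique_snd closed by metis

lemma cancel_trd: "\<lbrakk>br a b c = br a b c'; a \<in> X; b \<in> X; c \<in> X; c' \<in> X\<rbrakk> \<Longrightarrow> c = c'"
  using unique_trd closed by metis

lemma solve_fst: "\<lbrakk>b \<in> X; c \<in> X; d \<in> X\<rbrakk> \<Longrightarrow> \<exists>a\<in>X. br a b c = d"
  using unique_fst by blast

lemma solve_snd: "\<lbrakk>a \<in> X; c \<in> X; d \<in> X\<rbrakk> \<Longrightarrow> \<exists>b\<in>X. br a b c = d"
  using unique_snd by blast

lemma solve_trd: "\<lbrakk>a \<in> X; b \<in> X; d \<in> X\<rbrakk> \<Longrightarrow> \<exists>c\<in>X. br a b c = d"
  using unique_trd by blast

end

text \<open>A pair gives the sides of the over- and of the under-strand, with \<open>True\<close>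
  for left, so the corners appear in the order \<rho>1, \<rho>2, \<rho>3, \<rho>4 of the crossing
  equation.\<close>

definition face :: "('x \<Rightarrow> 'x \<Rightarrow> 'x \<Rightarrow> 'x) \<Rightarrow> (bool \<times> bool \<Rightarrow> 'x) \<Rightarrow> bool" where
  "face br H \<longleftrightarrow> br (H (True, True)) (H (False, True)) (H (True, False)) = H (False, False)"

context tribracket
begin

text \<open>Each position of the free corner is one clause of unique solvability, with closure
  serving the last. This colors the bigon created by a second move.\<close>

lemma face_extend:
  assumes "range H \<subseteq> X"
  shows "\<exists>w\<in>X. face br (H(l := w))"
proof -
  have in_X [simp]: "H l \<in> X" for l using assms by auto
  consider "l = (True, True)" | "l = (False, True)" | "l = (True, False)" | "l = (False, False)"
    by (metis (full_types) surj_pair)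
  then show ?thesis
    by cases (auto simp: face_def closed intro: solve_fst solve_snd solve_trd)
qed

text \<open>By cancellation at the position of \<open>l\<close>. It determines the color of the
  bigon and, applied to the faces at the two crossings of a bigon, shows that the parts on either
  side of it have equal colors.\<close>

lemma face_unique:
  assumes "range H \<subseteq> X" "range H' \<subseteq> X" "face br H" "face br H'"
    and eq: "\<And>l'. l' \<noteq> l \<Longrightarrow> H l' = H' l'"
  shows "H l = H' l"
proof -
  have in_X [simp]: "H l \<in> X" "H' l \<in> X" for l using assms by auto
  have f: "br (H (True, True)) (H (False, True)) (H (True, False)) = H (False, False)"
    "br (H' (True, True)) (H' (False, True)) (H' (True, False)) = H' (False, False)"
    using assms(3,4) by (simp_all add: face_def)
  consider "l = (True, True)" | "l = (False, True)" | "l = (True, False)" | "l = (False, False)"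
    by (metis (full_types) surj_pair)
  then show ?thesis
  proof cases
    case 1
    then have "br (H (True, True)) (H' (False, True)) (H' (True, False)) = br (H' (True, True)) (H' (False, True)) (H' (True, False))"
      using f eq[of "(False, True)"] eq[of "(True, False)"] eq[of "(False, False)"] by auto
    from cancel_fst[OF this] show ?thesis using 1 by simp
  next
    case 2
    then have "br (H' (True, True)) (H (False, True)) (H' (True, False)) = br (H' (True, True)) (H' (False, True)) (H' (True, False))"
      using f eq[of "(True, True)"] eq[of "(True, False)"] eq[of "(False, False)"] by auto
    from cancel_snd[OF this] show ?thesis using 2 by simp
  next
    case 3
    then have "br (H' (True, True)) (H' (False, True)) (H (True, False)) = br (H' (True, True)) (H' (False, True)) (H' (True, False))"
      using f eq[of "(True, True)"] eq[of "(False, True)"] eq[of "(False, False)"] by auto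
    from cancel_trd[OF this] show ?thesis using 3 by simp
  next
    case 4
    with f show ?thesis
      using eq[of "(True, True)"] eq[of "(False, True)"] eq[of "(True, False)"] by auto
  qed
qed

end

text \<open>
  The corners of the cube are the triples of sides of the top, the middle and the bottom strand of a
  third Reidemeister move (with \<open>True\<close> for the left side). The crossings of either picture are the
  faces at the corner opposite to the one that does not occur in it.
\<close>

definition cube_faces :: "('x \<Rightarrow> 'x \<Rightarrow> 'x \<Rightarrow> 'x) \<Rightarrow> (bool \<times> bool \<times> bool \<Rightarrow> 'x) \<Rightarrow>
    bool \<Rightarrow> bool \<Rightarrow> bool \<Rightarrow> bool" where
  "cube_faces br G t m b \<longleftrightarrow>
     br (G (True, True, b)) (G (False, True, b)) (G (True, False, b)) = G (False, False, b) \<and>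
     br (G (True, m, True)) (G (False, m, True)) (G (True, m, False)) = G (False, m, False) \<and>
     br (G (t, True, True)) (G (t, False, True)) (G (t, True, False)) = G (t, False, False)"

context tribracket
begin

text \<open>One face through \<open>(t, m, b)\<close> suffices, here the one between the top and the
  middle strand: its other corners are known, and cancellation gives the last. The cases on
  \<open>t\<close> and \<open>m\<close> decide in which position of the bracket it stands.\<close>

lemma cube_faces_unique:
  assumes "range G \<subseteq> X" "range G' \<subseteq> X" "cube_faces br G t m b" "cube_faces br G' t m b"
    and "\<And>l. l \<noteq> (t, m, b) \<Longrightarrow> l \<noteq> (\<not> t, \<not> m, \<not> b) \<Longrightarrow> G l = G' l"
  shows "G (t, m, b) = G' (t, m, b)"
proof -
  have "G l \<in> X" "G' l \<in> X" for l using assms by auto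
  then show ?thesis
    using assms(3-4) assms(5)[of "(\<not> t, m, b)"] assms(5)[of "(t, \<not> m, b)"]
      assms(5)[of "(\<not> t, \<not> m, b)"]
    unfolding cube_faces_def
    by (cases t; cases m; simp; metis cancel_fst cancel_snd cancel_trd)
qed

text \<open>The free corner is forced by one of the new equations, and the exchange axioms give the
  other two. If \<open>pqr\<close> or one of \<open>pq\<close>, \<open>pr\<close>, \<open>qr\<close>
  is free, it is a value of the bracket and can be written down; if \<open>p\<close>,
  \<open>q\<close>, \<open>r\<close> or \<open>a\<close> is free, it is the solution of an equation,
  and cancellation has to be used as well.\<close>

lemma cube_faces_extend:
  assumes G: "range G \<subseteq> X" and "cube_faces br G t m b"
  shows "\<exists>w\<in>X. cube_faces br (G((\<not> t, \<not> m, \<not> b) := w)) (\<not> t) (\<not> m) (\<not> b)"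
proof -
  have in_X [simp]: "G l \<in> X" for l using G by auto
  define a where "a = G (True, True, True)"
  define p where "p = G (False, True, True)"
  define q where "q = G (True, False, True)"
  define r where "r = G (True, True, False)"
  define pq where "pq = G (False, False, True)"
  define pr where "pr = G (False, True, False)"
  define qr where "qr = G (True, False, False)"
  define pqr where "pqr = G (False, False, False)"
  note defs = a_def p_def q_def r_def pq_def pr_def qr_def pqr_def
  have X: "a \<in> X" "p \<in> X" "q \<in> X" "r \<in> X" "pq \<in> X" "pr \<in> X" "qr \<in> X" "pqr \<in> X"
    by (simp_all add: defs)
  note F = assms(2)[unfolded cube_faces_def]
  consider "t" "m" "b" | "\<not> t" "m" "b" | "t" "\<not> m" "b" | "t" "m" "\<not> b"
    | "\<not> t" "\<not> m" "b" | "\<not> t" "m" "\<not> b" | "t" "\<not> m" "\<not> b" | "\<not> t" "\<not> m" "\<not> b"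
    by blast
  then show ?thesis
  proof cases
    case 1
    then have "br a p q = pq" "br a p r = pr" "br a q r = qr" using F by (simp_all add: defs)
    then have "br p pq pr = br r pr qr" "br q pq qr = br r pr qr"
      using exchange1[of a p q r] exchange2[of a p q r] X by auto
    then show ?thesis using 1 X by (intro bexI[of _ "br r pr qr"]) (auto simp: cube_faces_def defs closed)
  next
    case 2
    then have "br a p q = pq" "br a p r = pr" "br p pq pr = pqr" using F by (simp_all add: defs)
    then have "br r pr (br a q r) = pqr" "br q pq (br a q r) = pqr"
      using exchange1[of a p q r] exchange2[of a p q r] X by auto
    then show ?thesis using 2 X by (intro bexI[of _ "br a q r"]) (auto simp: cube_faces_def defs closed)
  next
    case 3
    then have "br a p q = pq" "br a q r = qr" "br q pq qr = pqr" using F by (simp_all add: defs)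
    then have "br r (br a p r) qr = pqr" "br p pq (br a p r) = pqr"
      using exchange1[of a p q r] exchange2[of a p q r] X by auto
    then show ?thesis using 3 X by (intro bexI[of _ "br a p r"]) (auto simp: cube_faces_def defs closed)
  next
    case 4
    then have "br a p r = pr" "br a q r = qr" "br r pr qr = pqr" using F by (simp_all add: defs)
    then have "br q (br a p q) qr = pqr" "br p (br a p q) pr = pqr"
      using exchange1[of a p q r] exchange2[of a p q r] X by auto
    then show ?thesis using 4 X by (intro bexI[of _ "br a p q"]) (auto simp: cube_faces_def defs closed)
  next
    case 5
    then have E: "br a p q = pq" "br p pq pr = pqr" "br q pq qr = pqr" using F by (simp_all add: defs)
    \<comment> \<open>The free corner is now an argument of the bracket rather than a value. It is
      chosen to satisfy one new equation; comparing the exchange axioms with the given equations and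
      cancelling yields the others.\<close>
    obtain r' where r': "r' \<in> X" "br a p r' = pr" using solve_trd X by metis
    have "br q pq (br a q r') = br q pq qr"
      using exchange1[of a p q r'] exchange2[of a p q r'] X E r' by auto
    then have "br a q r' = qr" using X r' closed cancel_trd by metis
    moreover have "br r' pr qr = pqr" using exchange1[of a p q r'] exchange2[of a p q r'] X E r' calculation by auto
    ultimately show ?thesis using 5 X r' by (intro bexI[of _ r']) (auto simp: cube_faces_def defs)
  next
    case 6
    then have E: "br a p r = pr" "br p pq pr = pqr" "br r pr qr = pqr" using F by (simp_all add: defs)
    obtain q' where q': "q' \<in> X" "br a p q' = pq" using solve_trd X by metis
    have "br r pr (br a q' r) = br r pr qr"
      using exchange1[of a p q' r] exchange2[of a p q' r] X E q' by auto
    then have "br a q' r = qr" using X q' closed cancel_trd by metis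
    moreover have "br q' pq qr = pqr" using exchange1[of a p q' r] exchange2[of a p q' r] X E q' calculation by auto
    ultimately show ?thesis using 6 X q' by (intro bexI[of _ q']) (auto simp: cube_faces_def defs)
  next
    case 7
    then have E: "br a q r = qr" "br q pq qr = pqr" "br r pr qr = pqr" using F by (simp_all add: defs)
    obtain p' where p': "p' \<in> X" "br a p' q = pq" using solve_snd X by metis
    have "br r (br a p' r) qr = br r pr qr"
      using exchange1[of a p' q r] exchange2[of a p' q r] X E p' by auto
    then have "br a p' r = pr" using X p' closed cancel_snd by metis
    moreover have "br p' pq pr = pqr" using exchange1[of a p' q r] exchange2[of a p' q r] X E p' calculation by auto
    ultimately show ?thesis using 7 X p' by (intro bexI[of _ p']) (auto simp: cube_faces_def defs)
  next
    case 8
    then have E: "br p pq pr = pqr" "br q pq qr = pqr" "br r pr qr = pqr" using F by (simp_all add: defs)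
    \<comment> \<open>Here the corner \<open>a\<close>, from which the exchange axioms start, is
      itself unknown. Solving for \<open>a'\<close> and for an auxiliary \<open>r'\<close> makes
      them applicable; cancellation then gives the equation for \<open>qr\<close> and finally
      \<open>r' = r\<close>.\<close>
    obtain a' where a': "a' \<in> X" "br a' p q = pq" using solve_fst X by metis
    obtain r' where r': "r' \<in> X" "br a' p r' = pr" using solve_trd X a' by metis
    note ex = exchange1[of a' p q r'] exchange2[of a' p q r']
    have "br q pq (br a' q r') = br q pq qr" using ex X E a' r' by auto
    then have qr: "br a' q r' = qr" using X a' r' closed cancel_trd by metis
    have "br r' pr qr = br r pr qr" using ex X E a' r' qr by auto
    then have "r' = r" using X a' r' cancel_fst by metis
    then show ?thesis using 8 X a' r' qr by (intro bexI[of _ a']) (auto simp: cube_faces_def defs)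
  qed
qed

end

section \<open>The tribracket of a module\<close>

definition module_br ::
  "('r, 'm) ring_scheme \<Rightarrow> ('x \<Rightarrow> 'x \<Rightarrow> 'x \<Rightarrow> 'x) \<Rightarrow>
   ('x \<Rightarrow> 'x \<Rightarrow> 'x \<Rightarrow> 'r) \<Rightarrow> ('x \<Rightarrow> 'x \<Rightarrow> 'x \<Rightarrow> 'r) \<Rightarrow> 'x \<times> 'r \<Rightarrow> 'x \<times> 'r \<Rightarrow> 'x \<times> 'r \<Rightarrow> 'x \<times> 'r"
  where
  "module_br R br x y = (\<lambda>(a, r) (b, s) (c, t). (br a b c,
     (\<ominus>\<^bsub>R\<^esub> (x a b c \<otimes>\<^bsub>R\<^esub> y a b c \<otimes>\<^bsub>R\<^esub> r)) \<oplus>\<^bsub>R\<^esub> x a b c \<otimes>\<^bsub>R\<^esub> s \<oplus>\<^bsub>R\<^esub> y a b c \<otimes>\<^bsub>R\<^esub> t))"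

context cring
begin

lemma unit_minus:
  assumes "u \<in> Units R"
  shows "\<ominus> u \<in> Units R"
proof -
  have [simp]: "u \<in> carrier R" "inv u \<in> carrier R" using assms by auto
  have "\<ominus> u \<otimes> \<ominus> (inv u) = \<one>" "\<ominus> (inv u) \<otimes> \<ominus> u = \<one>"
    using assms by (simp_all add: l_minus r_minus)
  then show ?thesis
    unfolding Units_def by (auto intro!: bexI[of _ "\<ominus> (inv u)"])
qed

text \<open>Solvability in the \<open>R\<close>-coordinate: whichever argument of the bracket is
  unknown, its coefficient is a unit.\<close>

lemma unit_affine_unique:
  assumes u: "u \<in> Units R" and k: "k \<in> carrier R" and d: "d \<in> carrier R"
  shows "\<exists>!r. r \<in> carrier R \<and> u \<otimes> r \<oplus> k = d"
proof (rule ex_ex1I)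
  have [simp]: "u \<in> carrier R" "inv u \<in> carrier R" "d \<ominus> k \<in> carrier R" using assms by auto
  have "u \<otimes> (inv u \<otimes> (d \<ominus> k)) = d \<ominus> k"
    using u by (simp add: m_assoc[symmetric])
  then have "u \<otimes> (inv u \<otimes> (d \<ominus> k)) \<oplus> k = d"
    using k d by (simp add: a_minus_def a_assoc l_neg)
  then show "\<exists>r. r \<in> carrier R \<and> u \<otimes> r \<oplus> k = d"
    using u by (intro exI[of _ "inv u \<otimes> (d \<ominus> k)"]) simp
next
  fix r r' assume *: "r \<in> carrier R \<and> u \<otimes> r \<oplus> k = d" "r' \<in> carrier R \<and> u \<otimes> r' \<oplus> k = d"
  then have "u \<otimes> r = u \<otimes> r'"
    using add.right_cancel[of k "u \<otimes> r" "u \<otimes> r'"] assms by auto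
  then show "r = r'" using * u by (simp add: Units_l_cancel)
qed

end

context tribracket_module
begin

lemma x_closed: "\<lbrakk>a \<in> X; b \<in> X; c \<in> X\<rbrakk> \<Longrightarrow> x a b c \<in> carrier R"
  using x_unit Units_closed by blast

lemma y_closed: "\<lbrakk>a \<in> X; b \<in> X; c \<in> X\<rbrakk> \<Longrightarrow> y a b c \<in> carrier R"
  using y_unit Units_closed by blast

text \<open>All sides are linear in \<open>r\<close>, \<open>s\<close>, \<open>t\<close>,
  \<open>w\<close>. Comparing coefficients, the axioms \<open>xxy1\<close> and \<open>xxy2\<close>
  settle \<open>r\<close>, \<open>xx1\<close> and \<open>xx2\<close> settle \<open>s\<close>,
  \<open>xy1\<close> and \<open>xy2\<close> settle \<open>t\<close>, and \<open>yy1\<close> and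
  \<open>yy2\<close> settle \<open>w\<close>.\<close>

lemma module_br_exchange:
  assumes X: "a \<in> X" "b \<in> X" "c \<in> X" "d \<in> X"
    and R: "r \<in> carrier R" "s \<in> carrier R" "t \<in> carrier R" "w \<in> carrier R"
  defines "B \<equiv> module_br R br x y"
  shows "B (b, s) (B (a, r) (b, s) (c, t)) (B (a, r) (b, s) (d, w)) =
      B (c, t) (B (a, r) (b, s) (c, t)) (B (a, r) (c, t) (d, w))" (is "?L1 = ?R1")
    and "B (c, t) (B (a, r) (b, s) (c, t)) (B (a, r) (c, t) (d, w)) =
      B (d, w) (B (a, r) (b, s) (d, w)) (B (a, r) (c, t) (d, w))" (is "?L2 = ?R2")
proof -
  define xb yb xc yc xd yd where d1: "xb = x b (br a b c) (br a b d)" "yb = y b (br a b c) (br a b d)"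
    "xc = x c (br a b c) (br a c d)" "yc = y c (br a b c) (br a c d)"
    "xd = x d (br a b d) (br a c d)" "yd = y d (br a b d) (br a c d)"
  define p p' q q' m m' where d2: "p = x a b c" "p' = y a b c" "q = x a b d" "q' = y a b d"
    "m = x a c d" "m' = y a c d"
  have carr [simp]: "xb \<in> carrier R" "yb \<in> carrier R" "xc \<in> carrier R" "yc \<in> carrier R"
     "xd \<in> carrier R" "yd \<in> carrier R"
     "p \<in> carrier R" "p' \<in> carrier R" "q \<in> carrier R" "q' \<in> carrier R" "m \<in> carrier R" "m' \<in> carrier R"
    unfolding d1 d2 using X by (simp_all add: x_closed y_closed closed)
  note ax = xx1[OF X] xx2[OF X] yy1[OF X] yy2[OF X] xy1[OF X] xy2[OF X] xxy1[OF X] xxy2[OF X]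
  note ax = ax[folded d1, folded d2]
  have e1: "(\<ominus> (xb \<otimes> yb \<otimes> s)) \<oplus> xb \<otimes> ((\<ominus> (p \<otimes> p' \<otimes> r)) \<oplus> p \<otimes> s \<oplus> p' \<otimes> t)
       \<oplus> yb \<otimes> ((\<ominus> (q \<otimes> q' \<otimes> r)) \<oplus> q \<otimes> s \<oplus> q' \<otimes> w)
     = (\<ominus> ((xb \<otimes> p \<otimes> p' \<oplus> yb \<otimes> q \<otimes> q') \<otimes> r)) \<oplus> (xb \<otimes> p \<oplus> yb \<otimes> q \<ominus> xb \<otimes> yb) \<otimes> s
       \<oplus> (xb \<otimes> p') \<otimes> t \<oplus> (yb \<otimes> q') \<otimes> w"
    using R by (simp add: r_distr l_distr m_ac a_minus_def r_minus l_minus a_ac minus_add)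
  have e2: "(\<ominus> (xc \<otimes> yc \<otimes> t)) \<oplus> xc \<otimes> ((\<ominus> (p \<otimes> p' \<otimes> r)) \<oplus> p \<otimes> s \<oplus> p' \<otimes> t)
       \<oplus> yc \<otimes> ((\<ominus> (m \<otimes> m' \<otimes> r)) \<oplus> m \<otimes> t \<oplus> m' \<otimes> w)
     = (\<ominus> ((xc \<otimes> p \<otimes> p' \<oplus> yc \<otimes> m \<otimes> m') \<otimes> r)) \<oplus> (xc \<otimes> p) \<otimes> s
       \<oplus> (xc \<otimes> p' \<oplus> yc \<otimes> m \<ominus> xc \<otimes> yc) \<otimes> t \<oplus> (yc \<otimes> m') \<otimes> w"
    using R by (simp add: r_distr l_distr m_ac a_minus_def r_minus l_minus a_ac minus_add)
  have e3: "(\<ominus> (xd \<otimes> yd \<otimes> w)) \<oplus> xd \<otimes> ((\<ominus> (q \<otimes> q' \<otimes> r)) \<oplus> q \<otimes> s \<oplus> q' \<otimes> w)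
       \<oplus> yd \<otimes> ((\<ominus> (m \<otimes> m' \<otimes> r)) \<oplus> m \<otimes> t \<oplus> m' \<otimes> w)
     = (\<ominus> ((xd \<otimes> q \<otimes> q' \<oplus> yd \<otimes> m \<otimes> m') \<otimes> r)) \<oplus> (xd \<otimes> q) \<otimes> s
       \<oplus> (yd \<otimes> m) \<otimes> t \<oplus> (xd \<otimes> q' \<oplus> yd \<otimes> m' \<ominus> xd \<otimes> yd) \<otimes> w"
    using R by (simp add: r_distr l_distr m_ac a_minus_def r_minus l_minus a_ac minus_add)
  \<comment> \<open>In each expansion one coefficient is a trinomial. It is folded into the monomial
    that the module axioms equate it with, so that the remaining comparisons are between
    monomials.\<close>
  note e = e1[folded ax(2)] e2[folded ax(6)] e3[folded ax(4)]
  show "?L1 = ?R1"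
    unfolding B_def module_br_def prod.case d1[symmetric] d2[symmetric] e ax(7)
    by (simp only: ax(1,3,5) exchange1[OF X])
  show "?L2 = ?R2"
    unfolding B_def module_br_def prod.case d1[symmetric] d2[symmetric] e ax(7) ax(8)
    by (simp only: ax(1,3,5) exchange2[OF X])
qed

text \<open>The \<open>X\<close>-coordinate of an unknown is solved first: only then are the
  coefficients known, and the \<open>R\<close>-coordinate becomes the solution of an affine equation
  whose leading coefficient is \<open>\<ominus> (x a b c \<otimes> y a b c)\<close>,
  \<open>x a b c\<close> or \<open>y a b c\<close>.\<close>

lemma module_tribracket: "tribracket (X \<times> carrier R) (module_br R br x y)"
proof
  fix A B C D
  assume A: "A \<in> X \<times> carrier R" and B: "B \<in> X \<times> carrier R" and C: "C \<in> X \<times> carrier R"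
    and D: "D \<in> X \<times> carrier R"
  obtain a r b s c t d w where e: "A = (a, r)" "B = (b, s)" "C = (c, t)" "D = (d, w)"
    and X: "a \<in> X" "b \<in> X" "c \<in> X" "d \<in> X"
    and R: "r \<in> carrier R" "s \<in> carrier R" "t \<in> carrier R" "w \<in> carrier R"
    using A B C D by (cases A; cases B; cases C; cases D) auto
  show "module_br R br x y B (module_br R br x y A B C) (module_br R br x y A B D) =
      module_br R br x y C (module_br R br x y A B C) (module_br R br x y A C D)"
    unfolding e by (rule module_br_exchange(1)[OF X R])
  show "module_br R br x y C (module_br R br x y A B C) (module_br R br x y A C D) =
      module_br R br x y D (module_br R br x y A B D) (module_br R br x y A C D)"
    unfolding e by (rule module_br_exchange(2)[OF X R])
next
  fix A B C
  assume "A \<in> X \<times> carrier R" "B \<in> X \<times> carrier R" "C \<in> X \<times> carrier R"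
  then show "module_br R br x y A B C \<in> X \<times> carrier R"
    by (auto simp: module_br_def closed x_closed y_closed)
next
  fix B C D
  assume "B \<in> X \<times> carrier R" "C \<in> X \<times> carrier R" "D \<in> X \<times> carrier R"
  then obtain b s c t d w where e: "B = (b, s)" "C = (c, t)" "D = (d, w)"
    and [simp]: "b \<in> X" "c \<in> X" "d \<in> X" "s \<in> carrier R" "t \<in> carrier R" "w \<in> carrier R" by auto
  obtain a where a: "a \<in> X" "br a b c = d" "\<And>a'. a' \<in> X \<Longrightarrow> br a' b c = d \<Longrightarrow> a' = a"
    using unique_fst[OF \<open>b \<in> X\<close> \<open>c \<in> X\<close> \<open>d \<in> X\<close>] by blast
  have u: "\<ominus> (x a b c \<otimes> y a b c) \<in> Units R"
    using a(1) x_unit y_unit by (simp add: Units_m_closed unit_minus)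
  have [simp]: "x a b c \<in> carrier R" "y a b c \<in> carrier R" using a(1) x_closed y_closed by auto
  have U: "\<exists>!r. r \<in> carrier R \<and> (\<ominus> (x a b c \<otimes> y a b c)) \<otimes> r \<oplus> (x a b c \<otimes> s \<oplus> y a b c \<otimes> t) = w"
    by (rule unit_affine_unique[OF u]) simp_all
  obtain r where r: "r \<in> carrier R"
    "(\<ominus> (x a b c \<otimes> y a b c)) \<otimes> r \<oplus> (x a b c \<otimes> s \<oplus> y a b c \<otimes> t) = w"
    "\<And>r'. r' \<in> carrier R \<Longrightarrow> (\<ominus> (x a b c \<otimes> y a b c)) \<otimes> r' \<oplus> (x a b c \<otimes> s \<oplus> y a b c \<otimes> t) = w \<Longrightarrow> r' = r"
    using U by blast
  have eq: "(\<ominus> (x a b c \<otimes> y a b c)) \<otimes> r' \<oplus> (x a b c \<otimes> s \<oplus> y a b c \<otimes> t) =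
    \<ominus> (x a b c \<otimes> y a b c \<otimes> r') \<oplus> x a b c \<otimes> s \<oplus> y a b c \<otimes> t" if "r' \<in> carrier R" for r'
    using that by (simp add: l_minus a_assoc)
  show "\<exists>!A. A \<in> X \<times> carrier R \<and> module_br R br x y A B C = D"
  proof (rule ex1I)
    show "(a, r) \<in> X \<times> carrier R \<and> module_br R br x y (a, r) B C = D"
      using a(1,2) r(1,2) eq[OF r(1)] by (simp add: module_br_def e)
  next
    fix P assume P: "P \<in> X \<times> carrier R \<and> module_br R br x y P B C = D"
    obtain a' r' where P': "P = (a', r')" "a' \<in> X" "r' \<in> carrier R" using P by (cases P) auto
    then have "a' = a" using P a(3)[of a'] unfolding e module_br_def by simp
    then have "r' = r" using P P' r(3)[of r'] eq[of r'] unfolding e module_br_def by simp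
    then show "P = (a, r)" using P' \<open>a' = a\<close> by simp
  qed
next
  fix A C D
  assume "A \<in> X \<times> carrier R" "C \<in> X \<times> carrier R" "D \<in> X \<times> carrier R"
  then obtain a r c t d w where e: "A = (a, r)" "C = (c, t)" "D = (d, w)"
    and [simp]: "a \<in> X" "c \<in> X" "d \<in> X" "r \<in> carrier R" "t \<in> carrier R" "w \<in> carrier R" by auto
  obtain b where b: "b \<in> X" "br a b c = d" "\<And>b'. b' \<in> X \<Longrightarrow> br a b' c = d \<Longrightarrow> b' = b"
    using unique_snd[OF \<open>a \<in> X\<close> \<open>c \<in> X\<close> \<open>d \<in> X\<close>] by blast
  have [simp]: "x a b c \<in> carrier R" "y a b c \<in> carrier R" using b(1) x_closed y_closed by auto
  let ?k = "\<ominus> (x a b c \<otimes> y a b c \<otimes> r) \<oplus> y a b c \<otimes> t"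
  have U: "\<exists>!s. s \<in> carrier R \<and> x a b c \<otimes> s \<oplus> ?k = w"
    by (rule unit_affine_unique) (simp_all add: x_unit b(1))
  obtain s where s: "s \<in> carrier R" "x a b c \<otimes> s \<oplus> ?k = w"
    "\<And>s'. s' \<in> carrier R \<Longrightarrow> x a b c \<otimes> s' \<oplus> ?k = w \<Longrightarrow> s' = s"
    using U by blast
  have eq: "x a b c \<otimes> s' \<oplus> ?k =
    \<ominus> (x a b c \<otimes> y a b c \<otimes> r) \<oplus> x a b c \<otimes> s' \<oplus> y a b c \<otimes> t" if "s' \<in> carrier R" for s'
    using that by (simp add: a_ac)
  show "\<exists>!B. B \<in> X \<times> carrier R \<and> module_br R br x y A B C = D"
  proof (rule ex1I)
    show "(b, s) \<in> X \<times> carrier R \<and> module_br R br x y A (b, s) C = D"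
      using b(1,2) s(1,2) eq[OF s(1)] by (simp add: module_br_def e)
  next
    fix P assume P: "P \<in> X \<times> carrier R \<and> module_br R br x y A P C = D"
    obtain b' s' where P': "P = (b', s')" "b' \<in> X" "s' \<in> carrier R" using P by (cases P) auto
    then have "b' = b" using P b(3)[of b'] unfolding e module_br_def by simp
    then have "s' = s" using P P' s(3)[of s'] eq[of s'] unfolding e module_br_def by simp
    then show "P = (b, s)" using P' \<open>b' = b\<close> by simp
  qed
next
  fix A B D
  assume "A \<in> X \<times> carrier R" "B \<in> X \<times> carrier R" "D \<in> X \<times> carrier R"
  then obtain a r b s d w where e: "A = (a, r)" "B = (b, s)" "D = (d, w)"
    and [simp]: "a \<in> X" "b \<in> X" "d \<in> X" "r \<in> carrier R" "s \<in> carrier R" "w \<in> carrier R" by auto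
  obtain c where c: "c \<in> X" "br a b c = d" "\<And>c'. c' \<in> X \<Longrightarrow> br a b c' = d \<Longrightarrow> c' = c"
    using unique_trd[OF \<open>a \<in> X\<close> \<open>b \<in> X\<close> \<open>d \<in> X\<close>] by blast
  have [simp]: "x a b c \<in> carrier R" "y a b c \<in> carrier R" using c(1) x_closed y_closed by auto
  let ?k = "\<ominus> (x a b c \<otimes> y a b c \<otimes> r) \<oplus> x a b c \<otimes> s"
  have U: "\<exists>!t. t \<in> carrier R \<and> y a b c \<otimes> t \<oplus> ?k = w"
    by (rule unit_affine_unique) (simp_all add: y_unit c(1))
  obtain t where t: "t \<in> carrier R" "y a b c \<otimes> t \<oplus> ?k = w"
    "\<And>t'. t' \<in> carrier R \<Longrightarrow> y a b c \<otimes> t' \<oplus> ?k = w \<Longrightarrow> t' = t"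
    using U by blast
  have eq: "y a b c \<otimes> t' \<oplus> ?k =
    \<ominus> (x a b c \<otimes> y a b c \<otimes> r) \<oplus> x a b c \<otimes> s \<oplus> y a b c \<otimes> t'" if "t' \<in> carrier R" for t'
    using that by (simp add: a_ac)
  show "\<exists>!C. C \<in> X \<times> carrier R \<and> module_br R br x y A B C = D"
  proof (rule ex1I)
    show "(c, t) \<in> X \<times> carrier R \<and> module_br R br x y A B (c, t) = D"
      using c(1,2) t(1,2) eq[OF t(1)] by (simp add: module_br_def e)
  next
    fix P assume P: "P \<in> X \<times> carrier R \<and> module_br R br x y A B P = D"
    obtain c' t' where P': "P = (c', t')" "c' \<in> X" "t' \<in> carrier R" using P by (cases P) auto
    then have "c' = c" using P c(3)[of c'] unfolding e module_br_def by simp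
    then have "t' = t" using P P' t(3)[of t'] eq[of t'] unfolding e module_br_def by simp
    then show "P = (c, t)" using P' \<open>c' = c\<close> by simp
  qed
qed

end

section \<open>Link diagrams near their points\<close>

text \<open>A tube lemma for filters: finitely many of the given neighborhoods cover
  \<open>K\<close>, and finitely many events of \<open>F\<close> hold simultaneously.\<close>

lemma compact_eventually_ball:
  assumes "compact K" and "\<And>t. t \<in> K \<Longrightarrow> \<forall>\<^sub>F (t', y) in nhds t \<times>\<^sub>F F. P t' y"
  shows "\<forall>\<^sub>F y in F. \<forall>t\<in>K. P t y"
proof -
  have "\<exists>N Q. open N \<and> t \<in> N \<and> eventually Q F \<and> (\<forall>t'\<in>N. \<forall>y. Q y \<longrightarrow> P t' y)" if t: "t \<in> K" for t
  proof -
    obtain A Q where "eventually A (nhds t)" "eventually Q F" "\<And>t' y. A t' \<Longrightarrow> Q y \<Longrightarrow> P t' y"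
      using assms(2)[OF t] unfolding eventually_prod_filter by auto
    then show ?thesis by (metis eventually_nhds)
  qed
  then obtain N Q where N: "\<And>t. t \<in> K \<Longrightarrow> open (N t) \<and> t \<in> N t \<and> eventually (Q t) F \<and>
      (\<forall>t'\<in>N t. \<forall>y. Q t y \<longrightarrow> P t' y)" by metis
  obtain J where J: "J \<subseteq> K" "finite J" "K \<subseteq> (\<Union>t\<in>J. N t)"
    using compactE_image[OF \<open>compact K\<close>, of K N] N by blast
  have "\<forall>\<^sub>F y in F. \<forall>t\<in>J. Q t y"
    using J N by (intro eventually_ball_finite) auto
  then show ?thesis
    by eventually_elim (use J N in blast)
qed

lemma has_vector_derivative_slope:
  assumes "(k has_vector_derivative u) (at t)"
  shows "((\<lambda>s. (k s - k t) /\<^sub>R (s - t)) \<longlongrightarrow> u) (at t)"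
proof -
  have "((\<lambda>s. ((k s - k t) - (s - t) *\<^sub>R u) /\<^sub>R norm (s - t)) \<longlongrightarrow> 0) (at t)"
    using assms unfolding has_vector_derivative_def has_derivative_at_within by simp
  then have "((\<lambda>s. (k s - k t) /\<^sub>R (s - t) - u) \<longlongrightarrow> 0) (at t)"
    unfolding tendsto_iff dist_norm
  proof (rule all_forward, clarify)
    fix e :: real
    assume "\<forall>\<^sub>F s in at t. norm (((k s - k t) - (s - t) *\<^sub>R u) /\<^sub>R norm (s - t) - 0) < e"
    moreover have "\<forall>\<^sub>F s in at t. s \<noteq> t" by (simp add: eventually_at_filter)
    ultimately show "\<forall>\<^sub>F s in at t. norm ((k s - k t) /\<^sub>R (s - t) - u - 0) < e"
    proof eventually_elim
      case (elim s)
      then have "(k s - k t) /\<^sub>R (s - t) - u = ((k s - k t) - (s - t) *\<^sub>R u) /\<^sub>R (s - t)"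
        by (simp add: scaleR_right_diff_distrib)
      then show ?case using elim by simp
    qed
  qed
  then show ?thesis by (rule LIM_zero_cancel)
qed

lemma Im_cnj_sgn: "Im (cnj (sgn u) * v) = Im (cnj u * v) / norm u"
  by (simp add: sgn_div_norm divide_inverse algebra_simps)

text \<open>Away from \<open>p\<close> this is continuity. At \<open>p\<close> the slopes of the
  chords from \<open>p\<close> tend to \<open>u\<close>, whereas a point of the curve in direction
  \<open>w'\<close> would make \<open>w'\<close> a real multiple of such a slope; near
  \<open>w\<close> this is excluded. Letting \<open>w'\<close> vary gives a whole cone, not only a
  ray, and letting \<open>s\<close> vary prepares the compactness argument.\<close>

lemma immersed_curve_avoids_cone:
  fixes k :: "real \<Rightarrow> complex"
  assumes k: "(k has_vector_derivative u) (at t)" and w: "k t = p \<Longrightarrow> Im (cnj u * w) \<noteq> 0"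
  shows "\<forall>\<^sub>F (s, e, w') in nhds t \<times>\<^sub>F (at_right 0 \<times>\<^sub>F nhds w). k s \<noteq> p + of_real e * w'"
proof -
  let ?F = "nhds t \<times>\<^sub>F (at_right (0::real) \<times>\<^sub>F nhds w)"
  have fs: "filterlim fst (nhds t) ?F" by (rule filterlim_fst)
  have fe: "filterlim (\<lambda>z. fst (snd z)) (at_right 0) ?F"
    by (rule filterlim_compose[OF filterlim_fst filterlim_snd])
  have fe': "((\<lambda>z. fst (snd z)) \<longlongrightarrow> 0) ?F"
    using fe by (simp add: filterlim_at)
  have fw: "((\<lambda>z. snd (snd z)) \<longlongrightarrow> w) ?F"
    by (rule filterlim_compose[OF filterlim_snd filterlim_snd])
  have "isCont k t" using k has_vector_derivative_continuous by blast
  then have kc: "((\<lambda>z. k (fst z)) \<longlongrightarrow> k t) ?F"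
    using fs isCont_tendsto_compose by blast
  show ?thesis
  proof (cases "k t = p")
    case False
    have "((\<lambda>z. k (fst z) - (p + of_real (fst (snd z)) * snd (snd z))) \<longlongrightarrow> k t - (p + of_real 0 * w)) ?F"
      by (intro tendsto_intros kc fe' fw)
    then have "\<forall>\<^sub>F z in ?F. k (fst z) - (p + of_real (fst (snd z)) * snd (snd z)) \<noteq> 0"
      by (rule tendsto_imp_eventually_ne) (use False in simp)
    then show ?thesis by eventually_elim auto
  next
    case True
    \<comment> \<open>The chord slope, completed by the derivative, is continuous at
      \<open>t\<close>, so that \<open>s = t\<close> needs no separate treatment.\<close>
    define q where "q s = (if s = t then u else (k s - k t) /\<^sub>R (s - t))" for s
    have "(q \<longlongrightarrow> u) (at t)"
      by (rule Lim_transform_eventually[OF has_vector_derivative_slope[OF k]])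
        (auto simp: q_def eventually_at_filter)
    then have "isCont q t" by (simp add: isCont_def q_def)
    then have qc: "((\<lambda>z. q (fst z)) \<longlongrightarrow> q t) ?F"
      using fs isCont_tendsto_compose by blast
    have "((\<lambda>z. Im (cnj (q (fst z)) * snd (snd z))) \<longlongrightarrow> Im (cnj (q t) * w)) ?F"
      by (intro tendsto_intros qc fw)
    then have "\<forall>\<^sub>F z in ?F. Im (cnj (q (fst z)) * snd (snd z)) \<noteq> 0"
      by (rule tendsto_imp_eventually_ne) (use w[OF True] in \<open>simp add: q_def\<close>)
    moreover have "\<forall>\<^sub>F z in ?F. fst (snd z) > 0"
      using fe eventually_compose_filterlim[OF eventually_at_right_less fe] by blast
    ultimately show ?thesis
    proof eventually_elim
      case (elim z)
      obtain s e w' where z: "z = (s, e, w')" by (cases z) auto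
      have "k s \<noteq> p + of_real e * w'"
      proof
        assume "k s = p + of_real e * w'"
        then have "of_real e * w' = of_real (s - t) * q s"
          using True by (auto simp: q_def scaleR_conv_of_real)
        then have "cnj (q s) * (of_real e * w') = of_real (s - t) * (q s * cnj (q s))"
          by (simp add: mult_ac)
        then have "of_real e * (cnj (q s) * w') = of_real (s - t) * of_real ((cmod (q s))\<^sup>2)"
          by (simp only: complex_norm_square mult_ac)
        then have "Im (of_real e * (cnj (q s) * w')) = 0"
          by (metis Im_complex_of_real of_real_mult)
        then show False using elim z by simp
      qed
      then show ?case using z by simp
    qed
  qed
qed

section \<open>The point set of a link diagram\<close>

definition curve :: "diagram \<Rightarrow> complex set" where
  "curve D = fst ` tangents D"

lemma regions_eq: "regions D = components (- curve D)"
  by (simp add: regions_def curve_def)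

lemma tangents_projection: "tangents (projection P k h) = (\<lambda>q. (curve_point k q, curve_tangent k q)) ` P"
  by (auto simp: projection_def)

lemma overs_subset_projection: "overs (projection P k h) \<subseteq> tangents (projection P k h)"
  by (auto simp: projection_def)

lemma overs_subset: "link_diagram D \<Longrightarrow> overs D \<subseteq> tangents D"
  unfolding link_diagram_def Let_def using overs_subset_projection by blast

lemma link_diagramE:
  assumes "link_diagram D"
  obtains n :: nat and k h where "D = projection ({..<n} \<times> {0..<1}) k h"
    "\<And>i t. i < n \<Longrightarrow> (k i has_vector_derivative vector_derivative (k i) (at t)) (at t)"
    "\<And>i t. i < n \<Longrightarrow> vector_derivative (k i) (at t) \<noteq> 0"
    "\<And>i t. i < n \<Longrightarrow> k i (t + 1) = k i t"
    "\<And>q r. \<lbrakk>q \<in> {..<n} \<times> {0..<1}; r \<in> {..<n} \<times> {0..<1}; r \<noteq> q; curve_point k r = curve_point k q\<rbrakk> \<Longrightarrow>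
      \<not> parallel (curve_tangent k q) (curve_tangent k r) \<and>
      (\<forall>s\<in>{..<n} \<times> {0..<1}. curve_point k s = curve_point k q \<longrightarrow> s = q \<or> s = r)"
proof -
  obtain n :: nat and k h where *: "let P = {..<n} \<times> {0..<1} in
       D = projection P k h \<and>
       (\<forall>i<n. k i C1_differentiable_on UNIV \<and> continuous_on UNIV (h i) \<and>
          (\<forall>t. k i (t + 1) = k i t \<and> h i (t + 1) = h i t \<and>
               vector_derivative (k i) (at t) \<noteq> 0)) \<and>
       finite {curve_point k q | q. q \<in> P \<and> (\<exists>r\<in>P. r \<noteq> q \<and> curve_point k r = curve_point k q)} \<and>
       (\<forall>q\<in>P. \<forall>r\<in>P. r \<noteq> q \<and> curve_point k r = curve_point k q \<longrightarrow>
          \<not> parallel (curve_tangent k q) (curve_tangent k r) \<and>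
          h (fst q) (snd q) \<noteq> h (fst r) (snd r) \<and>
          (\<forall>s\<in>P. curve_point k s = curve_point k q \<longrightarrow> s = q \<or> s = r))"
    using assms unfolding link_diagram_def by blast
  show ?thesis
  proof (rule that)
    show "D = projection ({..<n} \<times> {0..<1}) k h" using * by (simp add: Let_def)
    show "(k i has_vector_derivative vector_derivative (k i) (at t)) (at t)" if "i < n" for i t
      using * that by (auto simp: Let_def C1_differentiable_on_eq vector_derivative_works)
    show "vector_derivative (k i) (at t) \<noteq> 0" "k i (t + 1) = k i t" if "i < n" for i t
      using * that by (auto simp: Let_def)
    show "\<not> parallel (curve_tangent k q) (curve_tangent k r) \<and>
        (\<forall>s\<in>{..<n} \<times> {0..<1}. curve_point k s = curve_point k q \<longrightarrow> s = q \<or> s = r)"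
      if "q \<in> {..<n} \<times> {0..<1}" "r \<in> {..<n} \<times> {0..<1}" "r \<noteq> q" "curve_point k r = curve_point k q" for q r
      using *[unfolded Let_def, THEN conjunct2, THEN conjunct2, THEN conjunct2] that by blast
  qed
qed

lemma link_diagram_norm_tangent: "link_diagram D \<Longrightarrow> (p, u) \<in> tangents D \<Longrightarrow> norm u = 1"
  by (erule link_diagramE) (auto simp: projection_def curve_tangent_def norm_sgn)

text \<open>The parameter \<open>q\<close> of the over-strand and the lower one \<open>r\<close>
  exhaust the preimage of \<open>p\<close>. The tangent \<open>v\<close> is not in
  \<open>overs D\<close>, so it cannot come from \<open>q\<close> and must come from
  \<open>r\<close>.\<close>

lemma link_diagram_crossing:
  assumes "link_diagram D" "is_crossing D p u v"
  shows "\<not> parallel u v" "(p, t) \<in> tangents D \<longleftrightarrow> t = u \<or> t = v"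
proof -
  obtain n :: nat and k h where D: "D = projection ({..<n} \<times> {0..<1}) k h"
    and x: "\<And>q r. \<lbrakk>q \<in> {..<n} \<times> {0..<1}; r \<in> {..<n} \<times> {0..<1}; r \<noteq> q; curve_point k r = curve_point k q\<rbrakk> \<Longrightarrow>
      \<not> parallel (curve_tangent k q) (curve_tangent k r) \<and>
      (\<forall>s\<in>{..<n} \<times> {0..<1}. curve_point k s = curve_point k q \<longrightarrow> s = q \<or> s = r)"
    using assms(1) by (rule link_diagramE) blast
  define P where "P = {..<n} \<times> {0..<(1::real)}"
  note D = D[folded P_def] and x = x[folded P_def]
  have "(p, u) \<in> overs D" using assms(2) by (simp add: is_crossing_def)
  then obtain q r where q: "q \<in> P" "r \<in> P" "p = curve_point k q" "u = curve_tangent k q"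
    "curve_point k r = curve_point k q" "h (fst r) (snd r) < h (fst q) (snd q)"
    by (auto simp: D projection_def)
  have "r \<noteq> q" using q by auto
  note x = x[OF q(1,2) this q(5)]
  have "(p, v) \<in> tangents D" "(p, v) \<notin> overs D" using assms(2) by (auto simp: is_crossing_def)
  moreover obtain s where s: "s \<in> P" "p = curve_point k s" "v = curve_tangent k s"
    using \<open>(p, v) \<in> tangents D\<close> by (auto simp: D projection_def)
  ultimately have "s \<noteq> q" using q \<open>(p, u) \<in> overs D\<close> by auto
  then have v: "v = curve_tangent k r" using s x q by metis
  show "\<not> parallel u v" using x v q by simp
  show "(p, t) \<in> tangents D \<longleftrightarrow> t = u \<or> t = v"
  proof
    assume "(p, t) \<in> tangents D"
    then obtain s where "s \<in> P" "p = curve_point k s" "t = curve_tangent k s"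
      by (auto simp: D projection_def)
    then show "t = u \<or> t = v" using x v q by metis
  next
    assume "t = u \<or> t = v"
    then have "(p, t) = (curve_point k q, curve_tangent k q) \<or> (p, t) = (curve_point k r, curve_tangent k r)"
      using q v by auto
    then show "(p, t) \<in> tangents D" using q(1,2) unfolding D tangents_projection by blast
  qed
qed

lemma link_diagram_curve:
  assumes "link_diagram D"
  shows "compact (curve D)"
    and "(\<And>u. (p, u) \<in> tangents D \<Longrightarrow> \<not> parallel u w) \<Longrightarrow>
      \<forall>\<^sub>F (e, w') in at_right 0 \<times>\<^sub>F nhds w. p + of_real e * w' \<notin> curve D"
proof -
  obtain n :: nat and k h where D: "D = projection ({..<n} \<times> {0..<1}) k h"
    and k: "\<And>i t. i < n \<Longrightarrow> (k i has_vector_derivative vector_derivative (k i) (at t)) (at t)"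
    and nz: "\<And>i t. i < n \<Longrightarrow> vector_derivative (k i) (at t) \<noteq> 0"
    and per: "\<And>i t. i < n \<Longrightarrow> k i (t + 1) = k i t"
    using assms by (rule link_diagramE) blast
  have "k i ` {0..1} = k i ` {0..<1}" if "i < n" for i
  proof -
    have "k i 1 = k i 0" using per[OF that, of 0] by simp
    moreover have "{0..1} = insert 1 {0..<1::real}" by auto
    ultimately show ?thesis by force
  qed
  moreover have "curve D = (\<Union>i<n. k i ` {0..<1})"
    unfolding D curve_def tangents_projection image_image by (force simp: curve_point_def)
  ultimately have C: "curve D = (\<Union>i<n. k i ` {0..1})" by simp
  have cont: "continuous_on A (k i)" if "i < n" for A i
    using k[OF that] by (meson continuous_at_imp_continuous_on has_vector_derivative_continuous)
  show "compact (curve D)"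
    unfolding C by (intro compact_UN compact_continuous_image cont) auto
  assume w: "\<And>u. (p, u) \<in> tangents D \<Longrightarrow> \<not> parallel u w"
  have "\<forall>\<^sub>F y in at_right 0 \<times>\<^sub>F nhds w. \<forall>t\<in>{0..1}. k i t \<noteq> p + of_real (fst y) * snd y" if i: "i < n" for i
  proof (rule compact_eventually_ball)
    fix t :: real assume t: "t \<in> {0..1}"
    have "Im (cnj (vector_derivative (k i) (at t)) * w) \<noteq> 0" if p: "k i t = p"
    proof -
      \<comment> \<open>Compactness requires the closed interval, but the parameters of a diagram
        are half-open: the endpoint \<open>1\<close> borrows its tangent from \<open>0\<close> by
        periodicity.\<close>
      obtain s where s: "s \<in> {0..<1}" "k i s = p" "vector_derivative (k i) (at s) = vector_derivative (k i) (at t)"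
      proof (cases "t = 1")
        case True
        have "vector_derivative (k i) (at (0 + 1)) = vector_derivative (k i) (at 0)"
        proof (rule vector_derivative_at)
          have "((\<lambda>s. s - 1) has_vector_derivative 1) (at (0 + 1 :: real))"
            by (auto intro!: derivative_eq_intros)
          from vector_diff_chain_at[OF this, of "k i"] k[OF i, of 0]
          have "(k i \<circ> (\<lambda>s. s - 1) has_vector_derivative vector_derivative (k i) (at 0)) (at (0 + 1))"
            by simp
          moreover have "k i \<circ> (\<lambda>s. s - 1) = k i"
            using per[OF i, of "s - 1" for s] by (simp add: fun_eq_iff)
          ultimately show "(k i has_vector_derivative vector_derivative (k i) (at 0)) (at (0 + 1))"
            by simp
        qed
        then show ?thesis using that[of 0] per[OF i, of 0] p True by simp
      next
        case False
        with t have "t \<in> {0..<1}" by auto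
        then show ?thesis using that p by blast
      qed
      have "(p, curve_tangent k (i, s)) \<in> tangents D"
        using s i by (auto simp: D projection_def curve_point_def intro!: exI[of _ i] exI[of _ s])
      then have "\<not> parallel (curve_tangent k (i, s)) w" by (rule w)
      then show ?thesis using nz[OF i, of t] s by (simp add: parallel_def curve_tangent_def Im_cnj_sgn)
    qed
    from immersed_curve_avoids_cone[OF k[OF i], of t p w, OF this]
    show "\<forall>\<^sub>F (t', y) in nhds t \<times>\<^sub>F (at_right 0 \<times>\<^sub>F nhds w). k i t' \<noteq> p + of_real (fst y) * snd y"
      by (simp add: case_prod_unfold)
  qed simp
  then have "\<forall>\<^sub>F y in at_right 0 \<times>\<^sub>F nhds w. \<forall>i\<in>{..<n}. \<forall>t\<in>{0..1}. k i t \<noteq> p + of_real (fst y) * snd y"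
    by (intro eventually_ball_finite) auto
  then show "\<forall>\<^sub>F (e, w') in at_right 0 \<times>\<^sub>F nhds w. p + of_real e * w' \<notin> curve D"
    by eventually_elim (force simp: C)
qed

section \<open>Regions around a point\<close>

lemma left_of_eq: "left_of u = {w. inner (\<i> * u) w > 0}"
  and right_of_eq: "right_of u = {w. inner (\<i> * u) w < 0}"
  by (auto simp: left_of_def right_of_def inner_complex_def mult.commute)

lemma convex_sides: "convex (left_of u)" "convex (right_of u)"
  by (simp_all add: left_of_eq right_of_eq convex_halfspace_gt convex_halfspace_lt)

lemma sectors_nonempty:
  assumes "\<not> parallel u v"
  shows "left_of u \<inter> left_of v \<noteq> {}" "right_of u \<inter> left_of v \<noteq> {}"
    "left_of u \<inter> right_of v \<noteq> {}" "right_of u \<inter> right_of v \<noteq> {}"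
proof -
  define d where "d = Im (cnj u * v)"
  have d: "d \<noteq> 0" using assms by (simp add: d_def parallel_def)
  \<comment> \<open>In terms of \<open>u\<close> and \<open>v\<close> the two forms that define the
    sides take the values \<open>b * d\<close> and \<open>- a * d\<close>, so the signs of
    \<open>a\<close> and \<open>b\<close> choose the sector.\<close>
  define z where "z a b = of_real a * u + of_real b * v" for a b
  have Im: "Im (cnj u * z a b) = b * d" "Im (cnj v * z a b) = - a * d" for a b
    by (simp_all add: z_def d_def algebra_simps)
  have "z (- 1 / d) (1 / d) \<in> left_of u \<inter> left_of v" "z (- 1 / d) (- 1 / d) \<in> right_of u \<inter> left_of v"
    "z (1 / d) (1 / d) \<in> left_of u \<inter> right_of v" "z (1 / d) (- 1 / d) \<in> right_of u \<inter> right_of v"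
    unfolding left_of_def right_of_def Int_iff mem_Collect_eq Im using d by simp_all
  then show "left_of u \<inter> left_of v \<noteq> {}" "right_of u \<inter> left_of v \<noteq> {}"
    "left_of u \<inter> right_of v \<noteq> {}" "right_of u \<inter> right_of v \<noteq> {}" by blast+
qed

lemma regions_unique: "\<lbrakk>\<rho> \<in> regions D; \<rho>' \<in> regions D; z \<in> \<rho>; z \<in> \<rho>'\<rbrakk> \<Longrightarrow> \<rho> = \<rho>'"
  unfolding regions_def using components_nonoverlap by blast

lemma eventually_at_right_0_happens:
  "\<lbrakk>eventually P (at_right (0::real)); eventually Q (at_right 0)\<rbrakk> \<Longrightarrow> \<exists>e. P e \<and> Q e"
  using eventually_happens'[OF trivial_limit_at_right_real, of "\<lambda>e. P e \<and> Q e" 0] eventually_conj by blast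

text \<open>A small cone without its apex is the continuous image of an interval times a disc. It is
  therefore connected and, being off the curve, contained in one component.\<close>

lemma cone_region:
  assumes D: "link_diagram D" and w: "\<And>u. (p, u) \<in> tangents D \<Longrightarrow> \<not> parallel u w"
  shows "\<exists>\<rho>\<in>regions D. \<forall>\<^sub>F (e, w') in at_right 0 \<times>\<^sub>F nhds w. p + of_real e * w' \<in> \<rho>"
proof -
  have "\<forall>\<^sub>F (e, w') in at_right 0 \<times>\<^sub>F nhds w. p + of_real e * w' \<notin> curve D"
    using link_diagram_curve(2)[OF D] w by blast
  then obtain A B where "eventually A (at_right (0::real))" "eventually B (nhds w)"
    and AB: "\<And>e w'. A e \<Longrightarrow> B w' \<Longrightarrow> p + of_real e * w' \<notin> curve D"
    unfolding eventually_prod_filter by auto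
  then obtain d r where d: "d > 0" "\<And>e. 0 < e \<Longrightarrow> e < d \<Longrightarrow> A e"
    and r: "r > 0" "\<And>w'. w' \<in> ball w r \<Longrightarrow> B w'"
    unfolding eventually_at_right_field eventually_nhds_metric by (auto simp: dist_commute)
  define K where "K = (\<lambda>(e, w'). p + of_real e * w') ` ({0<..<d} \<times> ball w r)"
  have "connected K" unfolding K_def
    by (intro connected_continuous_image connected_Times connected_ball)
      (auto simp: case_prod_unfold intro!: continuous_intros)
  moreover have "K \<subseteq> - curve D" using AB d r by (auto simp: K_def)
  moreover have "p + of_real (d / 2) * w \<in> K"
    unfolding K_def by (rule image_eqI[of _ _ "(d / 2, w)"]) (use d r in auto)
  ultimately obtain \<rho> where \<rho>: "\<rho> \<in> regions D" "K \<subseteq> \<rho>"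
    unfolding regions_eq using exists_component_superset[of K "- curve D"] by blast
  have "\<forall>\<^sub>F e in at_right 0. e \<in> {0<..<d}" using d eventually_at_right_real by blast
  moreover have "\<forall>\<^sub>F w' in nhds w. w' \<in> ball w r" using r by (intro eventually_nhds_in_open) auto
  moreover have "p + of_real e * w' \<in> \<rho>" if "e \<in> {0<..<d}" "w' \<in> ball w r" for e w'
  proof -
    have "(case (e, w') of (e, w') \<Rightarrow> p + of_real e * w') \<in> K"
      unfolding K_def using that by blast
    then show ?thesis using \<rho> by auto
  qed
  ultimately have "\<forall>\<^sub>F (e, w') in at_right 0 \<times>\<^sub>F nhds w. p + of_real e * w' \<in> \<rho>"
    unfolding eventually_prod_filter by blast
  then show ?thesis using \<rho> by blast
qed

text \<open>Each direction in \<open>Q\<close> leads into some region, and by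
  \<open>cone_region\<close> nearby directions lead into the same one; a locally constant choice on
  a connected sector is constant.\<close>

lemma sector_region:
  assumes D: "link_diagram D" and Q: "connected Q" "Q \<noteq> {}"
    and w: "\<And>w u. w \<in> Q \<Longrightarrow> (p, u) \<in> tangents D \<Longrightarrow> \<not> parallel u w"
  shows "\<exists>\<rho>. quadrant_region D p Q \<rho>"
proof -
  have "\<exists>\<rho>\<in>regions D. \<forall>\<^sub>F w' in nhds w. \<forall>\<^sub>F e in at_right (0::real). p + of_real e * w' \<in> \<rho>"
    if wQ: "w \<in> Q" for w
  proof -
    obtain \<rho> where "\<rho> \<in> regions D"
      "\<forall>\<^sub>F (e, w') in at_right 0 \<times>\<^sub>F nhds w. p + of_real e * w' \<in> \<rho>"
      using cone_region[OF D w[OF wQ]] by blast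
    then show ?thesis
      unfolding eventually_prod_filter by (intro bexI[of _ \<rho>]) (force elim: eventually_mono)+
  qed
  then obtain R where R: "\<And>w. w \<in> Q \<Longrightarrow> R w \<in> regions D"
      "\<And>w. w \<in> Q \<Longrightarrow> \<forall>\<^sub>F w' in nhds w. \<forall>\<^sub>F e in at_right (0::real). p + of_real e * w' \<in> R w"
    by metis
  have R': "\<forall>\<^sub>F e in at_right (0::real). p + of_real e * w \<in> R w" if "w \<in> Q" for w
    using R(2)[OF that] by (rule eventually_nhds_x_imp_x)
  obtain w0 where w0: "w0 \<in> Q" using Q by blast
  have "R w0 = R w" if "w \<in> Q" for w
  proof (rule connected_local_const[OF Q(1) w0 that], rule ballI)
    fix a assume a: "a \<in> Q"
    have "\<forall>\<^sub>F b in at a within Q. b \<in> Q \<and> (\<forall>\<^sub>F e in at_right (0::real). p + of_real e * b \<in> R a)"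
      using R(2)[OF a] by (auto simp: eventually_at_filter elim: eventually_mono)
    then show "\<forall>\<^sub>F b in at a within Q. R a = R b"
    proof eventually_elim
      case (elim b)
      then obtain e where "p + of_real e * b \<in> R a" "p + of_real e * b \<in> R b"
        using eventually_at_right_0_happens R'[of b] by blast
      then show ?case using regions_unique R(1) a elim by blast
    qed
  qed
  then show ?thesis
    using R(1)[OF w0] R' unfolding quadrant_region_def by (intro exI[of _ "R w0"]) auto
qed

lemma crossing_quadrant_regions:
  assumes D: "link_diagram D" and c: "is_crossing D p u v"
  shows "\<exists>\<rho>. quadrant_region D p (left_of u \<inter> left_of v) \<rho>"
    "\<exists>\<rho>. quadrant_region D p (right_of u \<inter> left_of v) \<rho>"
    "\<exists>\<rho>. quadrant_region D p (left_of u \<inter> right_of v) \<rho>"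
    "\<exists>\<rho>. quadrant_region D p (right_of u \<inter> right_of v) \<rho>"
  by (rule sector_region[OF D convex_connected]; (intro convex_Int convex_sides)?;
    use sectors_nonempty[OF link_diagram_crossing(1)[OF D c]] link_diagram_crossing(2)[OF D c] in
      \<open>force simp: parallel_def left_of_def right_of_def\<close>)+

lemma quadrant_region_unique:
  assumes "quadrant_region D p Q \<rho>" "quadrant_region D p Q \<rho>'" "Q \<noteq> {}"
  shows "\<rho> = \<rho>'"
proof -
  obtain w where "w \<in> Q" using assms(3) by blast
  then have "\<forall>\<^sub>F e in at_right (0::real). p + of_real e * w \<in> \<rho>"
    "\<forall>\<^sub>F e in at_right (0::real). p + of_real e * w \<in> \<rho>'"
    using assms(1,2) by (auto simp: quadrant_region_def)
  then show ?thesis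
    using eventually_at_right_0_happens regions_unique assms(1,2) unfolding quadrant_region_def by metis
qed

text \<open>\<open>quadrant_region\<close> speaks of straight rays only. The cone is what remains
  meaningful after a diffeomorphism, which turns rays into curves.\<close>

lemma quadrant_region_cone:
  assumes D: "link_diagram D" and q: "quadrant_region D p Q \<rho>" "w \<in> Q"
    and w: "\<And>u. (p, u) \<in> tangents D \<Longrightarrow> \<not> parallel u w"
  shows "\<forall>\<^sub>F (e, w') in at_right 0 \<times>\<^sub>F nhds w. p + of_real e * w' \<in> \<rho>"
proof -
  obtain \<rho>' where \<rho>': "\<rho>' \<in> regions D"
    "\<forall>\<^sub>F (e, w') in at_right 0 \<times>\<^sub>F nhds w. p + of_real e * w' \<in> \<rho>'"
    using cone_region[OF D w] by blast
  obtain A B where AB: "eventually A (at_right (0::real))" "eventually B (nhds w)"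
    "\<And>e w'. A e \<Longrightarrow> B w' \<Longrightarrow> p + of_real e * w' \<in> \<rho>'"
    using \<rho>'(2) unfolding eventually_prod_filter by auto
  have "B w" using AB(2) by (rule eventually_nhds_x_imp_x)
  moreover have "\<forall>\<^sub>F e in at_right (0::real). p + of_real e * w \<in> \<rho>"
    using q by (auto simp: quadrant_region_def)
  ultimately obtain e where "p + of_real e * w \<in> \<rho>" "p + of_real e * w \<in> \<rho>'"
    using eventually_at_right_0_happens[OF AB(1)] AB(3) by blast
  then have "\<rho> = \<rho>'" using regions_unique \<rho>'(1) q(1) unfolding quadrant_region_def by blast
  then show ?thesis using \<rho>'(2) by simp
qed

section \<open>Colorings as functions on the points of the complement\<close>

definition region_of :: "diagram \<Rightarrow> complex \<Rightarrow> complex set" where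
  "region_of D z = connected_component_set (- curve D) z"

lemma region_of_in_regions: "z \<notin> curve D \<Longrightarrow> region_of D z \<in> regions D"
  by (simp add: region_of_def regions_eq componentsI)

lemma mem_region_of: "z \<notin> curve D \<Longrightarrow> z \<in> region_of D z"
  by (simp add: region_of_def)

lemma region_of_eq:
  assumes "\<rho> \<in> regions D" "z \<in> \<rho>"
  shows "region_of D z = \<rho>" "z \<notin> curve D"
proof -
  show "z \<notin> curve D" using assms in_components_subset by (force simp: regions_eq)
  then show "region_of D z = \<rho>"
    using regions_unique region_of_in_regions mem_region_of assms by metis
qed

lemma regions_nonempty: "\<rho> \<in> regions D \<Longrightarrow> \<exists>z. z \<in> \<rho>"
  using in_components_nonempty by (fastforce simp: regions_eq)

text \<open>The equation is read off from points close to \<open>p\<close> in four given directions,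
  so it is local at \<open>p\<close> and does not mention regions; this is what lets it survive
  cutting and gluing.\<close>

definition crossing_equation ::
  "('x \<Rightarrow> 'x \<Rightarrow> 'x \<Rightarrow> 'x) \<Rightarrow> (complex \<Rightarrow> 'x) \<Rightarrow> complex \<Rightarrow> complex \<Rightarrow> complex \<Rightarrow> complex \<Rightarrow> complex \<Rightarrow> bool"
  where
  "crossing_equation br F p w1 w2 w3 w4 \<longleftrightarrow> (\<forall>\<^sub>F e in at_right (0::real).
     br (F (p + of_real e * w1)) (F (p + of_real e * w2)) (F (p + of_real e * w3)) = F (p + of_real e * w4))"

definition sector_vectors ::
  "complex \<Rightarrow> complex \<Rightarrow> complex \<Rightarrow> complex \<Rightarrow> complex \<Rightarrow> complex \<Rightarrow> bool" where
  "sector_vectors u v w1 w2 w3 w4 \<longleftrightarrow>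
     w1 \<in> left_of u \<inter> left_of v \<and> w2 \<in> right_of u \<inter> left_of v \<and>
     w3 \<in> left_of u \<inter> right_of v \<and> w4 \<in> right_of u \<inter> right_of v"

definition locally_constant_off :: "complex set \<Rightarrow> (complex \<Rightarrow> 'a) \<Rightarrow> bool" where
  "locally_constant_off C F \<longleftrightarrow> (\<forall>z\<in>- C. \<forall>\<^sub>F w in nhds z. F w = F z)"

text \<open>
  Colorings viewed as locally constant functions on the complement of the diagram, which can be
  glued.
\<close>

definition point_coloring ::
  "'x set \<Rightarrow> ('x \<Rightarrow> 'x \<Rightarrow> 'x \<Rightarrow> 'x) \<Rightarrow> diagram \<Rightarrow> (complex \<Rightarrow> 'x) \<Rightarrow> bool" where
  "point_coloring X br D F \<longleftrightarrow> F ` (- curve D) \<subseteq> X \<and> locally_constant_off (curve D) F \<and>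
     (\<forall>p u v w1 w2 w3 w4. is_crossing D p u v \<and> sector_vectors u v w1 w2 w3 w4 \<longrightarrow>
        crossing_equation br F p w1 w2 w3 w4)"

lemma locally_constant_off_connected:
  assumes "locally_constant_off C F" "connected A" "A \<subseteq> - C" "a \<in> A" "b \<in> A"
  shows "F a = F b"
proof (rule connected_local_const[OF assms(2,4,5)], rule ballI)
  fix z assume "z \<in> A"
  then have "\<forall>\<^sub>F w in nhds z. F w = F z" using assms by (auto simp: locally_constant_off_def)
  then show "\<forall>\<^sub>F w in at z within A. F z = F w"
    by (auto simp: eventually_at_filter elim: eventually_mono)
qed

lemma locally_constant_off_region:
  assumes "locally_constant_off (curve D) F" "\<rho> \<in> regions D" "a \<in> \<rho>" "b \<in> \<rho>"
  shows "F a = F b"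
proof -
  have "connected \<rho>" "\<rho> \<subseteq> - curve D"
    using assms(2) in_components_connected in_components_subset unfolding regions_eq by blast+
  then show ?thesis using locally_constant_off_connected assms by metis
qed

lemma open_regions:
  assumes "link_diagram D" "\<rho> \<in> regions D"
  shows "open \<rho>"
proof -
  have "open (- curve D)" using link_diagram_curve(1)[OF assms(1)] by (simp add: compact_imp_closed open_Compl)
  then show ?thesis using assms(2) by (auto simp: regions_eq intro: open_components)
qed

lemma coloring_imp_point_coloring:
  assumes D: "link_diagram D" and f: "f \<in> colorings X br D"
  shows "point_coloring X br D (\<lambda>z. f (region_of D z))"
  unfolding point_coloring_def
proof (intro conjI allI impI)
  show "(\<lambda>z. f (region_of D z)) ` (- curve D) \<subseteq> X"
    using f region_of_in_regions by (fastforce simp: colorings_def)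
  show "locally_constant_off (curve D) (\<lambda>z. f (region_of D z))"
    unfolding locally_constant_off_def
  proof
    fix z assume "z \<in> - curve D"
    then have z: "z \<in> region_of D z" "region_of D z \<in> regions D" using region_of_in_regions mem_region_of by auto
    then have "\<forall>\<^sub>F w in nhds z. w \<in> region_of D z" using open_regions[OF D] by (simp add: eventually_nhds_in_open)
    then show "\<forall>\<^sub>F w in nhds z. f (region_of D w) = f (region_of D z)"
      by eventually_elim (use z region_of_eq(1) in metis)
  qed
  fix p u v w1 w2 w3 w4
  assume *: "is_crossing D p u v \<and> sector_vectors u v w1 w2 w3 w4"
  then have c: "is_crossing D p u v" and s: "sector_vectors u v w1 w2 w3 w4" by auto
  obtain \<rho>1 \<rho>2 \<rho>3 \<rho>4 where \<rho>: "quadrant_region D p (left_of u \<inter> left_of v) \<rho>1"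
    "quadrant_region D p (right_of u \<inter> left_of v) \<rho>2"
    "quadrant_region D p (left_of u \<inter> right_of v) \<rho>3"
    "quadrant_region D p (right_of u \<inter> right_of v) \<rho>4"
    using crossing_quadrant_regions[OF D c] by blast
  then have "regions_at_crossing D \<rho>1 \<rho>2 \<rho>3 \<rho>4" using c unfolding regions_at_crossing_def by blast
  then have eq: "br (f \<rho>1) (f \<rho>2) (f \<rho>3) = f \<rho>4" using f by (auto simp: colorings_def)
  have "\<forall>\<^sub>F e in at_right (0::real). region_of D (p + of_real e * w) = \<rho>"
    if "quadrant_region D p Q \<rho>" "w \<in> Q" for w Q \<rho>
  proof -
    have "\<rho> \<in> regions D" "\<forall>\<^sub>F e in at_right (0::real). p + of_real e * w \<in> \<rho>"
      using that by (auto simp: quadrant_region_def)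
    from this(2) show ?thesis
      by eventually_elim (rule region_of_eq(1)[OF \<open>\<rho> \<in> regions D\<close>])
  qed
  note this[OF \<rho>(1), of w1] this[OF \<rho>(2), of w2] this[OF \<rho>(3), of w3] this[OF \<rho>(4), of w4]
  then have "\<forall>\<^sub>F e in at_right (0::real). region_of D (p + of_real e * w1) = \<rho>1"
    "\<forall>\<^sub>F e in at_right (0::real). region_of D (p + of_real e * w2) = \<rho>2"
    "\<forall>\<^sub>F e in at_right (0::real). region_of D (p + of_real e * w3) = \<rho>3"
    "\<forall>\<^sub>F e in at_right (0::real). region_of D (p + of_real e * w4) = \<rho>4"
    using s by (auto simp: sector_vectors_def)
  then show "crossing_equation br (\<lambda>z. f (region_of D z)) p w1 w2 w3 w4"
    unfolding crossing_equation_def by eventually_elim (use eq in simp)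
qed

lemma quadrant_region_value:
  assumes "locally_constant_off (curve D) F" "quadrant_region D p Q \<rho>" "w \<in> Q" "a \<in> \<rho>"
  shows "\<forall>\<^sub>F e in at_right (0::real). F (p + of_real e * w) = F a"
proof -
  have "\<forall>\<^sub>F e in at_right (0::real). p + of_real e * w \<in> \<rho>"
    using assms by (auto simp: quadrant_region_def)
  then show ?thesis
    by eventually_elim (use assms locally_constant_off_region in \<open>auto simp: quadrant_region_def\<close>)
qed

lemma crossing_equation_iff:
  assumes F: "locally_constant_off (curve D) F" and s: "sector_vectors u v w1 w2 w3 w4"
    and \<rho>: "quadrant_region D p (left_of u \<inter> left_of v) \<rho>1"
    "quadrant_region D p (right_of u \<inter> left_of v) \<rho>2"
    "quadrant_region D p (left_of u \<inter> right_of v) \<rho>3"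
    "quadrant_region D p (right_of u \<inter> right_of v) \<rho>4"
    and z: "z1 \<in> \<rho>1" "z2 \<in> \<rho>2" "z3 \<in> \<rho>3" "z4 \<in> \<rho>4"
  shows "crossing_equation br F p w1 w2 w3 w4 \<longleftrightarrow> br (F z1) (F z2) (F z3) = F z4"
proof -
  have w: "w1 \<in> left_of u \<inter> left_of v" "w2 \<in> right_of u \<inter> left_of v"
     "w3 \<in> left_of u \<inter> right_of v" "w4 \<in> right_of u \<inter> right_of v"
    using s by (auto simp: sector_vectors_def)
  note ev = quadrant_region_value[OF F \<rho>(1) w(1) z(1)] quadrant_region_value[OF F \<rho>(2) w(2) z(2)]
    quadrant_region_value[OF F \<rho>(3) w(3) z(3)] quadrant_region_value[OF F \<rho>(4) w(4) z(4)]
  then have "\<forall>\<^sub>F e in at_right (0::real).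
     (br (F (p + of_real e * w1)) (F (p + of_real e * w2)) (F (p + of_real e * w3)) = F (p + of_real e * w4))
     = (br (F z1) (F z2) (F z3) = F z4)"
    by eventually_elim simp
  then show ?thesis
    unfolding crossing_equation_def using eventually_at_right_0_happens
    by (auto elim: eventually_elim2)
qed

text \<open>\<open>point_coloring\<close> asks for every choice of directions in the sectors,
  whereas a labelling of the box provides one choice per crossing.\<close>

lemma crossing_equation_independent:
  assumes D: "link_diagram D" "is_crossing D p u v" and F: "locally_constant_off (curve D) F"
    and s: "sector_vectors u v w1 w2 w3 w4" "sector_vectors u v w1' w2' w3' w4'"
  shows "crossing_equation br F p w1 w2 w3 w4 \<longleftrightarrow> crossing_equation br F p w1' w2' w3' w4'"
proof -
  obtain \<rho>1 \<rho>2 \<rho>3 \<rho>4 where \<rho>: "quadrant_region D p (left_of u \<inter> left_of v) \<rho>1"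
    "quadrant_region D p (right_of u \<inter> left_of v) \<rho>2"
    "quadrant_region D p (left_of u \<inter> right_of v) \<rho>3"
    "quadrant_region D p (right_of u \<inter> right_of v) \<rho>4"
    using crossing_quadrant_regions[OF D] by blast
  then obtain z1 z2 z3 z4 where z: "z1 \<in> \<rho>1" "z2 \<in> \<rho>2" "z3 \<in> \<rho>3" "z4 \<in> \<rho>4"
    using regions_nonempty unfolding quadrant_region_def by metis
  show ?thesis using crossing_equation_iff[OF F s(1) \<rho> z] crossing_equation_iff[OF F s(2) \<rho> z] by metis
qed

text \<open>Regions are connected, so a locally constant function has a single value on each of them
  and the chosen representative point does not matter. This turns a glued function back into a
  coloring.\<close>

lemma point_coloring_imp_coloring:
  assumes D: "link_diagram D" and F: "point_coloring X br D F"
  shows "\<exists>f\<in>colorings X br D. \<forall>z\<in>- curve D. f (region_of D z) = F z"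
proof -
  have lc: "locally_constant_off (curve D) F" and FX: "F ` (- curve D) \<subseteq> X"
    using F by (auto simp: point_coloring_def)
  define f where "f = (\<lambda>\<rho>\<in>regions D. F (SOME z. z \<in> \<rho>))"
  have f: "f \<rho> = F z" if "\<rho> \<in> regions D" "z \<in> \<rho>" for \<rho> z
    using that locally_constant_off_region[OF lc that(1), of "SOME z. z \<in> \<rho>" z] someI[of "\<lambda>z. z \<in> \<rho>" z]
    by (simp add: f_def)
  have "f \<in> colorings X br D"
    unfolding colorings_def
  proof (intro CollectI conjI allI impI)
    show "f \<in> regions D \<rightarrow>\<^sub>E X"
    proof (rule PiE_I)
      fix \<rho> assume \<rho>: "\<rho> \<in> regions D"
      then obtain z where "z \<in> \<rho>" using regions_nonempty by blast
      then show "f \<rho> \<in> X" using f \<rho> FX region_of_eq(2) by force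
    qed (simp add: f_def)
    fix \<rho>1 \<rho>2 \<rho>3 \<rho>4 assume "regions_at_crossing D \<rho>1 \<rho>2 \<rho>3 \<rho>4"
    then obtain p u v where c: "is_crossing D p u v"
      and \<rho>: "quadrant_region D p (left_of u \<inter> left_of v) \<rho>1"
        "quadrant_region D p (right_of u \<inter> left_of v) \<rho>2"
        "quadrant_region D p (left_of u \<inter> right_of v) \<rho>3"
        "quadrant_region D p (right_of u \<inter> right_of v) \<rho>4"
      unfolding regions_at_crossing_def by blast
    have r: "\<rho>1 \<in> regions D" "\<rho>2 \<in> regions D" "\<rho>3 \<in> regions D" "\<rho>4 \<in> regions D"
      using \<rho> by (auto simp: quadrant_region_def)
    then obtain z1 z2 z3 z4 where z: "z1 \<in> \<rho>1" "z2 \<in> \<rho>2" "z3 \<in> \<rho>3" "z4 \<in> \<rho>4"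
      using regions_nonempty by metis
    obtain w1 w2 w3 w4 where s: "sector_vectors u v w1 w2 w3 w4"
      using sectors_nonempty[OF link_diagram_crossing(1)[OF D c]] unfolding sector_vectors_def by blast
    then have "crossing_equation br F p w1 w2 w3 w4" using F c unfolding point_coloring_def by blast
    then have "br (F z1) (F z2) (F z3) = F z4" using crossing_equation_iff[OF lc s \<rho> z] by blast
    then show "br (f \<rho>1) (f \<rho>2) (f \<rho>3) = f \<rho>4" using f r z by metis
  qed
  then show ?thesis using f region_of_in_regions mem_region_of by (metis ComplD)
qed

lemma coloring_eqI:
  assumes "f \<in> colorings X br D" "g \<in> colorings X' br' D"
    and "\<And>z. z \<notin> curve D \<Longrightarrow> f (region_of D z) = g (region_of D z)"
  shows "f = g"
proof (rule extensionalityI[of f "regions D"])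
  show "f \<in> extensional (regions D)" "g \<in> extensional (regions D)"
    using assms by (auto simp: colorings_def PiE_iff)
  fix \<rho> assume "\<rho> \<in> regions D"
  then show "f \<rho> = g \<rho>" using assms(3) regions_nonempty region_of_eq by metis
qed

section \<open>Planar isotopy\<close>

text \<open>\<open>Z\<close> is a relation because a region of one diagram may correspond to several
  regions of the other, or to none.\<close>

definition agree :: "('a \<times> 'b) set \<Rightarrow> ('a \<Rightarrow> 'c) \<Rightarrow> ('b \<Rightarrow> 'c) \<Rightarrow> bool" where
  "agree Z f f' \<longleftrightarrow> (\<forall>(\<rho>, \<rho>')\<in>Z. f \<rho> = f' \<rho>')"

lemma agree_converse [simp]: "agree (Z\<inverse>) f' f \<longleftrightarrow> agree Z f f'"
  by (force simp: agree_def)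

text \<open>\<open>Z\<close> is a parameter, separate from the tribracket, so that colorings by
  \<open>X\<close> and by \<open>X \<times> R\<close> can be transferred along the same
  correspondence.\<close>

definition transfers ::
  "(complex set \<times> complex set) set \<Rightarrow> 'x set \<Rightarrow> ('x \<Rightarrow> 'x \<Rightarrow> 'x \<Rightarrow> 'x) \<Rightarrow> diagram \<Rightarrow> diagram \<Rightarrow> bool" where
  "transfers Z X br D D' \<longleftrightarrow>
     (\<forall>f\<in>colorings X br D. \<exists>!f'. f' \<in> colorings X br D' \<and> agree Z f f')"

lemma homeomorphism_image_component:
  assumes h: "homeomorphism S T f g" and c: "c \<in> components S"
  shows "f ` c \<in> components T"
  unfolding in_components_maximal
proof (intro conjI allI impI)
  have inv: "\<And>x. x \<in> S \<Longrightarrow> g (f x) = x" "\<And>y. y \<in> T \<Longrightarrow> f (g y) = y"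
    using h by (simp_all add: homeomorphism_def)
  have c': "c \<noteq> {}" "c \<subseteq> S" "connected c" using c in_components_maximal by blast+
  show "f ` c \<noteq> {}" using c' by simp
  show "f ` c \<subseteq> T" using c' h by (auto simp: homeomorphism_def)
  show "connected (f ` c)"
    using c' h by (meson connected_continuous_image continuous_on_subset homeomorphism_def)
  fix d assume d: "d \<noteq> {} \<and> f ` c \<subseteq> d \<and> d \<subseteq> T \<and> connected d"
  have "connected (g ` d)"
    using d h by (meson connected_continuous_image continuous_on_subset homeomorphism_def)
  moreover have "g ` d \<subseteq> S" using d h by (auto simp: homeomorphism_def)
  moreover have "g ` f ` c \<subseteq> g ` d" using d by blast
  moreover have "g ` f ` c = c"
    unfolding image_image using inv(1) c'(2)
    by (simp add: image_cong[of c c "\<lambda>x. g (f x)" "\<lambda>x. x"] subset_iff)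
  moreover have "d' = c" if "d' \<noteq> {}" "c \<subseteq> d'" "d' \<subseteq> S" "connected d'" for d'
    using c that unfolding in_components_maximal by metis
  ultimately have "g ` d = c" using d by simp
  moreover have "f ` g ` d = d"
    unfolding image_image using inv(2) d
    by (simp add: image_cong[of d d "\<lambda>x. f (g x)" "\<lambda>x. x"] subset_iff)
  ultimately show "d = f ` c" by simp
qed

lemma homeomorphism_components:
  assumes "homeomorphism S T f g"
  shows "components T = image f ` components S"
proof (intro equalityI subsetI)
  fix c assume c: "c \<in> components T"
  then have "c \<subseteq> T" using in_components_subset by blast
  then have "f ` g ` c = c"
    unfolding image_image using assms
    by (simp add: homeomorphism_def image_cong[of c c "\<lambda>x. f (g x)" "\<lambda>x. x"] subset_iff)
  then show "c \<in> image f ` components S"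
    using homeomorphism_image_component[OF homeomorphism_symD[OF assms] c] by (metis imageI)
qed (use homeomorphism_image_component[OF assms] in auto)

section \<open>Linear maps of the plane and orientation\<close>

lemma linear_complex_eq:
  assumes "linear (A :: complex \<Rightarrow> complex)"
  shows "A w = of_real (Re w) * A 1 + of_real (Im w) * A \<i>"
proof -
  have "w = Re w *\<^sub>R 1 + Im w *\<^sub>R \<i>" by (simp add: complex_eq_iff)
  then have "A w = Re w *\<^sub>R A 1 + Im w *\<^sub>R A \<i>"
    by (metis assms linear_add linear_scale)
  then show ?thesis by (simp add: scaleR_conv_of_real)
qed

text \<open>\<open>Im (cnj u * w)\<close> is the oriented area spanned by \<open>u\<close> and
  \<open>w\<close>, which a linear map multiplies by its determinant; the factor on the right is
  that determinant.\<close>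

lemma Im_cnj_linear:
  assumes "linear (A :: complex \<Rightarrow> complex)"
  shows "Im (cnj (A u) * A w) = Im (cnj (A 1) * A \<i>) * Im (cnj u * w)"
  unfolding linear_complex_eq[OF assms, of u] linear_complex_eq[OF assms, of w]
  by (simp add: algebra_simps)

lemma inj_linear_complex_Im_ne_0:
  assumes A: "linear (A :: complex \<Rightarrow> complex)" "inj A"
  shows "Im (cnj (A 1) * A \<i>) \<noteq> 0"
proof
  assume 0: "Im (cnj (A 1) * A \<i>) = 0"
  \<comment> \<open>Up to sign, \<open>w\<close> and \<open>w'\<close> are the columns of the
    adjugate matrix, so \<open>A\<close> sends them to vectors whose only possibly nonzero
    coordinate is the determinant up to sign.\<close>
  define w where "w = Complex (Im (A \<i>)) (- Im (A 1))"
  define w' where "w' = Complex (Re (A \<i>)) (- Re (A 1))"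
  have "A w = of_real (Im (A \<i>)) * A 1 + of_real (- Im (A 1)) * A \<i>"
    "A w' = of_real (Re (A \<i>)) * A 1 + of_real (- Re (A 1)) * A \<i>"
    using linear_complex_eq[OF A(1), of w] linear_complex_eq[OF A(1), of w'] by (simp_all add: w_def w'_def)
  then have "A w = 0" "A w' = 0"
    using 0 by (simp_all add: complex_eq_iff algebra_simps)
  then have "w = 0" "w' = 0" using A by (metis inj_eq linear_0)+
  then have "A 1 = 0" by (simp add: w_def w'_def complex_eq_iff)
  then show False using A by (metis inj_eq linear_0 zero_neq_one)
qed

text \<open>Of the isotopy only its end map is kept, together with the positive determinant
  \<open>orient\<close>, by which left stays left.\<close>

locale diagram_diffeo =
  fixes D D' :: diagram and g :: "complex \<Rightarrow> complex" and g' :: "complex \<Rightarrow> complex \<Rightarrow> complex"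
  assumes D: "link_diagram D" and D': "link_diagram D'"
    and bij: "bij g" and deriv: "\<And>z. (g has_derivative g' z) (at z)"
    and orient: "\<And>z. Im (cnj (g' z 1) * g' z \<i>) > 0"
    and tangents: "tangents D' = transport g ` tangents D"
    and overs: "overs D' = transport g ` overs D"
begin

lemma lin: "linear (g' z)"
  using deriv has_derivative_linear by blast

lemma sides: "w \<in> left_of u \<longleftrightarrow> g' z w \<in> left_of (sgn (g' z u))"
    "w \<in> right_of u \<longleftrightarrow> g' z w \<in> right_of (sgn (g' z u))" if "norm u = 1"
proof -
  have "g' z u \<noteq> 0"
  proof
    assume 0: "g' z u = 0"
    have "Im (cnj (g' z u) * g' z (\<i> * u)) = Im (cnj (g' z 1) * g' z \<i>) * Im (cnj u * (\<i> * u))"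
      by (rule Im_cnj_linear[OF lin])
    moreover have "Im (cnj u * (\<i> * u)) = (norm u)\<^sup>2"
      unfolding cmod_power2 by (simp add: power2_eq_square)
    ultimately show False using 0 orient[of z] that by simp
  qed
  then have *: "Im (cnj (sgn (g' z u)) * g' z w) = Im (cnj (g' z 1) * g' z \<i>) / norm (g' z u) * Im (cnj u * w)" for w
    by (simp only: Im_cnj_sgn Im_cnj_linear[OF lin, of z u w] times_divide_eq_left)
  have **: "Im (cnj (g' z 1) * g' z \<i>) / norm (g' z u) > 0" using orient[of z] \<open>g' z u \<noteq> 0\<close> by simp
  have pos: "(0 < x \<longleftrightarrow> 0 < c * x) \<and> (x < 0 \<longleftrightarrow> c * x < 0)" if "c > 0" for c x :: real
    using that by (simp add: zero_less_mult_iff mult_less_0_iff not_less)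
  show "w \<in> left_of u \<longleftrightarrow> g' z w \<in> left_of (sgn (g' z u))"
    "w \<in> right_of u \<longleftrightarrow> g' z w \<in> right_of (sgn (g' z u))"
    unfolding left_of_def right_of_def mem_Collect_eq *
    using pos[OF **] by blast+
qed

lemma transport_eq: "transport g (p, u) = (g p, sgn (g' p u))"
  by (simp add: transport_def frechet_derivative_at[OF deriv, symmetric])

text \<open>Under-strands are a set difference, and only an injective map transports a difference to
  a difference. For unit tangents with the same image, preservation of sides puts \<open>u\<close>
  on neither side of \<open>v\<close> and \<open>\<i> * v\<close> to the left of both, which leaves
  \<open>u = v\<close>.\<close>

lemma inj_transport: "inj_on (transport g) (tangents D)"
proof (rule inj_onI, clarify)
  fix p u q v assume t: "(p, u) \<in> tangents D" "(q, v) \<in> tangents D" "transport g (p, u) = transport g (q, v)"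
  then have "q = p" using bij by (auto simp: transport_eq dest: bij_is_inj injD)
  have n: "norm u = 1" "norm v = 1" using t link_diagram_norm_tangent[OF D] by auto
  have e: "sgn (g' p u) = sgn (g' p v)" using t \<open>q = p\<close> by (simp add: transport_eq)
  have "Im (cnj v * u) \<le> 0" "Im (cnj v * u) \<ge> 0"
    using sides[OF n(1), of u p] sides[OF n(2), of u p] e by (auto simp: left_of_def right_of_def)
  then have 0: "Im (cnj v * u) = 0" by simp
  have iv: "\<i> * v \<in> left_of v" using n(2) by (simp add: left_of_def cmod_def power2_eq_square)
  then have "\<i> * v \<in> left_of u" using sides[OF n(1), of "\<i> * v" p] sides[OF n(2), of "\<i> * v" p] e by simp
  then have 1: "Re (cnj v * u) > 0" by (simp add: left_of_def algebra_simps)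
  have "norm (cnj v * u) = 1" using n by (simp add: norm_mult)
  then have "cnj v * u = 1" using 0 1 by (simp add: complex_eq_iff cmod_def power2_eq_1_iff)
  then have "v * cnj v * u = v" by (metis mult.assoc mult.right_neutral)
  then have "u = v" using n by (simp add: complex_norm_square[symmetric])
  then show "p = q \<and> u = v" using \<open>q = p\<close> by simp
qed

lemma is_crossing_transport:
  "is_crossing D p u v \<Longrightarrow> is_crossing D' (g p) (sgn (g' p u)) (sgn (g' p v))"
proof -
  assume c: "is_crossing D p u v"
  have "tangents D' - overs D' = transport g ` (tangents D - overs D)"
    unfolding tangents overs
    by (rule inj_on_image_set_diff[OF inj_transport, symmetric]) (use overs_subset[OF D] in auto)
  then show ?thesis using c unfolding is_crossing_def overs transport_eq[symmetric] by auto
qed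

lemma is_crossing_transportE:
  assumes "is_crossing D' p' u' v'"
  obtains p u v where "is_crossing D p u v" "p' = g p" "u' = sgn (g' p u)" "v' = sgn (g' p v)"
proof -
  obtain p u where u: "(p, u) \<in> overs D" "p' = g p" "u' = sgn (g' p u)"
    using assms by (auto simp: is_crossing_def overs transport_eq)
  obtain q v where v: "(q, v) \<in> tangents D" "p' = g q" "v' = sgn (g' q v)"
    using assms by (auto simp: is_crossing_def tangents transport_eq)
  have "(q, v) \<notin> overs D" using assms v by (force simp: is_crossing_def overs transport_eq[symmetric])
  moreover have "q = p" using u v bij by (metis bij_is_inj injD)
  ultimately show ?thesis using that[of p u v] u v by (auto simp: is_crossing_def)
qed

lemma continuous_g: "continuous_on A g"
  by (rule has_derivative_continuous_on[OF has_derivative_at_withinI[OF deriv]])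

lemma regions_image: "regions D' = image g ` regions D"
proof -
  have c: "curve D' = g ` curve D"
    by (force simp: curve_def tangents image_image transport_def)
  have inj: "inj g" using bij by (rule bij_is_inj)
  then have im: "g ` (- curve D) = - curve D'"
    using c bij by (metis bij_image_Compl_eq)
  have "open (- curve D)"
    using link_diagram_curve(1)[OF D] by (simp add: compact_imp_closed open_Compl)
  \<comment> \<open>Invariance of domain supplies the continuity of the inverse.\<close>
  then obtain gi where "homeomorphism (- curve D) (g ` (- curve D)) g gi"
    using invariance_of_domain_homeomorphism[OF _ continuous_g] inj inj_on_subset by (metis order_refl subset_UNIV)
  then show ?thesis
    using homeomorphism_components im by (simp add: regions_eq)
qed

text \<open>The image of a ray is a curve leaving \<open>g p\<close> with velocity
  \<open>g' p w\<close>. It eventually runs inside every cone around that direction, hence inside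
  the region of the image sector, and one common point identifies the two regions.\<close>

lemma quadrant_region_image:
  assumes c: "is_crossing D p u v" and Q: "Q \<in> {left_of u, right_of u}" "P \<in> {left_of v, right_of v}"
    and q: "quadrant_region D p (Q \<inter> P) \<rho>"
    and Q': "g' p ` (Q \<inter> P) \<subseteq> Q' \<inter> P'"
    and QP': "Q' \<in> {left_of (sgn (g' p u)), right_of (sgn (g' p u))}"
       "P' \<in> {left_of (sgn (g' p v)), right_of (sgn (g' p v))}"
  shows "quadrant_region D' (g p) (Q' \<inter> P') (g ` \<rho>)"
proof -
  note c' = is_crossing_transport[OF c]
  have "\<exists>\<rho>'. quadrant_region D' (g p) (Q' \<inter> P') \<rho>'"
    using crossing_quadrant_regions[OF D' c'] QP' by auto
  then obtain \<rho>' where \<rho>': "quadrant_region D' (g p) (Q' \<inter> P') \<rho>'" by blast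
  obtain w where w: "w \<in> Q \<inter> P"
    using sectors_nonempty[OF link_diagram_crossing(1)[OF D c]] Q by auto
  have w': "g' p w \<in> Q' \<inter> P'" using w Q' by blast
  have np: "\<not> parallel u (g' p w)" if "(g p, u) \<in> tangents D'" for u
    using that w' QP' link_diagram_crossing(2)[OF D' c']
    by (auto simp: left_of_def right_of_def parallel_def)
  have cone: "\<forall>\<^sub>F (e, w') in at_right 0 \<times>\<^sub>F nhds (g' p w). g p + of_real e * w' \<in> \<rho>'"
    by (rule quadrant_region_cone[OF D' \<rho>' w' np])
  have "((\<lambda>e. g (p + e *\<^sub>R w)) has_vector_derivative g' p w) (at 0)"
  proof -
    have "((\<lambda>e. p + e *\<^sub>R w) has_derivative (\<lambda>e. e *\<^sub>R w)) (at 0)"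
      by (auto intro!: derivative_eq_intros)
    from diff_chain_at[OF this, of g "g' p"] deriv[of p]
    have "((\<lambda>e. g (p + e *\<^sub>R w)) has_derivative (\<lambda>e. g' p (e *\<^sub>R w))) (at 0)"
      by (simp add: comp_def)
    then show ?thesis by (simp add: has_vector_derivative_def linear_scale[OF lin])
  qed
  from has_vector_derivative_slope[OF this]
  have "((\<lambda>e. (g (p + of_real e * w) - g p) /\<^sub>R e) \<longlongrightarrow> g' p w) (at 0)"
    by (simp add: scaleR_conv_of_real)
  then have "((\<lambda>e. (g (p + of_real e * w) - g p) /\<^sub>R e) \<longlongrightarrow> g' p w) (at_right 0)"
    using filterlim_at_split by blast
  then have "filterlim (\<lambda>e. (e, (g (p + of_real e * w) - g p) /\<^sub>R e)) (at_right 0 \<times>\<^sub>F nhds (g' p w)) (at_right 0)"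
    by (intro filterlim_Pair filterlim_ident)
  from eventually_compose_filterlim[OF cone this]
  have "\<forall>\<^sub>F e in at_right 0. g p + of_real e * ((g (p + of_real e * w) - g p) /\<^sub>R e) \<in> \<rho>'" by simp
  moreover have "\<forall>\<^sub>F e in at_right 0. (e::real) > 0" by (rule eventually_at_right_less)
  moreover have "\<forall>\<^sub>F e in at_right (0::real). p + of_real e * w \<in> \<rho>"
    using q w by (auto simp: quadrant_region_def)
  ultimately have "\<forall>\<^sub>F e in at_right (0::real). g (p + of_real e * w) \<in> \<rho>' \<and> p + of_real e * w \<in> \<rho>"
    by eventually_elim (simp add: scaleR_conv_of_real mult.assoc[symmetric])
  then obtain e where "g (p + of_real e * w) \<in> \<rho>'" "p + of_real e * w \<in> \<rho>"
    using eventually_at_right_0_happens by blast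
  moreover have "g ` \<rho> \<in> regions D'" using q regions_image by (auto simp: quadrant_region_def)
  ultimately have "g ` \<rho> = \<rho>'" using regions_unique \<rho>' unfolding quadrant_region_def by blast
  then show ?thesis using \<rho>' by simp
qed

lemma regions_at_crossing_quadrants:
  assumes c: "is_crossing D p u v"
    and \<rho>: "quadrant_region D p (left_of u \<inter> left_of v) \<rho>1"
    "quadrant_region D p (right_of u \<inter> left_of v) \<rho>2"
    "quadrant_region D p (left_of u \<inter> right_of v) \<rho>3"
    "quadrant_region D p (right_of u \<inter> right_of v) \<rho>4"
  defines "u' \<equiv> sgn (g' p u)" and "v' \<equiv> sgn (g' p v)"
  shows "quadrant_region D' (g p) (left_of u' \<inter> left_of v') (g ` \<rho>1)"
    "quadrant_region D' (g p) (right_of u' \<inter> left_of v') (g ` \<rho>2)"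
    "quadrant_region D' (g p) (left_of u' \<inter> right_of v') (g ` \<rho>3)"
    "quadrant_region D' (g p) (right_of u' \<inter> right_of v') (g ` \<rho>4)"
proof -
  have n: "norm u = 1" "norm v = 1"
    using c link_diagram_norm_tangent[OF D] overs_subset[OF D] by (auto simp: is_crossing_def)
  show "quadrant_region D' (g p) (left_of u' \<inter> left_of v') (g ` \<rho>1)"
    by (rule quadrant_region_image[OF c _ _ \<rho>(1)]) (use sides[OF n(1)] sides[OF n(2)] in \<open>auto simp: u'_def v'_def\<close>)
  show "quadrant_region D' (g p) (right_of u' \<inter> left_of v') (g ` \<rho>2)"
    by (rule quadrant_region_image[OF c _ _ \<rho>(2)]) (use sides[OF n(1)] sides[OF n(2)] in \<open>auto simp: u'_def v'_def\<close>)
  show "quadrant_region D' (g p) (left_of u' \<inter> right_of v') (g ` \<rho>3)"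
    by (rule quadrant_region_image[OF c _ _ \<rho>(3)]) (use sides[OF n(1)] sides[OF n(2)] in \<open>auto simp: u'_def v'_def\<close>)
  show "quadrant_region D' (g p) (right_of u' \<inter> right_of v') (g ` \<rho>4)"
    by (rule quadrant_region_image[OF c _ _ \<rho>(4)]) (use sides[OF n(1)] sides[OF n(2)] in \<open>auto simp: u'_def v'_def\<close>)
qed

lemma regions_at_crossing_image:
  "regions_at_crossing D' \<rho>1' \<rho>2' \<rho>3' \<rho>4' \<longleftrightarrow>
    (\<exists>\<rho>1 \<rho>2 \<rho>3 \<rho>4. regions_at_crossing D \<rho>1 \<rho>2 \<rho>3 \<rho>4 \<and>
      \<rho>1' = g ` \<rho>1 \<and> \<rho>2' = g ` \<rho>2 \<and> \<rho>3' = g ` \<rho>3 \<and> \<rho>4' = g ` \<rho>4)"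
proof
  assume "regions_at_crossing D' \<rho>1' \<rho>2' \<rho>3' \<rho>4'"
  then obtain p' u' v' where c': "is_crossing D' p' u' v'"
    and \<rho>': "quadrant_region D' p' (left_of u' \<inter> left_of v') \<rho>1'"
     "quadrant_region D' p' (right_of u' \<inter> left_of v') \<rho>2'"
     "quadrant_region D' p' (left_of u' \<inter> right_of v') \<rho>3'"
     "quadrant_region D' p' (right_of u' \<inter> right_of v') \<rho>4'"
    unfolding regions_at_crossing_def by blast
  obtain p u v where c: "is_crossing D p u v" and e: "p' = g p" "u' = sgn (g' p u)" "v' = sgn (g' p v)"
    by (rule is_crossing_transportE[OF c'])
  obtain \<rho>1 \<rho>2 \<rho>3 \<rho>4 where \<rho>: "quadrant_region D p (left_of u \<inter> left_of v) \<rho>1"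
    "quadrant_region D p (right_of u \<inter> left_of v) \<rho>2"
    "quadrant_region D p (left_of u \<inter> right_of v) \<rho>3"
    "quadrant_region D p (right_of u \<inter> right_of v) \<rho>4"
    using crossing_quadrant_regions[OF D c] by blast
  note i = regions_at_crossing_quadrants[OF c \<rho>, folded e]
  have "regions_at_crossing D \<rho>1 \<rho>2 \<rho>3 \<rho>4" using c \<rho> unfolding regions_at_crossing_def by blast
  moreover note ne = sectors_nonempty[OF link_diagram_crossing(1)[OF D' c']]
  have "\<rho>1' = g ` \<rho>1" "\<rho>2' = g ` \<rho>2" "\<rho>3' = g ` \<rho>3" "\<rho>4' = g ` \<rho>4"
    using quadrant_region_unique[OF \<rho>'(1) i(1) ne(1)] quadrant_region_unique[OF \<rho>'(2) i(2) ne(2)]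
     quadrant_region_unique[OF \<rho>'(3) i(3) ne(3)] quadrant_region_unique[OF \<rho>'(4) i(4) ne(4)] by auto
  ultimately show "\<exists>\<rho>1 \<rho>2 \<rho>3 \<rho>4. regions_at_crossing D \<rho>1 \<rho>2 \<rho>3 \<rho>4 \<and>
      \<rho>1' = g ` \<rho>1 \<and> \<rho>2' = g ` \<rho>2 \<and> \<rho>3' = g ` \<rho>3 \<and> \<rho>4' = g ` \<rho>4" by blast
next
  assume "\<exists>\<rho>1 \<rho>2 \<rho>3 \<rho>4. regions_at_crossing D \<rho>1 \<rho>2 \<rho>3 \<rho>4 \<and>
      \<rho>1' = g ` \<rho>1 \<and> \<rho>2' = g ` \<rho>2 \<and> \<rho>3' = g ` \<rho>3 \<and> \<rho>4' = g ` \<rho>4"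
  then obtain \<rho>1 \<rho>2 \<rho>3 \<rho>4 p u v where c: "is_crossing D p u v"
    and \<rho>: "quadrant_region D p (left_of u \<inter> left_of v) \<rho>1"
    "quadrant_region D p (right_of u \<inter> left_of v) \<rho>2"
    "quadrant_region D p (left_of u \<inter> right_of v) \<rho>3"
    "quadrant_region D p (right_of u \<inter> right_of v) \<rho>4"
    and e: "\<rho>1' = g ` \<rho>1" "\<rho>2' = g ` \<rho>2" "\<rho>3' = g ` \<rho>3" "\<rho>4' = g ` \<rho>4"
    unfolding regions_at_crossing_def by blast
  show "regions_at_crossing D' \<rho>1' \<rho>2' \<rho>3' \<rho>4'"
    unfolding regions_at_crossing_def e
    using is_crossing_transport[OF c] regions_at_crossing_quadrants[OF c \<rho>] by blast
qed

definition region_pairs :: "(complex set \<times> complex set) set" where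
  "region_pairs = (\<lambda>\<rho>. (\<rho>, g ` \<rho>)) ` regions D"

lemma colorings_agree:
  assumes "f \<in> regions D \<rightarrow>\<^sub>E X" "f' \<in> regions D' \<rightarrow>\<^sub>E X" "agree region_pairs f f'"
  shows "f \<in> colorings X br D \<longleftrightarrow> f' \<in> colorings X br D'"
proof -
  have e: "f' (g ` \<rho>) = f \<rho>" if "\<rho> \<in> regions D" for \<rho>
    using assms(3) that by (auto simp: agree_def region_pairs_def)
  have r: "\<rho>1 \<in> regions D \<and> \<rho>2 \<in> regions D \<and> \<rho>3 \<in> regions D \<and> \<rho>4 \<in> regions D"
    if "regions_at_crossing D \<rho>1 \<rho>2 \<rho>3 \<rho>4" for \<rho>1 \<rho>2 \<rho>3 \<rho>4
    using that by (auto simp: regions_at_crossing_def quadrant_region_def)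
  show ?thesis
    using assms(1,2) e r unfolding colorings_def mem_Collect_eq regions_at_crossing_image
    by (smt (verit, best))
qed

lemma transfers_diffeo: "transfers region_pairs X br D D'" "transfers (region_pairs\<inverse>) X br D' D"
proof -
  have inj: "inj_on (image g) A" for A
    using bij by (meson bij_is_inj inj_image_eq_iff inj_onI)
  show "transfers region_pairs X br D D'"
    unfolding transfers_def
  proof (intro ballI ex1I conjI)
    fix f assume f: "f \<in> colorings X br D"
    then have f0: "f \<in> regions D \<rightarrow>\<^sub>E X" by (simp add: colorings_def)
    define f' where "f' = (\<lambda>\<rho>'\<in>regions D'. f (the_inv_into (regions D) (image g) \<rho>'))"
    have e: "f' (g ` \<rho>) = f \<rho>" if "\<rho> \<in> regions D" for \<rho>
      using that by (simp add: f'_def regions_image the_inv_into_f_f[OF inj])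
    have "f' \<in> regions D' \<rightarrow>\<^sub>E X"
      using e f0 by (auto simp: regions_image f'_def the_inv_into_f_f[OF inj])
    moreover show a: "agree region_pairs f f'" using e by (auto simp: agree_def region_pairs_def)
    ultimately show "f' \<in> colorings X br D'" using colorings_agree f f0 by blast
    fix h assume h: "h \<in> colorings X br D' \<and> agree region_pairs f h"
    show "h = f'"
    proof (rule extensionalityI[of _ "regions D'"])
      fix \<rho>' assume "\<rho>' \<in> regions D'"
      then obtain \<rho> where "\<rho> \<in> regions D" "\<rho>' = g ` \<rho>" by (auto simp: regions_image)
      then show "h \<rho>' = f' \<rho>'" using h e by (auto simp: agree_def region_pairs_def)
    qed (use h in \<open>auto simp: colorings_def PiE_iff f'_def\<close>)
  qed
  show "transfers (region_pairs\<inverse>) X br D' D"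
    unfolding transfers_def agree_converse
  proof (intro ballI ex1I conjI)
    fix f' assume f': "f' \<in> colorings X br D'"
    then have f0: "f' \<in> regions D' \<rightarrow>\<^sub>E X" by (simp add: colorings_def)
    define f where "f = (\<lambda>\<rho>\<in>regions D. f' (g ` \<rho>))"
    have "f \<in> regions D \<rightarrow>\<^sub>E X"
      using f0 by (auto simp: f_def regions_image)
    moreover show "agree region_pairs f f'" by (auto simp: agree_def region_pairs_def f_def)
    ultimately show "f \<in> colorings X br D" using colorings_agree f' f0 by blast
    fix h assume h: "h \<in> colorings X br D \<and> agree region_pairs h f'"
    show "h = f"
      by (rule extensionalityI[of _ "regions D"])
       (use h in \<open>auto simp: colorings_def PiE_iff f_def agree_def region_pairs_def\<close>)
  qed
qed

end

text \<open>The Jacobian determinant of \<open>H t\<close> at \<open>z\<close> is continuous in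
  \<open>t\<close>, positive at \<open>t = 0\<close> where \<open>H t\<close> is the identity, and
  never zero because the derivatives are bijective; by the intermediate value theorem it is positive
  at \<open>t = 1\<close>.\<close>

lemma ambient_isotopy_orientation:
  assumes "ambient_isotopy H"
  obtains g' where "\<And>z. (H 1 has_derivative g' z) (at z)" "\<And>z. Im (cnj (g' z 1) * g' z \<i>) > 0"
proof -
  from assms have H0: "\<And>z. H 0 z = z"
    and ex: "\<exists>H'. (\<forall>t\<in>{0..1}. \<forall>z. (H t has_derivative H' t z) (at z) \<and> bij (H' t z)) \<and>
      (\<forall>w. continuous_on ({0..1} \<times> UNIV) (\<lambda>(t, z). H' t z w))"
    unfolding ambient_isotopy_def by auto
  obtain H' where "\<forall>t\<in>{0..1}. \<forall>z. (H t has_derivative H' t z) (at z) \<and> bij (H' t z)"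
    and cont': "\<forall>w. continuous_on ({0..1} \<times> UNIV) (\<lambda>(t, z). H' t z w)"
    using ex by (elim exE conjE) (rule that)
  then have H': "\<And>t z. t \<in> {0..1} \<Longrightarrow> (H t has_derivative H' t z) (at z) \<and> bij (H' t z)" by blast
  have cont: "\<And>w. continuous_on ({0..1} \<times> UNIV) (\<lambda>(t, z). H' t z w)" using cont' by (rule spec)
  have "Im (cnj (H' 1 z 1) * H' 1 z \<i>) > 0" for z
  proof (rule ccontr)
    let ?j = "\<lambda>t. Im (cnj (H' t z 1) * H' t z \<i>)"
    have c: "continuous_on {0..1} (\<lambda>t. H' t z w)" for w
    proof -
      have "continuous_on {0..1} (\<lambda>t::real. (t, z))" by (intro continuous_intros)
      from continuous_on_compose2[OF cont this] show ?thesis by (simp add: image_subset_iff)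
    qed
    have "H 0 = (\<lambda>z. z)" using H0 by blast
    then have "((\<lambda>z. z) has_derivative H' 0 z) (at z)" using H'[of 0 z] by simp
    then have "H' 0 z = (\<lambda>z. z)" by (rule has_derivative_unique[OF _ has_derivative_ident])
    then have j0: "0 \<le> ?j 0" by simp
    assume "\<not> ?j 1 > 0"
    then have j1: "?j 1 \<le> 0" by (simp only: not_less)
    have "continuous_on {0..1} ?j" by (intro continuous_intros c)
    from IVT2'[of ?j 1 0 0, OF j1 j0 _ this]
    obtain t where t: "0 \<le> t" "t \<le> 1" "?j t = 0" by auto
    then have "(H t has_derivative H' t z) (at z)" "bij (H' t z)" using H'[of t z] by simp_all
    then show False
      using inj_linear_complex_Im_ne_0[OF has_derivative_linear bij_is_inj] t(3) by blast
  qed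
  then show ?thesis using that[of "H' 1"] H'[of 1] by simp
qed

lemma planar_isotopic_transfers:
  assumes "link_diagram D" "link_diagram D'" "planar_isotopic D D'"
  obtains g g' where "diagram_diffeo D D' g g'"
proof -
  obtain H where H: "ambient_isotopy H"
    "tangents D' = transport (H 1) ` tangents D" "overs D' = transport (H 1) ` overs D"
    using assms(3) unfolding planar_isotopic_def by blast
  obtain g' where "\<And>z. (H 1 has_derivative g' z) (at z)" "\<And>z. Im (cnj (g' z 1) * g' z \<i>) > 0"
    using ambient_isotopy_orientation[OF H(1)] by blast
  moreover have "bij (H 1)" using H(1) by (auto simp: ambient_isotopy_def)
  ultimately have "diagram_diffeo D D' (H 1) g'" using assms H by unfold_locales auto
  then show ?thesis by (rule that)
qed

section \<open>Replacing a diagram inside a box\<close>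

text \<open>For every move, the curves before and after it coincide outside this square. The frame
  between it and the boundary of the box is where the two sides of a move are compared.\<close>

definition core :: "complex set" where
  "core = {z. \<bar>Re z\<bar> \<le> 1 \<and> \<bar>Im z\<bar> \<le> 1}"

definition open_box :: "complex set" where
  "open_box = {z. \<bar>Re z\<bar> < 2 \<and> \<bar>Im z\<bar> < 3}"

lemma open_open_box: "open open_box"
proof -
  have eq: "open_box = {z. \<bar>Re z\<bar> < 2} \<inter> {z. \<bar>Im z\<bar> < 3}" by (auto simp: open_box_def)
  show ?thesis unfolding eq by (intro open_Int open_Collect_less continuous_intros)
qed

lemma closed_core: "closed core"
proof -
  have eq: "core = {z. \<bar>Re z\<bar> \<le> 1} \<inter> {z. \<bar>Im z\<bar> \<le> 1}" by (auto simp: core_def)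
  show ?thesis unfolding eq by (intro closed_Int closed_Collect_le continuous_intros)
qed

lemma core_subset_open_box: "core \<subseteq> open_box" and open_box_subset_move_box: "open_box \<subseteq> move_box"
  by (auto simp: core_def open_box_def move_box_def)

definition crossing_labels ::
  "(complex \<Rightarrow> 'l) \<Rightarrow> complex \<Rightarrow> complex \<Rightarrow> complex \<Rightarrow> 'l \<times> 'l \<times> 'l \<times> 'l \<Rightarrow> bool" where
  "crossing_labels lab p u v = (\<lambda>(l1, l2, l3, l4). \<exists>w1 w2 w3 w4. sector_vectors u v w1 w2 w3 w4 \<and>
     (\<forall>\<^sub>F e in at_right (0::real). lab (p + of_real e * w1) = l1 \<and> lab (p + of_real e * w2) = l2 \<and>
        lab (p + of_real e * w3) = l3 \<and> lab (p + of_real e * w4) = l4))"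

text \<open>
  The fibres of \<open>lab\<close> are the regions of the diagram within the move box, and \<open>K\<close> lists the label
  quadruples around its crossings there.
\<close>

definition box_labelling :: "diagram \<Rightarrow> (complex \<Rightarrow> 'l) \<Rightarrow> ('l \<times> 'l \<times> 'l \<times> 'l) set \<Rightarrow> bool" where
  "box_labelling D lab K \<longleftrightarrow>
     (\<forall>z\<in>open_box - curve D. \<forall>\<^sub>F w in nhds z. lab w = lab z) \<and>
     (\<forall>l. connected {z \<in> open_box - curve D. lab z = l}) \<and>
     (\<forall>p u v. is_crossing D p u v \<and> p \<in> move_box \<longrightarrow> p \<in> open_box \<and> (\<exists>q\<in>K. crossing_labels lab p u v q)) \<and>
     (\<forall>q\<in>K. \<exists>p u v. is_crossing D p u v \<and> p \<in> open_box \<and> crossing_labels lab p u v q)"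

definition satisfies :: "('x \<Rightarrow> 'x \<Rightarrow> 'x \<Rightarrow> 'x) \<Rightarrow> ('l \<times> 'l \<times> 'l \<times> 'l) set \<Rightarrow> ('l \<Rightarrow> 'x) \<Rightarrow> bool" where
  "satisfies br K G \<longleftrightarrow> (\<forall>(l1, l2, l3, l4)\<in>K. br (G l1) (G l2) (G l3) = G l4)"

lemma eventually_ray_open:
  fixes A :: "complex set"
  assumes "open A" "p \<in> A"
  shows "\<forall>\<^sub>F e in at_right (0::real). p + of_real e * w \<in> A"
proof -
  have "((\<lambda>e::real. p + of_real e * w) \<longlongrightarrow> p + of_real 0 * w) (at_right 0)"
    by (intro tendsto_intros)
  then show ?thesis using topological_tendstoD assms by fastforce
qed

lemma eventually_ray_off_curve:
  assumes D: "link_diagram D" and c: "is_crossing D p u v" and s: "sector_vectors u v w1 w2 w3 w4"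
  shows "\<forall>\<^sub>F e in at_right (0::real). p + of_real e * w1 \<notin> curve D \<and> p + of_real e * w2 \<notin> curve D \<and>
     p + of_real e * w3 \<notin> curve D \<and> p + of_real e * w4 \<notin> curve D"
proof -
  have ev: "\<forall>\<^sub>F e in at_right (0::real). p + of_real e * w \<notin> curve D"
    if "\<exists>\<rho>. quadrant_region D p Q \<rho>" "w \<in> Q" for w Q
    using that region_of_eq(2) by (auto simp: quadrant_region_def elim!: eventually_mono dest!: bspec)
  have w: "w1 \<in> left_of u \<inter> left_of v" "w2 \<in> right_of u \<inter> left_of v"
     "w3 \<in> left_of u \<inter> right_of v" "w4 \<in> right_of u \<inter> right_of v"
    using s by (auto simp: sector_vectors_def)
  note q = crossing_quadrant_regions[OF D c]
  show ?thesis
    using ev[OF q(1) w(1)] ev[OF q(2) w(2)] ev[OF q(3) w(3)] ev[OF q(4) w(4)]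
    by eventually_elim blast
qed

lemma crossing_equation_labels:
  assumes D: "link_diagram D" and c: "is_crossing D p u v" "p \<in> open_box"
    and FG: "\<And>z. z \<in> open_box - curve D \<Longrightarrow> F z = G (lab z)"
    and q: "crossing_labels lab p u v (l1, l2, l3, l4)"
  shows "\<exists>w1 w2 w3 w4. sector_vectors u v w1 w2 w3 w4 \<and>
    (crossing_equation br F p w1 w2 w3 w4 \<longleftrightarrow> br (G l1) (G l2) (G l3) = G l4)"
proof -
  obtain w1 w2 w3 w4 where s: "sector_vectors u v w1 w2 w3 w4"
    and l: "\<forall>\<^sub>F e in at_right (0::real). lab (p + of_real e * w1) = l1 \<and> lab (p + of_real e * w2) = l2 \<and>
        lab (p + of_real e * w3) = l3 \<and> lab (p + of_real e * w4) = l4"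
    using q by (auto simp: crossing_labels_def)
  note ray = eventually_ray_open[OF open_open_box c(2)]
  have "\<forall>\<^sub>F e in at_right (0::real).
     (br (F (p + of_real e * w1)) (F (p + of_real e * w2)) (F (p + of_real e * w3)) = F (p + of_real e * w4))
     = (br (G l1) (G l2) (G l3) = G l4)"
    using l eventually_ray_off_curve[OF D c(1) s] ray[of w1] ray[of w2] ray[of w3] ray[of w4]
    by eventually_elim (simp add: FG)
  then have "crossing_equation br F p w1 w2 w3 w4 \<longleftrightarrow> br (G l1) (G l2) (G l3) = G l4"
    unfolding crossing_equation_def using eventually_at_right_0_happens
    by (auto elim: eventually_elim2)
  then show ?thesis using s by blast
qed

lemma point_coloring_labels:
  assumes D: "link_diagram D" and L: "box_labelling D lab K" and F: "point_coloring X br D F"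
  shows "\<exists>G. range G \<subseteq> X \<and> satisfies br K G \<and> (\<forall>z\<in>open_box - curve D. F z = G (lab z))"
proof -
  have lc: "locally_constant_off (curve D) F" and FX: "F ` (- curve D) \<subseteq> X"
    using F by (auto simp: point_coloring_def)
  have "curve D \<noteq> UNIV"
    using link_diagram_curve(1)[OF D] not_compact_UNIV[where 'a = complex] by metis
  then obtain z0 where z0: "z0 \<notin> curve D" by blast
  \<comment> \<open>Labels that do not occur still need a value in \<open>X\<close>. The point
    \<open>z0\<close> for this default exists because the curve is compact and the plane is
    not.\<close>
  define G where "G l = (if \<exists>z\<in>open_box - curve D. lab z = l
     then F (SOME z. z \<in> open_box - curve D \<and> lab z = l) else F z0)" for l
  have FG: "F z = G (lab z)" if "z \<in> open_box - curve D" for z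
  proof -
    let ?A = "{z' \<in> open_box - curve D. lab z' = lab z}"
    have "(SOME z'. z' \<in> open_box - curve D \<and> lab z' = lab z) \<in> ?A"
      using someI[of "\<lambda>z'. z' \<in> open_box - curve D \<and> lab z' = lab z" z] that by simp
    moreover have "connected ?A" using L by (simp add: box_labelling_def)
    ultimately have "F z = F (SOME z'. z' \<in> open_box - curve D \<and> lab z' = lab z)"
      using that by (intro locally_constant_off_connected[OF lc, of ?A]) auto
    then show ?thesis using that by (auto simp: G_def)
  qed
  have "G l \<in> X" for l
  proof (cases "\<exists>z\<in>open_box - curve D. lab z = l")
    case True
    then obtain z where "z \<in> open_box - curve D" "lab z = l" by blast
    then show ?thesis using FG FX by force
  next
    case False
    then show ?thesis using z0 FX by (auto simp: G_def)
  qed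
  moreover have "satisfies br K G"
    unfolding satisfies_def
  proof clarify
    fix l1 l2 l3 l4 assume "(l1, l2, l3, l4) \<in> K"
    then obtain p u v where c: "is_crossing D p u v" "p \<in> open_box" "crossing_labels lab p u v (l1, l2, l3, l4)"
      using L unfolding box_labelling_def by blast
    then obtain w1 w2 w3 w4 where s: "sector_vectors u v w1 w2 w3 w4"
      "crossing_equation br F p w1 w2 w3 w4 \<longleftrightarrow> br (G l1) (G l2) (G l3) = G l4"
      using crossing_equation_labels[where F = F and G = G and lab = lab, OF D c(1,2) FG c(3)] by blast
    then show "br (G l1) (G l2) (G l3) = G l4" using F c unfolding point_coloring_def by blast
  qed
  ultimately show ?thesis using FG by blast
qed

text \<open>A common point in the core does not count: the picture changes there, and one point may
  lie in unrelated regions of the two diagrams.\<close>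

definition common_region_pairs :: "diagram \<Rightarrow> diagram \<Rightarrow> (complex set \<times> complex set) set" where
  "common_region_pairs D D' =
     {(\<rho>, \<rho>'). \<rho> \<in> regions D \<and> \<rho>' \<in> regions D' \<and> (\<exists>z\<in>\<rho> \<inter> \<rho>'. z \<notin> core)}"

lemma common_region_pairs_swap: "common_region_pairs D' D = (common_region_pairs D D')\<inverse>"
  by (auto simp: common_region_pairs_def)

section \<open>Gluing colorings along the frame of the box\<close>

locale local_replacement =
  fixes D D' :: diagram and lab :: "complex \<Rightarrow> 'l" and K and lab' :: "complex \<Rightarrow> 'k" and K'
  assumes D: "link_diagram D" and D': "link_diagram D'"
    and outer: "restrict_diagram (- move_box) D = restrict_diagram (- move_box) D'"
    and curve: "\<And>z. z \<in> move_box \<Longrightarrow> z \<notin> core \<Longrightarrow> z \<in> curve D \<longleftrightarrow> z \<in> curve D'"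
    and L: "box_labelling D lab K" and L': "box_labelling D' lab' K'"
begin

lemma outer_tangents: "p \<notin> move_box \<Longrightarrow> (p, u) \<in> tangents D \<longleftrightarrow> (p, u) \<in> tangents D'"
  and outer_overs: "p \<notin> move_box \<Longrightarrow> (p, u) \<in> overs D \<longleftrightarrow> (p, u) \<in> overs D'"
  using outer by (auto simp: restrict_diagram_def set_eq_iff)

lemma curve_off_core: "z \<notin> core \<Longrightarrow> z \<in> curve D \<longleftrightarrow> z \<in> curve D'"
proof (cases "z \<in> move_box")
  case False
  then show ?thesis using outer_tangents by (force simp: curve_def)
qed (simp add: curve)

lemma outer_crossing: "p \<notin> move_box \<Longrightarrow> is_crossing D p u v \<longleftrightarrow> is_crossing D' p u v"
  by (simp add: is_crossing_def outer_tangents outer_overs)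

lemma agree_common_region_pairs:
  "agree (common_region_pairs D D') f f' \<longleftrightarrow>
    (\<forall>z. z \<notin> core \<and> z \<notin> curve D \<longrightarrow> f (region_of D z) = f' (region_of D' z))"
proof (intro iffI allI impI)
  fix z assume a: "agree (common_region_pairs D D') f f'" and z: "z \<notin> core \<and> z \<notin> curve D"
  then have "(region_of D z, region_of D' z) \<in> common_region_pairs D D'"
    unfolding common_region_pairs_def using curve_off_core region_of_in_regions mem_region_of by auto
  then show "f (region_of D z) = f' (region_of D' z)" using a by (auto simp: agree_def)
next
  assume *: "\<forall>z. z \<notin> core \<and> z \<notin> curve D \<longrightarrow> f (region_of D z) = f' (region_of D' z)"
  show "agree (common_region_pairs D D') f f'"
    unfolding agree_def
  proof clarify
    fix \<rho> \<rho>' assume "(\<rho>, \<rho>') \<in> common_region_pairs D D'"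
    then obtain z where z: "z \<in> \<rho>" "z \<in> \<rho>'" "z \<notin> core" "\<rho> \<in> regions D" "\<rho>' \<in> regions D'"
      by (auto simp: common_region_pairs_def)
    then show "f \<rho> = f' \<rho>'" using * region_of_eq by metis
  qed
qed

text \<open>Inside the open box the new function is given by labels, outside it is the old one. Both
  descriptions hold on the frame off the core, so the new function stays locally constant across the
  boundary of the box; crossings outside the box only see the old function.\<close>

lemma glue_point_coloring:
  assumes F: "point_coloring X br D F" and FG: "\<And>z. z \<in> open_box - curve D \<Longrightarrow> F z = G (lab z)"
    and G': "range G' \<subseteq> X" "satisfies br K' G'"
    and GG': "\<And>z. z \<in> open_box - curve D \<Longrightarrow> z \<notin> core \<Longrightarrow> G' (lab' z) = G (lab z)"
  defines "F' \<equiv> \<lambda>z. if z \<in> open_box then G' (lab' z) else F z"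
  shows "point_coloring X br D' F'" "\<And>z. z \<notin> core \<Longrightarrow> z \<notin> curve D \<Longrightarrow> F' z = F z"
proof -
  show F'F: "F' z = F z" if "z \<notin> core" "z \<notin> curve D" for z
    using that FG GG' by (simp add: F'_def)
  have lc: "locally_constant_off (curve D) F" and FX: "F ` (- curve D) \<subseteq> X"
    using F by (auto simp: point_coloring_def)
  have op: "open (- curve D)" using link_diagram_curve(1)[OF D] by (simp add: compact_imp_closed open_Compl)
  have lc': "locally_constant_off (curve D') F'"
    unfolding locally_constant_off_def
  proof
    fix z assume z: "z \<in> - curve D'"
    show "\<forall>\<^sub>F w in nhds z. F' w = F' z"
    proof (cases "z \<in> open_box")
      case True
      then have "\<forall>\<^sub>F w in nhds z. lab' w = lab' z" using L' z by (simp add: box_labelling_def)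
      moreover have "\<forall>\<^sub>F w in nhds z. w \<in> open_box" using True open_open_box eventually_nhds_in_open by blast
      ultimately show ?thesis by eventually_elim (use True in \<open>simp add: F'_def\<close>)
    next
      case False
      then have zc: "z \<notin> core" "z \<notin> curve D" using core_subset_open_box curve_off_core z by auto
      have "\<forall>\<^sub>F w in nhds z. F w = F z" using lc zc by (simp add: locally_constant_off_def)
      moreover have "\<forall>\<^sub>F w in nhds z. w \<in> - core \<inter> - curve D"
        using zc op closed_core by (intro eventually_nhds_in_open) auto
      ultimately show ?thesis by eventually_elim (use zc F'F in auto)
    qed
  qed
  have X: "F' ` (- curve D') \<subseteq> X"
  proof -
    have "z \<notin> curve D" if "z \<notin> open_box" "z \<notin> curve D'" for z
      using that core_subset_open_box curve_off_core by blast
    then show ?thesis using G'(1) FX by (auto simp: F'_def)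
  qed
  have "crossing_equation br F' p w1 w2 w3 w4"
    if c: "is_crossing D' p u v" and s: "sector_vectors u v w1 w2 w3 w4" for p u v w1 w2 w3 w4
  proof (cases "p \<in> move_box")
    case True
    then obtain l1 l2 l3 l4 where l: "p \<in> open_box" "(l1, l2, l3, l4) \<in> K'"
      "crossing_labels lab' p u v (l1, l2, l3, l4)"
      using L' c unfolding box_labelling_def by (metis prod_cases4)
    have "F' z = G' (lab' z)" if "z \<in> open_box - curve D'" for z using that by (simp add: F'_def)
    from crossing_equation_labels[where F = F' and G = G' and lab = lab' and br = br, OF D' c l(1) this l(3)]
    obtain v1 v2 v3 v4 where v: "sector_vectors u v v1 v2 v3 v4"
      "crossing_equation br F' p v1 v2 v3 v4 \<longleftrightarrow> br (G' l1) (G' l2) (G' l3) = G' l4" by blast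
    have "br (G' l1) (G' l2) (G' l3) = G' l4" using G'(2) l(2) by (auto simp: satisfies_def)
    then show ?thesis using crossing_equation_independent[OF D' c lc' s v(1)] v(2) by blast
  next
    case False
    then have cD: "is_crossing D p u v" using c outer_crossing by blast
    then have e: "crossing_equation br F p w1 w2 w3 w4" using F s unfolding point_coloring_def by blast
    have "p \<in> - core" using False core_subset_open_box open_box_subset_move_box by blast
    note ray = eventually_ray_open[OF open_Compl[OF closed_core] this]
    show ?thesis
      using e ray[of w1] ray[of w2] ray[of w3] ray[of w4] eventually_ray_off_curve[OF D cD s]
      unfolding crossing_equation_def by eventually_elim (simp add: F'F)
  qed
  then show "point_coloring X br D' F'"
    using lc' X unfolding point_coloring_def by blast
qed

text \<open>\<open>ext\<close> colors the labels of the new picture, and the result is glued to the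
  old coloring. By \<open>uniq\<close>, two colorings of the new diagram that agree off the core
  also agree inside. What remains for each move is a finite problem on labels, apart from knowing
  which labels occur outside the core.\<close>

theorem transfers_common_region_pairs:
  assumes ext: "\<And>G. range G \<subseteq> X \<Longrightarrow> satisfies br K G \<Longrightarrow>
      \<exists>G'. range G' \<subseteq> X \<and> satisfies br K' G' \<and> (\<forall>z\<in>open_box - core - curve D. G' (lab' z) = G (lab z))"
    and uniq: "\<And>G G' z. \<lbrakk>range G \<subseteq> X; satisfies br K' G; range G' \<subseteq> X; satisfies br K' G';
      \<And>z. z \<in> open_box - core - curve D' \<Longrightarrow> G (lab' z) = G' (lab' z); z \<in> open_box - curve D'\<rbrakk> \<Longrightarrow>
      G (lab' z) = G' (lab' z)"
  shows "transfers (common_region_pairs D D') X br D D'"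
  unfolding transfers_def
proof (intro ballI ex_ex1I)
  fix f assume "f \<in> colorings X br D"
  define F where "F z = f (region_of D z)" for z
  have F: "point_coloring X br D F"
    using coloring_imp_point_coloring[OF D \<open>f \<in> colorings X br D\<close>] by (simp add: F_def[abs_def])
  obtain G where G: "range G \<subseteq> X" "satisfies br K G" "\<And>z. z\<in>open_box - curve D \<Longrightarrow> F z = G (lab z)"
    using point_coloring_labels[OF D L F] by blast
  obtain G' where G': "range G' \<subseteq> X" "satisfies br K' G'"
      "\<forall>z\<in>open_box - core - curve D. G' (lab' z) = G (lab z)"
    using ext[OF G(1,2)] by blast
  then have "G' (lab' z) = G (lab z)" if "z \<in> open_box - curve D" "z \<notin> core" for z
    using that by blast
  note g = glue_point_coloring[OF F G(3) G'(1,2) this]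
  obtain f' where f': "f' \<in> colorings X br D'" "\<forall>z\<in>- curve D'. f' (region_of D' z) =
      (if z \<in> open_box then G' (lab' z) else F z)"
    using point_coloring_imp_coloring[OF D' g(1)] by blast
  have "agree (common_region_pairs D D') f f'"
    unfolding agree_common_region_pairs using f'(2) g(2) curve_off_core by (metis ComplI F_def)
  then show "\<exists>f'. f' \<in> colorings X br D' \<and> agree (common_region_pairs D D') f f'" using f' by blast
next
  fix f f1 f2
  assume f1: "f1 \<in> colorings X br D' \<and> agree (common_region_pairs D D') f f1"
    and f2: "f2 \<in> colorings X br D' \<and> agree (common_region_pairs D D') f f2"
  define F1 where "F1 z = f1 (region_of D' z)" for z
  define F2 where "F2 z = f2 (region_of D' z)" for z
  have pc: "point_coloring X br D' F1" "point_coloring X br D' F2"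
    using coloring_imp_point_coloring[OF D'] f1 f2 by (auto simp: F1_def[abs_def] F2_def[abs_def])
  obtain G1 where G1: "range G1 \<subseteq> X" "satisfies br K' G1" "\<And>z. z\<in>open_box - curve D' \<Longrightarrow> F1 z = G1 (lab' z)"
    using point_coloring_labels[OF D' L' pc(1)] by blast
  obtain G2 where G2: "range G2 \<subseteq> X" "satisfies br K' G2" "\<And>z. z\<in>open_box - curve D' \<Longrightarrow> F2 z = G2 (lab' z)"
    using point_coloring_labels[OF D' L' pc(2)] by blast
  have off: "F1 z = F2 z" if "z \<notin> core" "z \<notin> curve D'" for z
    using f1 f2 that unfolding agree_common_region_pairs F1_def F2_def using curve_off_core by metis
  have G12: "G1 (lab' z) = G2 (lab' z)" if "z \<in> open_box - curve D'" for z
  proof (rule uniq[OF G1(1,2) G2(1,2) _ that])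
    fix z assume "z \<in> open_box - core - curve D'"
    then show "G1 (lab' z) = G2 (lab' z)" using off[of z] G1(3)[of z] G2(3)[of z] by auto
  qed
  show "f1 = f2"
  proof (rule coloring_eqI[OF conjunct1[OF f1] conjunct1[OF f2]])
    fix z assume z: "z \<notin> curve D'"
    have "F1 z = F2 z"
    proof (cases "z \<in> core")
      case True
      then have "z \<in> open_box - curve D'" using z core_subset_open_box by blast
      then show ?thesis using G1(3) G2(3) G12 by simp
    qed (use off z in blast)
    then show "f1 (region_of D' z) = f2 (region_of D' z)" by (simp add: F1_def F2_def)
  qed
qed

end

section \<open>Local pictures made of graphs\<close>

lemma projection_cong:
  assumes "\<And>i t. (i, t) \<in> P \<Longrightarrow> k i = k' i \<and> h i = h' i"
  shows "projection P k h = projection P k' h'"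
proof -
  have e: "curve_point k q = curve_point k' q" "curve_tangent k q = curve_tangent k' q"
     "h (fst q) (snd q) = h' (fst q) (snd q)" if "q \<in> P" for q
    using assms[of "fst q" "snd q"] that by (simp_all add: curve_point_def curve_tangent_def)
  have tangents_eq: "{(curve_point k q, curve_tangent k q) | q. q \<in> P} =
      {(curve_point k' q, curve_tangent k' q) | q. q \<in> P}"
    by (rule Collect_cong) (metis e(1,2))
  have "(\<exists>r\<in>P. curve_point k r = curve_point k q \<and> h (fst r) (snd r) < h (fst q) (snd q)) =
      (\<exists>r\<in>P. curve_point k' r = curve_point k' q \<and> h' (fst r) (snd r) < h' (fst q) (snd q))" if "q \<in> P" for q
    using that e by (intro bex_cong) auto
  then have overs_eq: "{(curve_point k q, curve_tangent k q) | q. q \<in> P \<and>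
        (\<exists>r\<in>P. curve_point k r = curve_point k q \<and> h (fst r) (snd r) < h (fst q) (snd q))} =
      {(curve_point k' q, curve_tangent k' q) | q. q \<in> P \<and>
        (\<exists>r\<in>P. curve_point k' r = curve_point k' q \<and> h' (fst r) (snd r) < h' (fst q) (snd q))}"
    by (intro Collect_cong) (metis (no_types, lifting) e(1,2))
  show ?thesis unfolding projection_def tangents_eq overs_eq ..
qed

lemma local_picture_cong:
  assumes "\<And>i. i < m \<Longrightarrow> k i = k' i"
  shows "local_picture m k h = local_picture m k' h"
proof -
  have "{(i, t). i < m \<and> k i t \<in> move_box} = {(i, t). i < m \<and> k' i t \<in> move_box}"
    using assms by auto
  then show ?thesis unfolding local_picture_def
    using assms by (auto intro!: projection_cong)
qed

lemma eventually_pos_of_deriv: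
  fixes \<phi> :: "real \<Rightarrow> real"
  assumes "(\<phi> has_real_derivative d) (at 0)" "\<phi> 0 = 0"
  shows "d > 0 \<Longrightarrow> \<forall>\<^sub>F e in at_right 0. \<phi> e > 0" "d < 0 \<Longrightarrow> \<forall>\<^sub>F e in at_right 0. \<phi> e < 0"
proof -
  assume "d > 0"
  from DERIV_pos_inc_right[OF assms(1) this]
  obtain r where "r > 0" "\<forall>e>0. e < r \<longrightarrow> \<phi> 0 < \<phi> (0 + e)"
    by (elim exE conjE) (rule that)
  then have "\<forall>e>0. e < r \<longrightarrow> \<phi> e > 0" using assms(2) by simp
  with \<open>r > 0\<close> show "\<forall>\<^sub>F e in at_right 0. \<phi> e > 0" unfolding eventually_at_right_field by blast
next
  assume "d < 0"
  from DERIV_neg_dec_right[OF assms(1) this]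
  obtain r where "r > 0" "\<forall>e>0. e < r \<longrightarrow> \<phi> 0 > \<phi> (0 + e)"
    by (elim exE conjE) (rule that)
  then have "\<forall>e>0. e < r \<longrightarrow> \<phi> e < 0" using assms(2) by simp
  with \<open>r > 0\<close> show "\<forall>\<^sub>F e in at_right 0. \<phi> e < 0" unfolding eventually_at_right_field by blast
qed

text \<open>Strands that are graphs over the real axis, oriented by the signs \<sigma>: left and
  right of a strand become above and below up to that sign. This covers the second and the third
  move and the straight strand of the first; the kink is not a graph.\<close>

locale graph_picture =
  fixes D :: diagram and m :: nat and g g' :: "nat \<Rightarrow> real \<Rightarrow> real" and \<sigma> h :: "nat \<Rightarrow> real"
  assumes D: "link_diagram D"
    and picture: "restrict_diagram move_box D =
      local_picture m (\<lambda>i t. Complex (\<sigma> i * t) (g i (\<sigma> i * t))) (\<lambda>i t. h i)"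
    and sign: "i < m \<Longrightarrow> \<sigma> i \<in> {1, -1}" and inj: "inj_on h {..<m}"
    and deriv: "i < m \<Longrightarrow> (g i has_real_derivative g' i s) (at s)"
    and bounded: "i < m \<Longrightarrow> \<bar>s\<bar> \<le> 2 \<Longrightarrow> \<bar>g i s\<bar> < 3"
    and transversal: "\<lbrakk>i < m; j < m; i \<noteq> j; \<bar>s\<bar> \<le> 2; g i s = g j s\<rbrakk> \<Longrightarrow> \<bar>s\<bar> < 2 \<and> g' i s \<noteq> g' j s"
    and double: "\<lbrakk>i < m; j < m; k < m; i \<noteq> j; k \<noteq> i; k \<noteq> j; \<bar>s\<bar> \<le> 2; g i s = g j s\<rbrakk> \<Longrightarrow> g k s \<noteq> g i s"
begin

definition dir :: "nat \<Rightarrow> real \<Rightarrow> complex" where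
  "dir i s = sgn (of_real (\<sigma> i) * Complex 1 (g' i s))"

definition strand :: "nat \<Rightarrow> real \<Rightarrow> complex" where
  "strand i t = Complex (\<sigma> i * t) (g i (\<sigma> i * t))"

definition params :: "(nat \<times> real) set" where
  "params = {(i, t). i < m \<and> strand i t \<in> move_box}"

lemma tangent_strand:
  assumes "i < m"
  shows "curve_tangent strand (i, t) = dir i (\<sigma> i * t)"
proof -
  have "((\<lambda>t. g i (\<sigma> i * t)) has_real_derivative g' i (\<sigma> i * t) * \<sigma> i) (at t)"
    by (rule DERIV_chain2[OF deriv[OF assms]]) (auto intro!: derivative_eq_intros)
  then have "((\<lambda>t. of_real (\<sigma> i * t) + \<i> * of_real (g i (\<sigma> i * t))) has_vector_derivative
      of_real (\<sigma> i) + \<i> * of_real (g' i (\<sigma> i * t) * \<sigma> i)) (at t)"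
    unfolding has_real_derivative_iff_has_vector_derivative
    by (intro has_vector_derivative_add has_vector_derivative_mult_right has_vector_derivative_of_real)
      (auto intro!: derivative_eq_intros simp: has_real_derivative_iff_has_vector_derivative[symmetric])
  moreover have "strand i = (\<lambda>t. of_real (\<sigma> i * t) + \<i> * of_real (g i (\<sigma> i * t)))"
    by (simp add: strand_def Complex_eq fun_eq_iff)
  moreover have "of_real (\<sigma> i) + \<i> * of_real (g' i (\<sigma> i * t) * \<sigma> i) = of_real (\<sigma> i) * Complex 1 (g' i (\<sigma> i * t))"
    by (simp add: complex_eq_iff)
  ultimately show ?thesis
    by (simp add: curve_tangent_def dir_def vector_derivative_at)
qed

lemma params_iff:
  assumes "p \<in> move_box"
  shows "(i, t) \<in> params \<and> curve_point strand (i, t) = p \<longleftrightarrow> i < m \<and> t = \<sigma> i * Re p \<and> Im p = g i (Re p)"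
proof (cases "i < m")
  case True
  then have "strand i t = p \<longleftrightarrow> t = \<sigma> i * Re p \<and> Im p = g i (Re p)"
    using sign[OF True] by (auto simp: strand_def complex_eq_iff)
  then show ?thesis
    using assms True by (auto simp: params_def curve_point_def)
qed (simp add: params_def)

lemma box_tangents:
  assumes "p \<in> move_box"
  shows "(p, u) \<in> tangents D \<longleftrightarrow> (\<exists>i<m. Im p = g i (Re p) \<and> u = dir i (Re p))"
proof -
  have "(p, u) \<in> tangents D \<longleftrightarrow> (p, u) \<in> tangents (restrict_diagram move_box D)"
    using assms by (simp add: restrict_diagram_def)
  also have "\<dots> \<longleftrightarrow> (\<exists>i t. (i, t) \<in> params \<and> curve_point strand (i, t) = p \<and> u = curve_tangent strand (i, t))"
    unfolding picture local_picture_def strand_def[symmetric] params_def[symmetric] projection_def by auto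
  also have "\<dots> \<longleftrightarrow> (\<exists>i t. i < m \<and> t = \<sigma> i * Re p \<and> Im p = g i (Re p) \<and> u = dir i (\<sigma> i * t))"
    using params_iff[OF assms] tangent_strand by metis
  also have "\<dots> \<longleftrightarrow> (\<exists>i<m. Im p = g i (Re p) \<and> u = dir i (Re p))"
    using sign by (auto simp: mult.assoc[symmetric]) (metis (no_types) insertE mult.assoc mult_1 mult_minus1 minus_minus singletonD)+
  finally show ?thesis .
qed

lemma box_overs:
  assumes "p \<in> move_box"
  shows "(p, u) \<in> overs D \<longleftrightarrow>
    (\<exists>i<m. \<exists>j<m. Im p = g i (Re p) \<and> Im p = g j (Re p) \<and> h j < h i \<and> u = dir i (Re p))"
proof -
  have s: "\<sigma> i * (\<sigma> i * s) = s" if "i < m" for i s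
    using sign[OF that] by auto
  have "(p, u) \<in> overs D \<longleftrightarrow> (p, u) \<in> overs (restrict_diagram move_box D)"
    using assms by (simp add: restrict_diagram_def)
  also have "\<dots> \<longleftrightarrow> (\<exists>i t. (i, t) \<in> params \<and> curve_point strand (i, t) = p \<and> u = curve_tangent strand (i, t) \<and>
      (\<exists>j t'. (j, t') \<in> params \<and> curve_point strand (j, t') = p \<and> h j < h i))"
    unfolding picture local_picture_def strand_def[symmetric] params_def[symmetric] projection_def
    by (auto simp: Bex_def)
  also have "\<dots> \<longleftrightarrow> (\<exists>i<m. \<exists>j<m. Im p = g i (Re p) \<and> Im p = g j (Re p) \<and> h j < h i \<and> u = dir i (Re p))"
    using params_iff[OF assms] tangent_strand s by (metis (no_types, lifting))
  finally show ?thesis .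
qed

lemma box_curve:
  assumes "p \<in> move_box"
  shows "p \<in> curve D \<longleftrightarrow> (\<exists>i<m. Im p = g i (Re p))"
  using box_tangents[OF assms] by (force simp: curve_def)

text \<open>Up to a positive factor, the form that defines the sides of a strand is \<sigma> times
  the height above its tangent line.\<close>

lemma Im_cnj_dir:
  assumes "i < m"
  shows "\<exists>c>0. Im (cnj (dir i s) * w) = c * (\<sigma> i * (Im w - g' i s * Re w))"
proof (intro exI conjI)
  let ?u = "of_real (\<sigma> i) * Complex 1 (g' i s)"
  have "?u \<noteq> 0" using sign[OF assms] by (auto simp: complex_eq_iff)
  then show "1 / norm ?u > 0" by simp
  show "Im (cnj (dir i s) * w) = 1 / norm ?u * (\<sigma> i * (Im w - g' i s * Re w))"
  proof -
    have "Im (cnj ?u * w) = \<sigma> i * (Im w - g' i s * Re w)" by (simp add: algebra_simps)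
    then show ?thesis unfolding dir_def Im_cnj_sgn by (simp only:) simp
  qed
qed

lemma dir_inj:
  assumes "i < m" "j < m" "\<bar>s\<bar> \<le> 2" "g i s = g j s" "dir i s = dir j s"
  shows "i = j"
proof (rule ccontr)
  assume "i \<noteq> j"
  obtain c where "c > 0" "Im (cnj (dir i s) * Complex 1 (g' j s)) = c * (\<sigma> i * (g' j s - g' i s))"
    using Im_cnj_dir[OF assms(1), of s "Complex 1 (g' j s)"] by auto
  moreover obtain d where "Im (cnj (dir j s) * Complex 1 (g' j s)) = d * 0"
    using Im_cnj_dir[OF assms(2), of s "Complex 1 (g' j s)"] by auto
  ultimately have "\<sigma> i * (g' j s - g' i s) = 0" using assms(5) by simp
  then show False using transversal[OF assms(1,2) \<open>i \<noteq> j\<close> assms(3,4)] sign[OF assms(1)] by auto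
qed

lemma box_crossing:
  assumes p: "p \<in> move_box"
  shows "is_crossing D p u v \<longleftrightarrow> (\<exists>i<m. \<exists>j<m. h j < h i \<and> Im p = g i (Re p) \<and> Im p = g j (Re p) \<and>
    u = dir i (Re p) \<and> v = dir j (Re p))"
proof
  have Rp: "\<bar>Re p\<bar> \<le> 2" using p by (simp add: move_box_def)
  {
    assume c: "is_crossing D p u v"
    then obtain i j where ij: "i < m" "j < m" "Im p = g i (Re p)" "Im p = g j (Re p)" "h j < h i" "u = dir i (Re p)"
      unfolding is_crossing_def box_overs[OF p] by blast
    obtain l where l: "l < m" "Im p = g l (Re p)" "v = dir l (Re p)"
      using c p by (auto simp: is_crossing_def box_tangents)
    \<comment> \<open>As \<open>v\<close> is not an over-tangent, no strand through \<open>p\<close>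
      runs below the strand of \<open>v\<close>; so that strand is at most as high as the one below
      \<open>u\<close>.\<close>
    have nov: "\<not> h k < h l" if "k < m" "Im p = g k (Re p)" for k
    proof
      assume "h k < h l"
      then have "(p, v) \<in> overs D" unfolding box_overs[OF p] using that l by blast
      then show False using c by (simp add: is_crossing_def)
    qed
    have "h l \<le> h j" using nov ij by force
    then show "\<exists>i<m. \<exists>j<m. h j < h i \<and> Im p = g i (Re p) \<and> Im p = g j (Re p) \<and>
      u = dir i (Re p) \<and> v = dir j (Re p)" using ij l by (intro exI[of _ i] exI[of _ l]) auto
  next
    assume "\<exists>i<m. \<exists>j<m. h j < h i \<and> Im p = g i (Re p) \<and> Im p = g j (Re p) \<and>
      u = dir i (Re p) \<and> v = dir j (Re p)"
    then obtain i j where ij: "i < m" "j < m" "Im p = g i (Re p)" "Im p = g j (Re p)" "h j < h i"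
      "u = dir i (Re p)" "v = dir j (Re p)" by blast
    have "(p, u) \<in> overs D" unfolding box_overs[OF p] using ij by blast
    moreover have "(p, v) \<in> tangents D" unfolding box_tangents[OF p] using ij by blast
    \<comment> \<open>The strand of \<open>v\<close> could be an over-strand only with a third
      strand below it, because directions at \<open>p\<close> determine strands; but there are no
      triple points.\<close>
    moreover have "(p, v) \<notin> overs D"
    proof
      assume "(p, v) \<in> overs D"
      then obtain k l where kl: "k < m" "l < m" "Im p = g k (Re p)" "Im p = g l (Re p)" "h l < h k" "v = dir k (Re p)"
        unfolding box_overs[OF p] by blast
      then have "k = j" using dir_inj[OF _ _ Rp] ij by metis
      then have "l \<noteq> i" "l \<noteq> j" "i \<noteq> j" using kl ij by auto
      then show False using double[OF ij(1,2) kl(2) _ _ _ Rp] ij kl by metis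
    qed
    ultimately show "is_crossing D p u v" by (simp add: is_crossing_def)
  }
qed

text \<open>\<open>True\<close> means left of the strand. Indices from \<open>m\<close> on get
  \<open>False\<close>, so that a label is determined by its sides of the actual strands.\<close>

definition lab :: "complex \<Rightarrow> nat \<Rightarrow> bool" where
  "lab z = (\<lambda>i. i < m \<and> (g i (Re z) < Im z \<longleftrightarrow> \<sigma> i = 1))"

lemma continuous_g: "i < m \<Longrightarrow> isCont (g i) s"
  using deriv DERIV_isCont by blast

lemma above_locally_constant:
  assumes "i < m" "Im z \<noteq> g i (Re z)"
  shows "\<forall>\<^sub>F w in nhds z. (g i (Re w) < Im w \<longleftrightarrow> g i (Re z) < Im z) \<and> Im w \<noteq> g i (Re w)"
proof -
  have "isCont (\<lambda>w. Im w - g i (Re w)) z"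
    by (intro continuous_intros isCont_o2[OF _ continuous_g[OF assms(1)]]) auto
  then have t: "((\<lambda>w. Im w - g i (Re w)) \<longlongrightarrow> Im z - g i (Re z)) (at z)"
    by (simp add: isCont_def)
  show ?thesis
  proof (cases "g i (Re z) < Im z")
    case True
    then have "\<forall>\<^sub>F w in nhds z. Im w - g i (Re w) > 0" using order_tendstoD(1)[OF t, of 0] by (simp add: eventually_nhds_conv_at)
    then show ?thesis by eventually_elim (use True in auto)
  next
    case False
    then have "\<forall>\<^sub>F w in nhds z. Im w - g i (Re w) < 0" using assms order_tendstoD(2)[OF t, of 0] by (simp add: eventually_nhds_conv_at)
    then show ?thesis by eventually_elim (use False in auto)
  qed
qed

lemma lab_locally_constant:
  assumes "z \<in> open_box - curve D"
  shows "\<forall>\<^sub>F w in nhds z. lab w = lab z"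
proof -
  have "Im z \<noteq> g i (Re z)" if "i < m" for i
    using assms that box_curve[of z] open_box_subset_move_box by auto
  then have "\<forall>\<^sub>F w in nhds z. \<forall>i\<in>{..<m}. (g i (Re w) < Im w \<longleftrightarrow> g i (Re z) < Im z)"
    using above_locally_constant by (intro eventually_ball_finite) (auto intro: eventually_mono[OF above_locally_constant])
  then show ?thesis by eventually_elim (auto simp: lab_def)
qed

lemma crossing_in_open_box: "is_crossing D p u v \<Longrightarrow> p \<in> move_box \<Longrightarrow> p \<in> open_box"
  using box_crossing[of p u v] transversal[of _ _ "Re p"] bounded[of _ "Re p"]
  by (fastforce simp: open_box_def move_box_def)

text \<open>\<open>\<phi> e\<close> is the height of the ray above the strand. It vanishes at 0, and
  the sign of its derivative there, corrected by \<sigma>, tells the side to which \<open>w\<close>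
  points.\<close>

lemma side_lab:
  assumes i: "i < m" and p: "Im p = g i (Re p)"
  shows "w \<in> left_of (dir i (Re p)) \<Longrightarrow> \<forall>\<^sub>F e in at_right (0::real). lab (p + of_real e * w) i"
    and "w \<in> right_of (dir i (Re p)) \<Longrightarrow> \<forall>\<^sub>F e in at_right (0::real). \<not> lab (p + of_real e * w) i"
proof -
  define \<phi> where "\<phi> e = (Im p + e * Im w) - g i (Re p + e * Re w)" for e
  have "((\<lambda>e. g i (Re p + e * Re w)) has_real_derivative g' i (Re p + 0 * Re w) * Re w) (at 0)"
    by (rule DERIV_chain2[OF deriv[OF i]]) (auto intro!: derivative_eq_intros)
  then have d: "(\<phi> has_real_derivative (Im w - g' i (Re p) * Re w)) (at 0)"
    unfolding \<phi>_def[abs_def] by (auto intro!: derivative_eq_intros)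
  have 0: "\<phi> 0 = 0" using p by (simp add: \<phi>_def)
  have l: "lab (p + of_real e * w) i \<longleftrightarrow> (\<phi> e > 0 \<longleftrightarrow> \<sigma> i = 1)" for e
    using i by (simp add: lab_def \<phi>_def)
  obtain c where c: "c > 0" "Im (cnj (dir i (Re p)) * w) = c * (\<sigma> i * (Im w - g' i (Re p) * Re w))"
    using Im_cnj_dir[OF i] by blast
  note ev = eventually_pos_of_deriv[OF d 0]
  show "\<forall>\<^sub>F e in at_right (0::real). lab (p + of_real e * w) i" if "w \<in> left_of (dir i (Re p))"
  proof -
    have *: "\<sigma> i * (Im w - g' i (Re p) * Re w) > 0"
      using that c unfolding left_of_def mem_Collect_eq by (simp only: zero_less_mult_iff) simp
    consider "\<sigma> i = 1" | "\<sigma> i = -1" using sign[OF i] by blast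
    then show ?thesis
    proof cases
      case 1
      then have "\<forall>\<^sub>F e in at_right 0. \<phi> e > 0" using * ev(1) by simp
      then show ?thesis unfolding l by eventually_elim (use 1 in simp)
    next
      case 2
      then have "\<forall>\<^sub>F e in at_right 0. \<phi> e < 0" using * ev(2) by simp
      then show ?thesis unfolding l by eventually_elim (use 2 in simp)
    qed
  qed
  show "\<forall>\<^sub>F e in at_right (0::real). \<not> lab (p + of_real e * w) i" if "w \<in> right_of (dir i (Re p))"
  proof -
    have *: "\<sigma> i * (Im w - g' i (Re p) * Re w) < 0"
      using that c unfolding right_of_def mem_Collect_eq by (simp only: mult_less_0_iff) simp
    consider "\<sigma> i = 1" | "\<sigma> i = -1" using sign[OF i] by blast
    then show ?thesis
    proof cases
      case 1
      then have "\<forall>\<^sub>F e in at_right 0. \<phi> e < 0" using * ev(2) by simp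
      then show ?thesis unfolding l by eventually_elim (use 1 in simp)
    next
      case 2
      then have "\<forall>\<^sub>F e in at_right 0. \<phi> e > 0" using * ev(1) by simp
      then show ?thesis unfolding l by eventually_elim (use 2 in simp)
    qed
  qed
qed

lemma other_lab:
  assumes i: "k < m" and p: "Im p \<noteq> g k (Re p)"
  shows "\<forall>\<^sub>F e in at_right (0::real). lab (p + of_real e * w) k = lab p k"
proof -
  obtain A where A: "open A" "p \<in> A" "\<And>w. w \<in> A \<Longrightarrow> (g k (Re w) < Im w \<longleftrightarrow> g k (Re p) < Im p)"
    using above_locally_constant[OF assms] unfolding eventually_nhds by blast
  have "\<forall>\<^sub>F e in at_right (0::real). p + of_real e * w \<in> A" by (rule eventually_ray_open[OF A(1,2)])
  then show ?thesis
  proof eventually_elim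
    case (elim e)
    then show ?case using A(3)[OF elim] by (simp only: lab_def)
  qed
qed

text \<open>Strand \<open>i\<close> is over strand \<open>j\<close>; the label \<open>s\<close>
  supplies the sides of all other strands, which do not change near the crossing.\<close>

definition quadruple :: "nat \<Rightarrow> nat \<Rightarrow> (nat \<Rightarrow> bool) \<Rightarrow> (nat \<Rightarrow> bool) \<times> (nat \<Rightarrow> bool) \<times> (nat \<Rightarrow> bool) \<times> (nat \<Rightarrow> bool)"
  where "quadruple i j s = (s(i := True, j := True), s(i := False, j := True), s(i := True, j := False), s(i := False, j := False))"

lemma crossing_labels_quadruple:
  assumes p: "p \<in> move_box" and ij: "i < m" "j < m" "h j < h i" "Im p = g i (Re p)" "Im p = g j (Re p)"
  shows "crossing_labels lab p (dir i (Re p)) (dir j (Re p)) (quadruple i j (lab p))"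
proof -
  have Rp: "\<bar>Re p\<bar> \<le> 2" using p by (simp add: move_box_def)
  let ?u = "dir i (Re p)" and ?v = "dir j (Re p)"
  have c: "is_crossing D p ?u ?v" unfolding box_crossing[OF p] using ij by blast
  have "i \<noteq> j" using ij by auto
  have other: "Im p \<noteq> g k (Re p)" if "k < m" "k \<noteq> i" "k \<noteq> j" for k
    using double[OF ij(1,2) that(1) \<open>i \<noteq> j\<close> that(2,3) Rp] ij by metis
  obtain w1 w2 w3 w4 where s: "sector_vectors ?u ?v w1 w2 w3 w4"
    using sectors_nonempty[OF link_diagram_crossing(1)[OF D c]] unfolding sector_vectors_def by blast
  have ray: "\<forall>\<^sub>F e in at_right (0::real). lab (p + of_real e * w) = (lab p)(i := a, j := b)"
    if "\<forall>\<^sub>F e in at_right (0::real). lab (p + of_real e * w) i = a"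
       "\<forall>\<^sub>F e in at_right (0::real). lab (p + of_real e * w) j = b" for w a b
  proof -
    have "\<forall>\<^sub>F e in at_right (0::real). \<forall>k\<in>{..<m} - {i, j}. lab (p + of_real e * w) k = lab p k"
      using other_lab other by (intro eventually_ball_finite) auto
    then show ?thesis using that
    proof eventually_elim
      case (elim e)
      show ?case
      proof
        fix k
        show "lab (p + of_real e * w) k = ((lab p)(i := a, j := b)) k"
        proof (cases "k < m")
          case False
          then show ?thesis using ij by (simp add: lab_def)
        qed (use elim \<open>i \<noteq> j\<close> in auto)
      qed
    qed
  qed
  have w: "w1 \<in> left_of ?u" "w1 \<in> left_of ?v" "w2 \<in> right_of ?u" "w2 \<in> left_of ?v"
    "w3 \<in> left_of ?u" "w3 \<in> right_of ?v" "w4 \<in> right_of ?u" "w4 \<in> right_of ?v"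
    using s by (auto simp: sector_vectors_def)
  note si = side_lab[OF ij(1,4)] and sj = side_lab[OF ij(2,5)]
  have "\<forall>\<^sub>F e in at_right (0::real). lab (p + of_real e * w1) = (lab p)(i := True, j := True)"
    "\<forall>\<^sub>F e in at_right (0::real). lab (p + of_real e * w2) = (lab p)(i := False, j := True)"
    "\<forall>\<^sub>F e in at_right (0::real). lab (p + of_real e * w3) = (lab p)(i := True, j := False)"
    "\<forall>\<^sub>F e in at_right (0::real). lab (p + of_real e * w4) = (lab p)(i := False, j := False)"
    using si(1)[OF w(1)] sj(1)[OF w(2)] si(2)[OF w(3)] sj(1)[OF w(4)]
      si(1)[OF w(5)] sj(2)[OF w(6)] si(2)[OF w(7)] sj(2)[OF w(8)] by (auto intro!: ray)
  then have "\<forall>\<^sub>F e in at_right (0::real). lab (p + of_real e * w1) = (lab p)(i := True, j := True) \<and>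
    lab (p + of_real e * w2) = (lab p)(i := False, j := True) \<and>
    lab (p + of_real e * w3) = (lab p)(i := True, j := False) \<and>
    lab (p + of_real e * w4) = (lab p)(i := False, j := False)"
    by eventually_elim blast
  then show ?thesis using s unfolding crossing_labels_def quadruple_def by auto
qed

definition crossing_quadruples :: "((nat \<Rightarrow> bool) \<times> (nat \<Rightarrow> bool) \<times> (nat \<Rightarrow> bool) \<times> (nat \<Rightarrow> bool)) set" where
  "crossing_quadruples = {quadruple i j (lab p) | i j p. i < m \<and> j < m \<and> h j < h i \<and> p \<in> move_box \<and>
     Im p = g i (Re p) \<and> Im p = g j (Re p)}"

definition cell :: "(nat \<Rightarrow> bool) \<Rightarrow> complex set" where
  "cell a = {z. \<bar>Re z\<bar> < 2 \<and> \<bar>Im z\<bar> < 3 \<and> (\<forall>i<m. if a i then g i (Re z) < Im z else Im z < g i (Re z))}"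

text \<open>Cells are described by above and below, labels by left and right; the orientation signs
  translate.\<close>

definition label_of :: "(nat \<Rightarrow> bool) \<Rightarrow> nat \<Rightarrow> bool" where
  "label_of a = (\<lambda>i. i < m \<and> (a i \<longleftrightarrow> \<sigma> i = 1))"

lemma lab_eq: "lab z = label_of (\<lambda>i. g i (Re z) < Im z)"
  by (simp add: lab_def label_of_def)

lemma label_of_eq_iff: "label_of a = label_of b \<longleftrightarrow> (\<forall>i<m. a i = b i)"
  by (auto simp: label_of_def fun_eq_iff)

lemma lab_fibre: "{z \<in> open_box - curve D. lab z = label_of a} = cell a"
proof (intro equalityI subsetI)
  fix z assume "z \<in> {z \<in> open_box - curve D. lab z = label_of a}"
  then have z: "z \<in> open_box" "z \<notin> curve D" "lab z = label_of a" by auto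
  then have "Im z \<noteq> g i (Re z)" "a i \<longleftrightarrow> g i (Re z) < Im z" if "i < m" for i
    using that box_curve[of z] open_box_subset_move_box by (auto simp: lab_eq label_of_eq_iff)
  then show "z \<in> cell a"
    using z(1) by (auto simp: cell_def open_box_def less_le not_less)
next
  fix z assume z: "z \<in> cell a"
  then have "z \<in> open_box" by (simp add: cell_def open_box_def)
  moreover have "Im z \<noteq> g i (Re z)" "g i (Re z) < Im z \<longleftrightarrow> a i" if "i < m" for i
    using z that by (auto simp: cell_def split: if_splits)
  ultimately show "z \<in> {z \<in> open_box - curve D. lab z = label_of a}"
    using box_curve[of z] open_box_subset_move_box by (auto simp: lab_eq label_of_eq_iff)
qed

lemma box_labelling_lab:
  assumes "\<And>a. connected (cell a)"
  shows "box_labelling D lab crossing_quadruples"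
  unfolding box_labelling_def
proof (intro conjI ballI allI impI)
  show "connected {z \<in> open_box - curve D. lab z = l}" for l
  proof (cases "l \<in> range label_of")
    case True
    then show ?thesis using lab_fibre assms by auto
  next
    case False
    then have "{z \<in> open_box - curve D. lab z = l} = {}" by (auto simp: lab_eq)
    then show ?thesis by (simp only: connected_empty)
  qed
  show "p \<in> open_box" if "is_crossing D p u v \<and> p \<in> move_box" for p u v
    using that crossing_in_open_box by blast
  show "\<exists>q\<in>crossing_quadruples. crossing_labels lab p u v q"
    if c: "is_crossing D p u v \<and> p \<in> move_box" for p u v
  proof -
    obtain i j where "i < m" "j < m" "h j < h i" "Im p = g i (Re p)" "Im p = g j (Re p)"
      "u = dir i (Re p)" "v = dir j (Re p)"
      using c box_crossing by blast
    then show ?thesis using crossing_labels_quadruple[of p i j] c unfolding crossing_quadruples_def by blast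
  qed
  show "\<exists>p u v. is_crossing D p u v \<and> p \<in> open_box \<and> crossing_labels lab p u v q"
    if q: "q \<in> crossing_quadruples" for q
  proof -
    obtain i j p where ij: "q = quadruple i j (lab p)" "p \<in> move_box" "i < m" "j < m" "h j < h i"
       "Im p = g i (Re p)" "Im p = g j (Re p)"
      using q unfolding crossing_quadruples_def by blast
    then have "is_crossing D p (dir i (Re p)) (dir j (Re p))" unfolding box_crossing[OF ij(2)] by blast
    then show ?thesis using crossing_labels_quadruple[OF ij(2-7)] crossing_in_open_box ij by blast
  qed
qed (use lab_locally_constant in blast)

end

text \<open>With the relative position between \<open>lo\<close> and \<open>hi\<close> as second
  coordinate, the strip is the continuous image of a product of two intervals.\<close>

lemma connected_strip:
  fixes lo hi :: "real \<Rightarrow> real"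
  assumes I: "is_interval I" and c: "continuous_on I lo" "continuous_on I hi"
    and lt: "\<And>x. x \<in> I \<Longrightarrow> lo x < hi x"
  shows "connected {z. Re z \<in> I \<and> lo (Re z) < Im z \<and> Im z < hi (Re z)}"
proof -
  have "{z. Re z \<in> I \<and> lo (Re z) < Im z \<and> Im z < hi (Re z)} =
    (\<lambda>(x, s). Complex x ((1 - s) * lo x + s * hi x)) ` (I \<times> {0<..<1})" (is "?A = ?f ` _")
  proof (intro equalityI subsetI)
    fix z assume z: "z \<in> ?A"
    define s where "s = (Im z - lo (Re z)) / (hi (Re z) - lo (Re z))"
    have d: "hi (Re z) - lo (Re z) > 0" using z by auto
    then have "0 < s" "s < 1" using z by (auto simp: s_def divide_simps)
    moreover have "s * (hi (Re z) - lo (Re z)) = Im z - lo (Re z)" using d by (simp add: s_def)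
    then have "(1 - s) * lo (Re z) + s * hi (Re z) = Im z" by (simp add: algebra_simps)
    ultimately show "z \<in> ?f ` (I \<times> {0<..<1})"
      using z by (intro image_eqI[of _ _ "(Re z, s)"]) auto
  next
    fix z assume "z \<in> ?f ` (I \<times> {0<..<1})"
    then obtain x s where xs: "x \<in> I" "0 < s" "s < 1" "z = Complex x ((1 - s) * lo x + s * hi x)" by auto
    have "s * (hi x - lo x) > 0" "(1 - s) * (hi x - lo x) > 0" using xs lt[of x] by simp_all
    then show "z \<in> ?A" using xs by (simp add: algebra_simps)
  qed
  moreover have "continuous_on (I \<times> {0<..<1}) ?f"
  proof -
    have cl: "continuous_on (I \<times> {0<..<1}) (\<lambda>p. lo (fst p))"
      by (rule continuous_on_compose2[OF c(1)]) (auto intro!: continuous_intros)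
    have ch: "continuous_on (I \<times> {0<..<1}) (\<lambda>p. hi (fst p))"
      by (rule continuous_on_compose2[OF c(2)]) (auto intro!: continuous_intros)
    show ?thesis unfolding case_prod_unfold Complex_eq by (intro continuous_intros cl ch)
  qed
  ultimately show ?thesis
    using I by (simp add: connected_continuous_image connected_Times is_interval_connected)
qed

section \<open>The third Reidemeister move\<close>

definition bump' :: "real \<Rightarrow> real" where
  "bump' t = - 4 * t * max 0 (1 - t\<^sup>2)"

lemma DERIV_max_0_square: "((\<lambda>s::real. (max 0 s)\<^sup>2) has_real_derivative 2 * max 0 x) (at x)"
proof -
  consider "x > 0" | "x < 0" | "x = 0" by linarith
  then show ?thesis
  proof cases
    case 1
    have "((\<lambda>s. s\<^sup>2) has_real_derivative 2 * max 0 x) (at x)"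
      using 1 by (auto intro!: derivative_eq_intros)
    then show ?thesis
      by (rule has_field_derivative_transform_within_open[of _ _ _ "{0<..}"]) (use 1 in auto)
  next
    case 2
    have "((\<lambda>s. 0) has_real_derivative 2 * max 0 x) (at x)"
      using 2 by (auto intro!: derivative_eq_intros)
    then show ?thesis
      by (rule has_field_derivative_transform_within_open[of _ _ _ "{..<0}"]) (use 2 in auto)
  next
    case 3
    \<comment> \<open>Caratheodory's criterion at 0: the square of \<open>max 0 s\<close> is
      \<open>max 0 s * s\<close>, with the continuous factor \<open>max 0\<close>.\<close>
    show ?thesis
      unfolding 3 CARAT_DERIV
      by (intro exI[of _ "max 0"]) (auto simp: max_def power2_eq_square intro!: continuous_intros)
  qed
qed

lemma DERIV_bump: "(bump has_real_derivative bump' t) (at t)"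
proof -
  have "((\<lambda>t. (max 0 (1 - t\<^sup>2))\<^sup>2) has_real_derivative 2 * max 0 (1 - t\<^sup>2) * (- 2 * t)) (at t)"
    by (rule DERIV_chain2[OF DERIV_max_0_square]) (auto intro!: derivative_eq_intros)
  then show ?thesis by (simp add: bump_def[abs_def] bump'_def mult_ac)
qed

lemma bump_0 [simp]: "bump 0 = 1"
  and bump_minus [simp]: "bump (- t) = bump t"
  and bump'_minus [simp]: "bump' (- t) = - bump' t"
  and bump_nonneg: "0 \<le> bump t"
  by (simp_all add: bump_def bump'_def)

lemma bump_antimono:
  assumes "\<bar>s\<bar> \<le> \<bar>t\<bar>"
  shows "bump t \<le> bump s"
proof -
  have "s\<^sup>2 \<le> t\<^sup>2" using assms by (simp add: abs_le_square_iff)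
  then show ?thesis unfolding bump_def by (intro power_mono) auto
qed

lemma bump_le_1: "bump t \<le> 1"
  using bump_antimono[of 0 t] by simp

lemma bump_outside: "1 \<le> \<bar>t\<bar> \<Longrightarrow> bump t = 0"
  using abs_le_square_iff[of 1 t] by (simp add: bump_def)

lemma bump'_neg: "0 < t \<Longrightarrow> t < 1 \<Longrightarrow> bump' t < 0"
  using abs_square_less_1[of t] by (simp add: bump'_def)

lemma bump'_nonzero: "t \<noteq> 0 \<Longrightarrow> \<bar>t\<bar> < 1 \<Longrightarrow> bump' t \<noteq> 0"
  using abs_square_less_1[of t] by (simp add: bump'_def)

lemma continuous_bump: "continuous_on A bump"
  using DERIV_bump by (meson DERIV_isCont continuous_at_imp_continuous_on)

lemma bump_fixed_point:
  assumes "bump s = s"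
  shows "0 < s" "s < 1" "bump' s < 0"
proof -
  have "s \<noteq> 0" using assms by auto
  then show "0 < s" using assms bump_nonneg[of s] by simp
  show "s < 1"
  proof (rule ccontr)
    assume "\<not> s < 1"
    then have "bump s = 0" by (intro bump_outside) simp
    then show False using assms \<open>0 < s\<close> by simp
  qed
  then show "bump' s < 0" using bump'_neg \<open>0 < s\<close> by blast
qed

text \<open>Applied to \<open>s\<close> and to \<open>- s\<close>, this locates the crossings of the
  third strand with the two diagonals, and the slope inequality makes them transversal. The case
  \<epsilon> = -1 follows since \<open>bump\<close> is even.\<close>

lemma signed_bump_fixed_point:
  assumes e: "\<epsilon> = 1 \<or> \<epsilon> = -1" and "\<epsilon> * bump s = s"
  shows "0 < \<epsilon> * s" "\<bar>s\<bar> < 1" "\<epsilon> * bump' s < 0"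
proof -
  have "bump (\<epsilon> * s) = \<epsilon> * s" using assms by auto
  from bump_fixed_point[OF this] e show "0 < \<epsilon> * s" "\<bar>s\<bar> < 1" "\<epsilon> * bump' s < 0" by auto
qed

lemma ex_bump_fixed_point: "\<exists>s. 0 \<le> s \<and> s \<le> 1 \<and> bump s = s"
proof -
  have "\<exists>s\<ge>0. s \<le> 1 \<and> bump s - s = 0"
    by (rule IVT2') (auto simp: bump_outside intro!: continuous_intros continuous_bump)
  then show ?thesis by auto
qed

text \<open>With the next lemma: the abscissae on either side of the crossing with a diagonal form a
  half-line. For \<open>x > 0\<close> this is monotonicity of \<open>bump\<close>; otherwise
  \<open>bump\<close> lies above the diagonal, being nonnegative and 1 at 0.\<close>

lemma below_bump_antimono:
  assumes "x \<le> y" "y < bump y"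
  shows "x < bump x"
proof (cases "0 < x")
  case True
  then have "bump y \<le> bump x" using assms by (intro bump_antimono) auto
  then show ?thesis using assms by linarith
next
  case False
  then show ?thesis using bump_nonneg[of x] by (cases "x = 0") (auto intro: less_le_trans)
qed

lemma above_bump_mono:
  assumes "x \<le> y" "bump x < x"
  shows "bump y < y"
proof -
  have "0 < x" using assms bump_nonneg[of x] by linarith
  then have "bump y \<le> bump x" using assms by (intro bump_antimono) auto
  then show ?thesis using assms by linarith
qed

text \<open>Every vertical slice is an interval, bounded by the maximum \<open>lo\<close> of the
  strands below and the minimum \<open>hi\<close> of those above. So it remains to see that the
  abscissae with a nonempty slice form an interval; \<open>I_iff\<close> gives one condition for
  each pair of strands, and each condition defines a half-line.\<close>

lemma connected_diagonal_cell:
  "connected {z. \<bar>Re z\<bar> < 2 \<and> \<bar>Im z\<bar> < 3 \<and>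
    (if a0 then Re z < Im z else Im z < Re z) \<and> (if a1 then - Re z < Im z else Im z < - Re z) \<and>
    (if a2 then bump (Re z) < Im z else Im z < bump (Re z))}" (is "connected ?C")
proof -
  define lo where "lo x = max (- 3) (max (if a0 then x else - 3)
     (max (if a1 then - x else - 3) (if a2 then bump x else - 3)))" for x
  define hi where "hi x = min 3 (min (if a0 then 3 else x)
     (min (if a1 then 3 else - x) (if a2 then 3 else bump x)))" for x
  define I where "I = {x. \<bar>x\<bar> < 2 \<and> lo x < hi x}"
  have C: "?C = {z. Re z \<in> I \<and> lo (Re z) < Im z \<and> Im z < hi (Re z)}"
    by (cases a0; cases a1; cases a2; auto simp: I_def lo_def hi_def)
  have I_iff: "x \<in> I \<longleftrightarrow> \<bar>x\<bar> < 2 \<and> ((a0 \<and> \<not> a1 \<longrightarrow> x < - x) \<and> (\<not> a0 \<and> a1 \<longrightarrow> - x < x)) \<and>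
      (a0 \<and> \<not> a2 \<longrightarrow> x < bump x) \<and> (\<not> a0 \<and> a2 \<longrightarrow> bump x < x) \<and>
      (a1 \<and> \<not> a2 \<longrightarrow> - x < bump x) \<and> (\<not> a1 \<and> a2 \<longrightarrow> bump x < - x)" for x
    using bump_nonneg[of x] bump_le_1[of x]
    by (cases a0; cases a1; cases a2; auto simp: I_def lo_def hi_def)
  have "is_interval I"
    unfolding is_interval_1
  proof (intro ballI allI impI)
    fix a b x assume ab: "a \<in> I" "b \<in> I" and x: "a \<le> x \<and> x \<le> b"
    note A = ab(1)[unfolded I_iff] and B = ab(2)[unfolded I_iff]
    show "x \<in> I"
      unfolding I_iff
    proof (intro conjI impI)
      have "\<bar>a\<bar> < 2" "\<bar>b\<bar> < 2" using A B by blast+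
      then show "\<bar>x\<bar> < 2" using x by linarith
    next
      assume "a0 \<and> \<not> a1"
      then have "b < - b" using B by blast
      then show "x < - x" using x by linarith
    next
      assume "\<not> a0 \<and> a1"
      then have "- a < a" using A by blast
      then show "- x < x" using x by linarith
    next
      assume "a0 \<and> \<not> a2"
      then have "b < bump b" using B by blast
      then show "x < bump x" using x below_bump_antimono by blast
    next
      assume "\<not> a0 \<and> a2"
      then have "bump a < a" using A by blast
      then show "bump x < x" using x above_bump_mono by blast
    next
      assume "a1 \<and> \<not> a2"
      then have "- a < bump (- a)" using A by simp
      then show "- x < bump x" using x below_bump_antimono[of "- x" "- a"] by simp
    next
      assume "\<not> a1 \<and> a2"
      then have "bump (- b) < - b" using B by simp
      then show "bump x < - x" using x above_bump_mono[of "- b" "- x"] by simp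
    qed
  qed
  moreover have "continuous_on I lo" "continuous_on I hi"
    unfolding lo_def[abs_def] hi_def[abs_def]
    by (cases a0; cases a1; cases a2; auto intro!: continuous_intros continuous_bump)+
  ultimately show ?thesis unfolding C by (intro connected_strip) (auto simp: I_def)
qed

section \<open>The local pictures of the third move\<close>

definition r3_graph :: "real \<Rightarrow> nat \<Rightarrow> real \<Rightarrow> real" where
  "r3_graph \<epsilon> i s = (if i = 0 then s else if i = 1 then - s else \<epsilon> * bump s)"

definition r3_graph' :: "real \<Rightarrow> nat \<Rightarrow> real \<Rightarrow> real" where
  "r3_graph' \<epsilon> i s = (if i = 0 then 1 else if i = 1 then - 1 else \<epsilon> * bump' s)"

lemma r3_graph_simps [simp]:
  "r3_graph \<epsilon> 0 s = s" "r3_graph \<epsilon> (Suc 0) s = - s" "r3_graph \<epsilon> 2 s = \<epsilon> * bump s"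
  "r3_graph' \<epsilon> 0 s = 1" "r3_graph' \<epsilon> (Suc 0) s = - 1" "r3_graph' \<epsilon> 2 s = \<epsilon> * bump' s"
  by (simp_all add: r3_graph_def r3_graph'_def)

lemma less_3_cases: "(i::nat) < 3 \<Longrightarrow> i = 0 \<or> i = 1 \<or> i = 2"
  by auto

lemma less_3_pair_cases:
  assumes "(i::nat) < 3" "j < 3" "i \<noteq> j"
  obtains "i = 0" "j = 1" | "i = 1" "j = 0" | "i = 0" "j = 2" | "i = 2" "j = 0" | "i = 1" "j = 2" | "i = 2" "j = 1"
  using less_3_cases[OF assms(1)] less_3_cases[OF assms(2)] assms(3) by blast

lemma all_less_3: "(\<forall>i<3. P i) \<longleftrightarrow> P 0 \<and> P 1 \<and> P (2::nat)"
  by (auto dest: less_3_cases)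

text \<open>The third strand passes above the crossing of the diagonals if \<epsilon> = 1 and below
  it if \<epsilon> = -1. \<open>T\<close>, \<open>M\<close>, \<open>B\<close> are the indices of the
  top, the middle and the bottom strand, whichever these are.\<close>

locale r3_picture =
  fixes D :: diagram and \<epsilon> :: real and \<sigma> h :: "nat \<Rightarrow> real" and T M B :: nat
  assumes D: "link_diagram D" and eps: "\<epsilon> = 1 \<or> \<epsilon> = -1"
    and picture: "restrict_diagram move_box D =
      local_picture 3 (\<lambda>i t. Complex (\<sigma> i * t) (r3_graph \<epsilon> i (\<sigma> i * t))) (\<lambda>i t. h i)"
    and sign: "i < 3 \<Longrightarrow> \<sigma> i \<in> {1, -1}" and inj: "inj_on h {..<3}"
    and order: "T < 3" "M < 3" "B < 3" "h B < h M" "h M < h T"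
begin

lemma graph_picture: "graph_picture D 3 (r3_graph \<epsilon>) (r3_graph' \<epsilon>) \<sigma> h"
proof
  show "(r3_graph \<epsilon> i has_real_derivative r3_graph' \<epsilon> i s) (at s)" for i s
    unfolding r3_graph_def[abs_def] r3_graph'_def
    using DERIV_cmult[OF DERIV_bump] by (auto intro!: derivative_eq_intros)
  show "\<bar>r3_graph \<epsilon> i s\<bar> < 3" if "\<bar>s\<bar> \<le> 2" for i s
    using that eps bump_nonneg[of s] bump_le_1[of s] by (auto simp: r3_graph_def)
  note fp = signed_bump_fixed_point[OF eps]
  have fp': "0 > \<epsilon> * s" "\<bar>s\<bar> < 1" "\<epsilon> * bump' s > 0" if "\<epsilon> * bump s = - s" for s
    using fp[of "- s"] that by auto
  show "\<bar>s\<bar> < 2 \<and> r3_graph' \<epsilon> i s \<noteq> r3_graph' \<epsilon> j s"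
    if "i < 3" "j < 3" "i \<noteq> j" "r3_graph \<epsilon> i s = r3_graph \<epsilon> j s" for i j s
    using that(4) by (rule_tac less_3_pair_cases[OF that(1-3)])
      (use fp[of s] fp'[of s] in \<open>force+\<close>)
  show "r3_graph \<epsilon> k s \<noteq> r3_graph \<epsilon> i s"
    if "i < 3" "j < 3" "k < 3" "i \<noteq> j" "k \<noteq> i" "k \<noteq> j" "r3_graph \<epsilon> i s = r3_graph \<epsilon> j s" for i j k s
  proof -
    have "k = 0 \<or> k = 1 \<or> k = 2" using that by auto
    then show ?thesis
      using that(4-7) eps by (rule_tac less_3_pair_cases[OF that(1,2,4)]) (auto split: if_splits)
  qed
qed (use D picture sign inj in auto)

sublocale graph_picture D 3 "r3_graph \<epsilon>" "r3_graph' \<epsilon>" \<sigma> h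
  by (rule graph_picture)

text \<open>No point of the picture lies on these sides of the three strands.\<close>

definition missing :: "nat \<Rightarrow> bool" where
  "missing i \<longleftrightarrow> (if i = 2 then \<epsilon> = 1 else \<epsilon> = -1)"

abbreviation antipode :: "nat \<Rightarrow> bool" where
  "antipode \<equiv> label_of (\<lambda>i. \<not> missing i)"

text \<open>Coordinates sorted by height turn labels into corners of the abstract cube, uniformly in
  all height orders.\<close>

definition cube :: "bool \<Rightarrow> bool \<Rightarrow> bool \<Rightarrow> nat \<Rightarrow> bool" where
  "cube t m b = (\<lambda>_. False)(T := t, M := m, B := b)"

lemma distinct: "T \<noteq> M" "T \<noteq> B" "M \<noteq> B"
  using order by auto

lemma less_3_iff: "i < 3 \<longleftrightarrow> i = T \<or> i = M \<or> i = B"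
  using order distinct by auto

lemma cube_eq_iff [simp]: "cube t m b = cube t' m' b' \<longleftrightarrow> t = t' \<and> m = m' \<and> b = b'"
  using distinct by (auto simp: cube_def fun_eq_iff)

lemma label_of_cube: "label_of a = cube (label_of a T) (label_of a M) (label_of a B)"
  using distinct by (auto simp: cube_def label_of_def fun_eq_iff less_3_iff)

lemma label_of_not: "label_of (\<lambda>i. \<not> a i) = cube (\<not> label_of a T) (\<not> label_of a M) (\<not> label_of a B)"
  using distinct order by (auto simp: cube_def label_of_def fun_eq_iff less_3_iff)

text \<open>The three crossings are the vertices of the central triangle, so each lies on the
  triangle's side of the strand that does not pass through it. The triangle is the cell with label
  \<open>antipode\<close>.\<close>

lemma third_side:
  assumes "i < 3" "j < 3" "k < 3" "i \<noteq> j" "k \<noteq> i" "k \<noteq> j" "r3_graph \<epsilon> i s = r3_graph \<epsilon> j s"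
  shows "r3_graph \<epsilon> k s < r3_graph \<epsilon> i s \<longleftrightarrow> \<not> missing k"
proof -
  have fp': "0 > \<epsilon> * s" "\<bar>s\<bar> < 1" "\<epsilon> * bump' s > 0" if "\<epsilon> * bump s = - s" for s
    using signed_bump_fixed_point[OF eps, of "- s"] that by auto
  have "k = 0 \<or> k = 1 \<or> k = 2" using assms by auto
  then show ?thesis
    using assms(4-7) signed_bump_fixed_point(1)[OF eps, of s] fp'(1)[of s] eps
    by (rule_tac less_3_pair_cases[OF assms(1,2,4)]) (auto simp: missing_def)
qed

text \<open>The diagonals meet at 0, and the third strand meets them at plus and minus a fixed point
  of \<open>bump\<close>.\<close>

lemma ex_crossing:
  assumes "i < 3" "j < 3" "i \<noteq> j"
  shows "\<exists>s. \<bar>s\<bar> \<le> 1 \<and> r3_graph \<epsilon> i s = r3_graph \<epsilon> j s"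
proof -
  obtain c where c: "0 \<le> c" "c \<le> 1" "bump c = c" using ex_bump_fixed_point by blast
  have "r3_graph \<epsilon> 2 (\<epsilon> * c) = \<epsilon> * c" "r3_graph \<epsilon> 2 (- \<epsilon> * c) = \<epsilon> * c" "\<bar>\<epsilon> * c\<bar> \<le> 1"
    using c eps by auto
  then show ?thesis
    by (rule_tac less_3_pair_cases[OF assms])
      (auto intro: exI[of _ 0] exI[of _ "\<epsilon> * c"] exI[of _ "- \<epsilon> * c"])
qed

lemma crossing_quadruples_eq:
  "crossing_quadruples = {quadruple i j antipode | i j. i < 3 \<and> j < 3 \<and> h j < h i}"
proof -
  have q: "quadruple i j (lab p) = quadruple i j antipode"
    if "i < 3" "j < 3" "h j < h i" "Im p = r3_graph \<epsilon> i (Re p)" "Im p = r3_graph \<epsilon> j (Re p)" for i j p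
  proof -
    have "lab p k = antipode k" if "k \<noteq> i" "k \<noteq> j" for k
    proof (cases "k < 3")
      case True
      then show ?thesis
        using third_side[of i j k "Re p"] that \<open>i < 3\<close> \<open>j < 3\<close> \<open>h j < h i\<close>
          \<open>Im p = r3_graph \<epsilon> i (Re p)\<close> \<open>Im p = r3_graph \<epsilon> j (Re p)\<close>
        by (auto simp: lab_eq label_of_def)
    qed (simp add: lab_def label_of_def)
    then show ?thesis unfolding quadruple_def by (auto simp: fun_eq_iff)
  qed
  show ?thesis
  proof (intro equalityI subsetI)
    fix x assume "x \<in> {quadruple i j antipode | i j. i < 3 \<and> j < 3 \<and> h j < h i}"
    then obtain i j where ij: "x = quadruple i j antipode" "i < 3" "j < 3" "h j < h i" by blast
    obtain s where s: "\<bar>s\<bar> \<le> 1" "r3_graph \<epsilon> i s = r3_graph \<epsilon> j s" using ex_crossing[of i j] ij by auto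
    define p where "p = Complex s (r3_graph \<epsilon> i s)"
    have "p \<in> move_box" using bounded[OF ij(2), of s] s by (simp add: p_def move_box_def)
    moreover have "Im p = r3_graph \<epsilon> i (Re p)" "Im p = r3_graph \<epsilon> j (Re p)" using s by (simp_all add: p_def)
    ultimately show "x \<in> crossing_quadruples"
      using q[of i j p] ij unfolding crossing_quadruples_def by force
  qed (use q in \<open>force simp: crossing_quadruples_def\<close>)
qed

lemma satisfies_crossing_quadruples:
  "satisfies br crossing_quadruples G \<longleftrightarrow>
    cube_faces br (\<lambda>(t, m, b). G (cube t m b)) (antipode T) (antipode M) (antipode B)"
proof -
  have "i < 3 \<and> j < 3 \<and> h j < h i \<longleftrightarrow> (i = T \<and> j = M) \<or> (i = T \<and> j = B) \<or> (i = M \<and> j = B)" for i j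
    using order distinct by (auto simp: less_3_iff)
  then have "crossing_quadruples = {quadruple T M antipode, quadruple T B antipode, quadruple M B antipode}"
    unfolding crossing_quadruples_eq by auto
  moreover have "antipode(T := x, M := y) = cube x y (antipode B)" "antipode(T := x, B := y) = cube x (antipode M) y"
    "antipode(M := x, B := y) = cube (antipode T) x y" for x y
    using distinct by (auto simp: cube_def fun_eq_iff label_of_def less_3_iff)
  ultimately show ?thesis by (simp add: satisfies_def quadruple_def cube_faces_def)
qed

text \<open>For \<epsilon> = 1 such a point would lie above the third strand, hence have positive
  height, and below both diagonals, hence have negative height; \<epsilon> = -1 is the mirror
  image.\<close>

lemma lab_ne_missing: "z \<notin> curve D \<Longrightarrow> z \<in> move_box \<Longrightarrow> lab z \<noteq> label_of missing"
  using bump_nonneg[of "Re z"] eps box_curve[of z]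
  by (auto simp: lab_eq label_of_eq_iff all_less_3 missing_def r3_graph_def)

text \<open>Of the seven cells only the triangle stays within the core. The witnesses lie on the
  vertical axis beyond the third strand or at abscissa 3/2 in absolute value, where
  \<open>bump\<close> vanishes, so they serve both signs \<epsilon>.\<close>

lemma outer_label:
  assumes "label_of a \<noteq> label_of missing" "label_of a \<noteq> antipode"
  shows "\<exists>z\<in>open_box - core - curve D. lab z = label_of a"
proof -
  \<comment> \<open>A change of \<epsilon> exchanges the missing cell and the triangle, so the same
    two cells are excluded for both signs.\<close>
  have "\<not> (\<not> a 0 \<and> \<not> a 1 \<and> a 2)" "\<not> (a 0 \<and> a 1 \<and> \<not> a 2)"
    using assms eps by (auto simp: label_of_eq_iff all_less_3 missing_def)
  then consider "a 0" "a 1" "a 2" | "\<not> a 0" "\<not> a 1" "\<not> a 2" | "\<not> a 0" "a 1" "a 2" | "\<not> a 0" "a 1" "\<not> a 2"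
    | "a 0" "\<not> a 1" "a 2" | "a 0" "\<not> a 1" "\<not> a 2" by blast
  then obtain z where "\<bar>Re z\<bar> < 2" "\<bar>Im z\<bar> < 3" "z \<notin> core"
    "\<forall>i<3. r3_graph \<epsilon> i (Re z) \<noteq> Im z \<and> (r3_graph \<epsilon> i (Re z) < Im z \<longleftrightarrow> a i)"
  proof cases
    case 1 then show ?thesis using that[of "Complex 0 2"] eps
      by (auto simp: core_def r3_graph_def all_less_3)
  next
    case 2 then show ?thesis using that[of "Complex 0 (- 2)"] eps
      by (auto simp: core_def r3_graph_def all_less_3)
  next
    case 3 then show ?thesis using that[of "Complex (3/2) (1/2)"] bump_outside[of "3/2"]
      by (auto simp: core_def r3_graph_def all_less_3)
  next
    case 4 then show ?thesis using that[of "Complex (3/2) (- (1/2))"] bump_outside[of "3/2"]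
      by (auto simp: core_def r3_graph_def all_less_3)
  next
    case 5 then show ?thesis using that[of "Complex (- (3/2)) (1/2)"] bump_outside[of "3/2"]
      by (auto simp: core_def r3_graph_def all_less_3)
  next
    case 6 then show ?thesis using that[of "Complex (- (3/2)) (- (1/2))"] bump_outside[of "3/2"]
      by (auto simp: core_def r3_graph_def all_less_3)
  qed
  then show ?thesis
    using box_curve[of z] open_box_subset_move_box
    by (intro bexI[of _ z]) (auto simp: open_box_def lab_eq label_of_eq_iff move_box_def)
qed

lemma connected_cell: "connected (cell a)"
  using eps
proof
  assume "\<epsilon> = 1"
  then have "cell a = {z. \<bar>Re z\<bar> < 2 \<and> \<bar>Im z\<bar> < 3 \<and>
      (if a 0 then Re z < Im z else Im z < Re z) \<and> (if a 1 then - Re z < Im z else Im z < - Re z) \<and>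
      (if a 2 then bump (Re z) < Im z else Im z < bump (Re z))}"
    unfolding cell_def all_less_3 by simp
  then show ?thesis using connected_diagonal_cell[of "a 0" "a 1" "a 2"] by (simp only:)
next
  assume e: "\<epsilon> = -1"
  \<comment> \<open>Reflection in the real axis reduces \<epsilon> = -1 to \<epsilon> = 1; it
    exchanges the two diagonals and reverses above and below.\<close>
  let ?C = "{z. \<bar>Re z\<bar> < 2 \<and> \<bar>Im z\<bar> < 3 \<and>
    (if \<not> a 1 then Re z < Im z else Im z < Re z) \<and> (if \<not> a 0 then - Re z < Im z else Im z < - Re z) \<and>
    (if \<not> a 2 then bump (Re z) < Im z else Im z < bump (Re z))}"
  have mem: "z \<in> cell a \<longleftrightarrow> \<bar>Re z\<bar> < 2 \<and> \<bar>Im z\<bar> < 3 \<and>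
      (if a 0 then Re z < Im z else Im z < Re z) \<and> (if a 1 then - Re z < Im z else Im z < - Re z) \<and>
      (if a 2 then - bump (Re z) < Im z else Im z < - bump (Re z))" for z
    unfolding cell_def all_less_3 using e by simp
  have "cell a = cnj ` ?C"
  proof (intro equalityI subsetI)
    fix z assume "z \<in> cell a"
    then have c: "cnj z \<in> ?C"
      unfolding mem by (cases "a 0"; cases "a 1"; cases "a 2"; simp; linarith)
    have "z = cnj (cnj z)" by simp
    then show "z \<in> cnj ` ?C" using c by (rule image_eqI)
  next
    fix z assume "z \<in> cnj ` ?C"
    then obtain c where c: "c \<in> ?C" "z = cnj c" by blast
    show "z \<in> cell a"
      unfolding mem c(2) using c(1) by (cases "a 0"; cases "a 1"; cases "a 2"; simp; linarith)
  qed
  moreover have "connected (cnj ` ?C)"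
    by (rule connected_continuous_image[OF _ connected_diagonal_cell]) (intro continuous_intros)
  ultimately show ?thesis by (simp only:)
qed

end

text \<open>The triangle of either picture carries the label that is missing in the other. All other
  labels occur outside the core and keep their colors, so the coloring is changed only at
  \<open>?v\<close>, the label of the new triangle, where the cube lemmas give existence and
  uniqueness of the color.\<close>

lemma r3_transfers:
  assumes A: "r3_picture D \<epsilon> \<sigma> h T M B" and A': "r3_picture D' (- \<epsilon>) \<sigma> h T M B"
    and outer: "restrict_diagram (- move_box) D = restrict_diagram (- move_box) D'"
    and X: "tribracket X br"
  shows "transfers (common_region_pairs D D') X br D D'"
proof -
  interpret A: r3_picture D \<epsilon> \<sigma> h T M B by fact
  interpret A': r3_picture D' "- \<epsilon>" \<sigma> h T M B by fact
  interpret tribracket X br by fact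
  have third: "r3_graph \<epsilon> i (Re z) < Im z \<longleftrightarrow> r3_graph (- \<epsilon>) i (Re z) < Im z"
    "r3_graph \<epsilon> i (Re z) = Im z \<longleftrightarrow> r3_graph (- \<epsilon>) i (Re z) = Im z" if "z \<notin> core" for z i
    using that A.eps bump_outside[of "Re z"] bump_nonneg[of "Re z"] bump_le_1[of "Re z"]
    by (auto simp: core_def r3_graph_def)
  interpret local_replacement D D' A.lab A.crossing_quadruples A'.lab A'.crossing_quadruples
  proof
    show "z \<in> curve D \<longleftrightarrow> z \<in> curve D'" if "z \<in> move_box" "z \<notin> core" for z
      unfolding A.box_curve[OF that(1)] A'.box_curve[OF that(1)] using third(2)[OF that(2)] by metis
    show "box_labelling D A.lab A.crossing_quadruples" by (rule A.box_labelling_lab[OF A.connected_cell])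
    show "box_labelling D' A'.lab A'.crossing_quadruples" by (rule A'.box_labelling_lab[OF A'.connected_cell])
  qed (rule A.D A'.D outer)+
  have lab: "A'.lab z = A.lab z" if "z \<notin> core" for z
    using third(1)[OF that] by (simp add: A.lab_def A'.lab_def)
  have mis: "A'.missing = (\<lambda>i. \<not> A.missing i)"
    using A.eps by (auto simp: A.missing_def A'.missing_def fun_eq_iff)
  let ?v = "A.label_of A.missing"
  have v: "A.cube (?v T) (?v M) (?v B) = ?v" using A.label_of_cube[of A.missing] by simp
  have w: "A.antipode T \<longleftrightarrow> \<not> ?v T" "A.antipode M \<longleftrightarrow> \<not> ?v M" "A.antipode B \<longleftrightarrow> \<not> ?v B"
    using A.order by (auto simp: A.label_of_def)
  have sat: "satisfies br A.crossing_quadruples G \<longleftrightarrow>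
      cube_faces br (\<lambda>(t, m, b). G (A.cube t m b)) (\<not> ?v T) (\<not> ?v M) (\<not> ?v B)" for G
    unfolding A.satisfies_crossing_quadruples w ..
  have sat': "satisfies br A'.crossing_quadruples G \<longleftrightarrow>
      cube_faces br (\<lambda>(t, m, b). G (A.cube t m b)) (?v T) (?v M) (?v B)" for G
    unfolding A'.satisfies_crossing_quadruples mis not_not ..
  have cube_v: "A.cube t m b = ?v \<longleftrightarrow> t = ?v T \<and> m = ?v M \<and> b = ?v B" for t m b
    using A.cube_eq_iff[of t m b "?v T" "?v M" "?v B"] unfolding v .
  show ?thesis
  proof (rule transfers_common_region_pairs)
    fix G assume G: "range G \<subseteq> X" "satisfies br A.crossing_quadruples G"
    let ?H = "\<lambda>(t, m, b). G (A.cube t m b)"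
    have "G l \<in> X" for l using G(1) by blast
    then have "range ?H \<subseteq> X" by (simp add: image_subset_iff split_def)
    from cube_faces_extend[OF this G(2)[unfolded sat], unfolded not_not]
    obtain w where w: "w \<in> X" "cube_faces br (?H((?v T, ?v M, ?v B) := w)) (?v T) (?v M) (?v B)"
      by blast
    have "?H((?v T, ?v M, ?v B) := w) = (\<lambda>(t, m, b). (G(?v := w)) (A.cube t m b))"
      by (intro ext) (simp add: cube_v split: prod.split)
    then have "satisfies br A'.crossing_quadruples (G(?v := w))" unfolding sat' using w(2) by simp
    moreover have "range (G(?v := w)) \<subseteq> X" using G w by auto
    moreover have "(G(?v := w)) (A'.lab z) = G (A.lab z)" if "z \<in> open_box - core - curve D" for z
      using that lab[of z] A.lab_ne_missing[of z] open_box_subset_move_box by auto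
    ultimately show "\<exists>G'. range G' \<subseteq> X \<and> satisfies br A'.crossing_quadruples G' \<and>
        (\<forall>z\<in>open_box - core - curve D. G' (A'.lab z) = G (A.lab z))" by blast
  next
    fix G G' z
    assume G: "range G \<subseteq> X" "satisfies br A'.crossing_quadruples G" "range G' \<subseteq> X" "satisfies br A'.crossing_quadruples G'"
      and eq: "\<And>z. z \<in> open_box - core - curve D' \<Longrightarrow> G (A'.lab z) = G' (A'.lab z)"
      and z: "z \<in> open_box - curve D'"
    have out: "G (A.label_of a) = G' (A.label_of a)" if a: "A.label_of a \<noteq> ?v" "A.label_of a \<noteq> A.antipode" for a
    proof -
      obtain z' where "z' \<in> open_box - core - curve D'" "A'.lab z' = A.label_of a"
        using A'.outer_label[of a] a unfolding mis not_not by blast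
      then show ?thesis using eq[of z'] by simp
    qed
    have surj: "\<exists>a. A.cube t m b = A.label_of a" for t m b
      using A.distinct A.sign by (intro exI[of _ "\<lambda>i. A.cube t m b i \<longleftrightarrow> \<sigma> i = 1"])
        (auto simp: A.label_of_def A.cube_def fun_eq_iff A.less_3_iff)
    have "G (A.cube (?v T) (?v M) (?v B)) = G' (A.cube (?v T) (?v M) (?v B))"
    proof -
      have "(\<lambda>(t, m, b). G (A.cube t m b)) (?v T, ?v M, ?v B) = (\<lambda>(t, m, b). G' (A.cube t m b)) (?v T, ?v M, ?v B)"
      proof (rule cube_faces_unique[OF _ _ G(2)[unfolded sat'] G(4)[unfolded sat']])
        fix l :: "bool \<times> bool \<times> bool"
        assume l: "l \<noteq> (?v T, ?v M, ?v B)" "l \<noteq> (\<not> ?v T, \<not> ?v M, \<not> ?v B)"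
        obtain t m b where tmb: "l = (t, m, b)" by (cases l)
        obtain a where a: "A.cube t m b = A.label_of a" using surj by blast
        have "A.cube t m b \<noteq> ?v" using l(1) unfolding cube_v tmb prod.inject .
        moreover have "A.cube t m b \<noteq> A.antipode"
          using l(2) unfolding A.label_of_not tmb prod.inject A.cube_eq_iff .
        ultimately show "(\<lambda>(t, m, b). G (A.cube t m b)) l = (\<lambda>(t, m, b). G' (A.cube t m b)) l"
          unfolding a tmb prod.case by (rule out)
      qed (use G(1,3) in \<open>simp_all add: image_subset_iff split_def\<close>)
      then show ?thesis unfolding prod.case .
    qed
    then have "G ?v = G' ?v" unfolding v .
    moreover have "A'.lab z \<noteq> A.antipode"
      using A'.lab_ne_missing[of z] z open_box_subset_move_box unfolding mis by auto
    ultimately show "G (A'.lab z) = G' (A'.lab z)"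
      using out unfolding A'.lab_eq[of z] by (cases "A'.lab z = ?v") (auto simp: A'.lab_eq[of z])
  qed
qed

section \<open>The second Reidemeister move\<close>

definition r2_graph :: "bool \<Rightarrow> nat \<Rightarrow> real \<Rightarrow> real" where
  "r2_graph b i s = (if i = 0 then 0 else if b then 1 - 2 * bump s else 1)"

definition r2_graph' :: "bool \<Rightarrow> nat \<Rightarrow> real \<Rightarrow> real" where
  "r2_graph' b i s = (if i = 0 then 0 else if b then - 2 * bump' s else 0)"

lemma r2_graph_simps [simp]:
  "r2_graph b 0 s = 0" "r2_graph True (Suc 0) s = 1 - 2 * bump s" "r2_graph False (Suc 0) s = 1"
  by (simp_all add: r2_graph_def)

lemma all_less_2: "(\<forall>i<2. P i) \<longleftrightarrow> P 0 \<and> P (1::nat)"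
  by (auto simp: less_2_cases_iff)

text \<open>Only the cell above strand 0 and below strand 1 is disconnected: the abscissae with
  \<open>bump x < 1 / 2\<close> form an interval on each side of the bigon. A half-line
  \<open>J\<close> selects one of them.\<close>

lemma connected_arc_cell:
  assumes "J = UNIV \<and> (a0 \<longrightarrow> a1) \<or> J = {..<0} \<or> J = {0..}"
  shows "connected {z. Re z \<in> J \<and> \<bar>Re z\<bar> < 2 \<and> \<bar>Im z\<bar> < 3 \<and> (if a0 then 0 < Im z else Im z < 0) \<and>
    (if a1 then 1 - 2 * bump (Re z) < Im z else Im z < 1 - 2 * bump (Re z))}" (is "connected ?C")
proof -
  define lo where "lo x = max (- 3) (max (if a0 then 0 else - 3) (if a1 then 1 - 2 * bump x else - 3))" for x
  define hi where "hi x = min 3 (min (if a0 then 3 else 0) (if a1 then 3 else 1 - 2 * bump x))" for x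
  define I where "I = {x. x \<in> J \<and> \<bar>x\<bar> < 2 \<and> lo x < hi x}"
  have C: "?C = {z. Re z \<in> I \<and> lo (Re z) < Im z \<and> Im z < hi (Re z)}"
    by (cases a0; cases a1; auto simp: I_def lo_def hi_def)
  have I_iff: "x \<in> I \<longleftrightarrow> x \<in> J \<and> \<bar>x\<bar> < 2 \<and> (a0 \<and> \<not> a1 \<longrightarrow> bump x < 1 / 2) \<and>
      (\<not> a0 \<and> a1 \<longrightarrow> 1 / 2 < bump x)" for x
    using bump_nonneg[of x] bump_le_1[of x]
    by (cases a0; cases a1; auto simp: I_def lo_def hi_def)
  have "is_interval I"
    unfolding is_interval_1
  proof (intro ballI allI impI)
    fix a b x assume ab: "a \<in> I" "b \<in> I" and x: "a \<le> x \<and> x \<le> b"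
    note A = ab(1)[unfolded I_iff] and B = ab(2)[unfolded I_iff]
    show "x \<in> I"
      unfolding I_iff
    proof (intro conjI impI)
      have "\<bar>a\<bar> < 2" "\<bar>b\<bar> < 2" using A B by blast+
      then show "\<bar>x\<bar> < 2" using x by linarith
      show "x \<in> J" using assms A B x by auto
    next
      assume a: "a0 \<and> \<not> a1"
      then have J: "J = {..<0} \<or> J = {0..}" and l: "bump a < 1 / 2" "bump b < 1 / 2" using assms A B by blast+
      show "bump x < 1 / 2"
      proof (cases "J = {..<0}")
        case True
        then have "\<bar>b\<bar> \<le> \<bar>x\<bar>" using B x by auto
        then show ?thesis using bump_antimono l(2) by (meson le_less_trans)
      next
        case False
        then have "\<bar>a\<bar> \<le> \<bar>x\<bar>" using J A x by auto
        then show ?thesis using bump_antimono l(1) by (meson le_less_trans)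
      qed
    next
      assume "\<not> a0 \<and> a1"
      then have l: "1 / 2 < bump a" "1 / 2 < bump b" using A B by blast+
      have "\<bar>x\<bar> \<le> \<bar>a\<bar> \<or> \<bar>x\<bar> \<le> \<bar>b\<bar>" using x by linarith
      then show "1 / 2 < bump x" using bump_antimono l by (meson less_le_trans)
    qed
  qed
  moreover have "continuous_on I lo" "continuous_on I hi"
    unfolding lo_def[abs_def] hi_def[abs_def]
    by (cases a0; cases a1; auto intro!: continuous_intros continuous_bump)+
  ultimately show ?thesis unfolding C by (intro connected_strip) (auto simp: I_def)
qed

section \<open>The local pictures of the second move\<close>

locale r2_picture =
  fixes D :: diagram and b :: bool and \<sigma> h :: "nat \<Rightarrow> real" and ov un :: nat
  assumes D: "link_diagram D"
    and picture: "restrict_diagram move_box D =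
      local_picture 2 (\<lambda>i t. Complex (\<sigma> i * t) (r2_graph b i (\<sigma> i * t))) (\<lambda>i t. h i)"
    and sign: "i < 2 \<Longrightarrow> \<sigma> i \<in> {1, -1}" and inj: "inj_on h {..<2}"
    and order: "ov < 2" "un < 2" "h un < h ov"
begin

lemma graph_picture: "graph_picture D 2 (r2_graph b) (r2_graph' b) \<sigma> h"
proof
  show "(r2_graph b i has_real_derivative r2_graph' b i s) (at s)" for i s
    unfolding r2_graph_def[abs_def] r2_graph'_def
    by (cases "i = 0"; cases b; auto intro!: derivative_eq_intros DERIV_bump)
  show "\<bar>r2_graph b i s\<bar> < 3" for i s
    using bump_nonneg[of s] bump_le_1[of s] by (auto simp: r2_graph_def)
  show "\<bar>s\<bar> < 2 \<and> r2_graph' b i s \<noteq> r2_graph' b j s"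
    if "i < 2" "j < 2" "i \<noteq> j" "r2_graph b i s = r2_graph b j s" for i j s
  proof -
    have b: b "bump s = 1 / 2" using that by (auto simp: r2_graph_def less_2_cases_iff split: if_splits)
    then have "s \<noteq> 0" "\<bar>s\<bar> < 1" using bump_outside[of s] by fastforce+
    then show ?thesis
      using bump'_nonzero[of s] b that by (auto simp: r2_graph'_def less_2_cases_iff)
  qed
  show "r2_graph b k s \<noteq> r2_graph b i s"
    if "i < 2" "j < 2" "k < 2" "i \<noteq> j" "k \<noteq> i" "k \<noteq> j" for i j k s
    using that by auto
qed (use D picture sign inj in auto)

sublocale graph_picture D 2 "r2_graph b" "r2_graph' b" \<sigma> h
  by (rule graph_picture)

text \<open>Above strand 0 and below strand 1: the points between the parallel strands.\<close>

abbreviation mid :: "nat \<Rightarrow> bool" where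
  "mid \<equiv> label_of (\<lambda>i. i = 0)"

text \<open>Below strand 0 and above strand 1: the bigon, which exists only after the move.\<close>

abbreviation opposite :: "nat \<Rightarrow> bool" where
  "opposite \<equiv> label_of (\<lambda>i. 0 < i)"

definition pair :: "bool \<Rightarrow> bool \<Rightarrow> nat \<Rightarrow> bool" where
  "pair s t = (\<lambda>_. False)(ov := s, un := t)"

lemma ov_ne_un: "ov \<noteq> un"
  using order by auto

lemma less_2_iff: "i < 2 \<longleftrightarrow> i = ov \<or> i = un"
  using order ov_ne_un by auto

lemma pair_eq_iff [simp]: "pair s t = pair s' t' \<longleftrightarrow> s = s' \<and> t = t'"
  using ov_ne_un by (auto simp: pair_def fun_eq_iff)

lemma mid_pair: "mid = pair (mid ov) (mid un)"
  using ov_ne_un by (auto simp: pair_def label_of_def fun_eq_iff less_2_iff)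

lemma opposite_pair: "opposite = pair (\<not> mid ov) (\<not> mid un)"
  using ov_ne_un order by (auto simp: pair_def label_of_def fun_eq_iff less_2_iff)

lemma quadruple_lab: "quadruple ov un (lab p) = (pair True True, pair False True, pair True False, pair False False)"
  using ov_ne_un order by (auto simp: quadruple_def pair_def lab_def fun_eq_iff less_2_iff)

lemma over_under: "i < 2 \<Longrightarrow> j < 2 \<Longrightarrow> h j < h i \<Longrightarrow> i = ov \<and> j = un"
  using order by (auto simp: less_2_iff)

lemma label_of_cases:
  "label_of a = label_of (\<lambda>_. True) \<or> label_of a = label_of (\<lambda>_. False) \<or> label_of a = mid \<or> label_of a = opposite"
  by (auto simp: label_of_eq_iff all_less_2)

lemma lab_cases:
  "lab z = label_of (\<lambda>_. True) \<or> lab z = label_of (\<lambda>_. False) \<or> lab z = mid \<or> lab z = opposite"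
  unfolding lab_eq by (rule label_of_cases)

lemma pair_label_of: "pair s t = label_of (\<lambda>i. pair s t i \<longleftrightarrow> \<sigma> i = 1)"
  by (rule ext) (auto simp: label_of_def pair_def less_2_iff)

lemma label_distinct: "label_of (\<lambda>_. True) \<noteq> mid" "label_of (\<lambda>_. False) \<noteq> mid" "mid \<noteq> opposite"
  by (auto simp: label_of_eq_iff all_less_2)

lemma outer_labels:
  "\<exists>z\<in>open_box - core - curve D. lab z = label_of (\<lambda>_. True)"
  "\<exists>z\<in>open_box - core - curve D. lab z = label_of (\<lambda>_. False)"
  "\<exists>z\<in>open_box - core - curve D. lab z = mid \<and> Re z < 0"
  "\<exists>z\<in>open_box - core - curve D. lab z = mid \<and> \<not> Re z < 0"
proof -
  have *: "z \<in> open_box - core - curve D \<and> lab z = label_of a"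
    if "\<bar>Re z\<bar> < 2" "\<bar>Im z\<bar> < 3" "\<not> (\<bar>Re z\<bar> \<le> 1 \<and> \<bar>Im z\<bar> \<le> 1)"
      "\<forall>i<2. r2_graph b i (Re z) \<noteq> Im z \<and> (r2_graph b i (Re z) < Im z \<longleftrightarrow> a i)" for z a
    using that box_curve[of z] open_box_subset_move_box
    by (auto simp: open_box_def core_def lab_eq label_of_eq_iff move_box_def)
  have b: "bump (3 / 2) = 0" by (rule bump_outside) simp
  show "\<exists>z\<in>open_box - core - curve D. lab z = label_of (\<lambda>_. True)"
    using *[of "Complex 0 2" "\<lambda>_. True"]
    by (intro bexI[of _ "Complex 0 2"]) (auto simp: all_less_2 r2_graph_def)
  show "\<exists>z\<in>open_box - core - curve D. lab z = label_of (\<lambda>_. False)"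
    using *[of "Complex 0 (- 2)" "\<lambda>_. False"]
    by (intro bexI[of _ "Complex 0 (- 2)"]) (auto simp: all_less_2 r2_graph_def)
  show "\<exists>z\<in>open_box - core - curve D. lab z = mid \<and> Re z < 0"
    using *[of "Complex (- (3 / 2)) (1 / 2)" "\<lambda>i. i = 0"] b
    by (intro bexI[of _ "Complex (- (3 / 2)) (1 / 2)"]) (auto simp: all_less_2 r2_graph_def)
  show "\<exists>z\<in>open_box - core - curve D. lab z = mid \<and> \<not> Re z < 0"
    using *[of "Complex (3 / 2) (1 / 2)" "\<lambda>i. i = 0"] b
    by (intro bexI[of _ "Complex (3 / 2) (1 / 2)"]) (auto simp: all_less_2 r2_graph_def)
qed

end

locale r2_parallel = r2_picture D False \<sigma> h ov un for D \<sigma> h ov un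
begin

lemma crossing_quadruples_empty: "crossing_quadruples = {}"
proof -
  have False if "i < 2" "j < 2" "h j < h i" "y = r2_graph False i x" "y = r2_graph False j x" for i j x y
  proof -
    have "i = 0 \<or> i = 1" "j = 0 \<or> j = 1" using that by auto
    then show False using that by auto
  qed
  then show ?thesis unfolding crossing_quadruples_def by blast
qed

lemma lab_ne_opposite: "lab z \<noteq> opposite"
  by (auto simp: lab_eq label_of_eq_iff all_less_2)

lemma connected_cell: "connected (cell a)"
proof -
  have "cell a = {z. \<bar>Re z\<bar> < 2 \<and> \<bar>Im z\<bar> < 3 \<and> (if a 0 then 0 < Im z else Im z < 0) \<and>
      (if a 1 then 1 < Im z else Im z < 1)}"
    unfolding cell_def all_less_2 by simp
  also have "\<dots> = {z. Re z \<in> (if a 1 \<and> \<not> a 0 then {} else {-2<..<2}) \<and>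
      (if a 1 then 1 else if a 0 then 0 else - 3) < Im z \<and>
      Im z < (if \<not> a 0 then 0 else if \<not> a 1 then 1 else 3)}"
    by (cases "a 0"; cases "a 1"; auto)
  finally show ?thesis
    using connected_strip[of "if a 1 \<and> \<not> a 0 then {} else {-2<..<2}"
      "\<lambda>_. if a 1 then 1 else if a 0 then 0 else - 3" "\<lambda>_. if \<not> a 0 then 0 else if \<not> a 1 then 1 else 3"]
    by (cases "a 0"; cases "a 1"; simp add: is_interval_oo)
qed

lemma box_labelling: "box_labelling D lab {}"
  using box_labelling_lab[OF connected_cell] by (simp only: crossing_quadruples_empty)

end

locale r2_crossing = r2_picture D True \<sigma> h ov un for D \<sigma> h ov un
begin

text \<open>The points between the two strands form two components, on both sides of the bigon.\<close>

definition split :: "bool \<Rightarrow> (nat \<Rightarrow> bool) \<Rightarrow> (nat \<Rightarrow> bool) \<times> bool" where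
  "split s l = (l, s \<and> l = mid)"

definition slab :: "complex \<Rightarrow> (nat \<Rightarrow> bool) \<times> bool" where
  "slab z = split (Re z < 0) (lab z)"

text \<open>Both crossings see the same four combinations of sides; they differ in the copy of
  \<open>mid\<close> that they touch.\<close>

definition split_quadruples ::
  "(((nat \<Rightarrow> bool) \<times> bool) \<times> ((nat \<Rightarrow> bool) \<times> bool) \<times> ((nat \<Rightarrow> bool) \<times> bool) \<times> ((nat \<Rightarrow> bool) \<times> bool)) set"
  where
  "split_quadruples = range (\<lambda>s. (split s (pair True True), split s (pair False True),
     split s (pair True False), split s (pair False False)))"

lemma satisfies_split_quadruples:
  "satisfies br split_quadruples G \<longleftrightarrow> (\<forall>s. face br (\<lambda>(t, u). G (split s (pair t u))))"
  by (auto simp: satisfies_def split_quadruples_def face_def)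

text \<open>On the line \<open>Re z = 0\<close> strand 1 has height -1 and is below strand 0, so
  nothing lies between them there and the sign of \<open>Re z\<close> is a locally constant way to
  separate the two parts.\<close>

lemma lab_mid_Re: "z \<in> open_box \<Longrightarrow> lab z = mid \<Longrightarrow> Re z \<noteq> 0"
  by (auto simp: lab_eq label_of_eq_iff all_less_2)

lemma eventually_Re_sign: "Re z \<noteq> 0 \<Longrightarrow> \<forall>\<^sub>F w in nhds z. Re w < 0 \<longleftrightarrow> Re z < 0"
proof -
  assume "Re z \<noteq> 0"
  then consider "Re z < 0" | "Re z > 0" by linarith
  then show ?thesis
  proof cases
    case 1
    then have "\<forall>\<^sub>F w in nhds z. w \<in> {w. Re w < 0}"
      by (intro eventually_nhds_in_open open_Collect_less continuous_intros) auto
    then show ?thesis by eventually_elim (use 1 in auto)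
  next
    case 2
    then have "\<forall>\<^sub>F w in nhds z. w \<in> {w. 0 < Re w}"
      by (intro eventually_nhds_in_open open_Collect_less continuous_intros) auto
    then show ?thesis by eventually_elim (use 2 in auto)
  qed
qed

lemma slab_locally_constant:
  assumes "z \<in> open_box - curve D"
  shows "\<forall>\<^sub>F w in nhds z. slab w = slab z"
proof (cases "lab z = mid")
  case True
  then have "Re z \<noteq> 0" using lab_mid_Re assms by blast
  show ?thesis
    using lab_locally_constant[OF assms] eventually_Re_sign[OF \<open>Re z \<noteq> 0\<close>]
    by eventually_elim (simp add: slab_def)
next
  case False
  show ?thesis using lab_locally_constant[OF assms]
    by eventually_elim (use False in \<open>simp add: slab_def split_def\<close>)
qed

lemma mem_cell:
  "z \<in> cell a \<longleftrightarrow> \<bar>Re z\<bar> < 2 \<and> \<bar>Im z\<bar> < 3 \<and> (if a 0 then 0 < Im z else Im z < 0) \<and>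
    (if a 1 then 1 - 2 * bump (Re z) < Im z else Im z < 1 - 2 * bump (Re z))"
  unfolding cell_def all_less_2 by simp

lemma connected_slab_fibre: "connected {z \<in> open_box - curve D. slab z = l}"
proof -
  obtain l1 s where l: "l = (l1, s)" by (cases l)
  show ?thesis
  proof (cases "l1 \<in> range label_of")
    case False
    then have "{z \<in> open_box - curve D. slab z = l} = {}" by (auto simp: slab_def split_def lab_eq l)
    then show ?thesis by (simp only: connected_empty)
  next
    case True
    then obtain a where a: "l1 = label_of a" by blast
    define J where "J = (if l1 = mid then (if s then {..<0} else {0..}) else (UNIV :: real set))"
    show ?thesis
    proof (cases "s \<and> l1 \<noteq> mid")
      case True
      then have "{z \<in> open_box - curve D. slab z = l} = {}" by (auto simp: slab_def split_def l)
      then show ?thesis by (simp only: connected_empty)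
    next
      case False
      have "{z \<in> open_box - curve D. slab z = l} = {z. Re z \<in> J \<and> z \<in> {z \<in> open_box - curve D. lab z = l1}}"
        using False by (auto simp: slab_def split_def l J_def)
      also have "\<dots> = {z. Re z \<in> J \<and> z \<in> cell a}" unfolding a lab_fibre ..
      also have "connected \<dots>"
        unfolding mem_cell
      proof (rule connected_arc_cell)
        show "J = UNIV \<and> (a 0 \<longrightarrow> a 1) \<or> J = {..<0} \<or> J = {0..}"
          by (auto simp: J_def a label_of_eq_iff all_less_2)
      qed
      finally show ?thesis .
    qed
  qed
qed

lemma crossing_slab:
  assumes p: "p \<in> move_box" "Im p = r2_graph True ov (Re p)" "Im p = r2_graph True un (Re p)"
  shows "crossing_labels slab p (dir ov (Re p)) (dir un (Re p))
    (split (Re p < 0) (pair True True), split (Re p < 0) (pair False True),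
     split (Re p < 0) (pair True False), split (Re p < 0) (pair False False))"
proof -
  have "Re p \<noteq> 0"
    using p(2,3) order ov_ne_un by (auto simp: less_2_cases_iff)
  then obtain A where A: "open A" "p \<in> A" "\<And>w. w \<in> A \<Longrightarrow> (Re w < 0 \<longleftrightarrow> Re p < 0)"
    using eventually_Re_sign[of p] unfolding eventually_nhds by blast
  have "crossing_labels lab p (dir ov (Re p)) (dir un (Re p))
      (pair True True, pair False True, pair True False, pair False False)"
    using crossing_labels_quadruple[OF p(1) order p(2,3)] unfolding quadruple_lab .
  then obtain w1 w2 w3 w4 where s: "sector_vectors (dir ov (Re p)) (dir un (Re p)) w1 w2 w3 w4"
    and l: "\<forall>\<^sub>F e in at_right (0::real). lab (p + of_real e * w1) = pair True True \<and>
        lab (p + of_real e * w2) = pair False True \<and>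
        lab (p + of_real e * w3) = pair True False \<and> lab (p + of_real e * w4) = pair False False"
    unfolding crossing_labels_def by auto
  note ray = eventually_ray_open[OF A(1,2)]
  have "\<forall>\<^sub>F e in at_right (0::real). slab (p + of_real e * w1) = split (Re p < 0) (pair True True) \<and>
        slab (p + of_real e * w2) = split (Re p < 0) (pair False True) \<and>
        slab (p + of_real e * w3) = split (Re p < 0) (pair True False) \<and>
        slab (p + of_real e * w4) = split (Re p < 0) (pair False False)"
    using l ray[of w1] ray[of w2] ray[of w3] ray[of w4]
    by eventually_elim (simp only: slab_def A(3) simp_thms)
  then show ?thesis unfolding crossing_labels_def using s by auto
qed

text \<open>The two crossings lie on the real axis, at plus and minus a point where
  \<open>bump\<close> is 1/2.\<close>

lemma ex_crossing: "\<exists>p\<in>move_box. (Re p < 0 \<longleftrightarrow> s) \<and> Im p = r2_graph True ov (Re p) \<and> Im p = r2_graph True un (Re p)"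
proof -
  have "\<exists>c\<ge>0. c \<le> 1 \<and> bump c = 1 / 2"
    by (rule IVT2') (auto simp: bump_outside intro!: continuous_bump)
  then obtain c where c: "0 \<le> c" "c \<le> 1" "bump c = 1 / 2" by blast
  then have "0 < c" by (cases "c = 0") auto
  have "r2_graph True i x = 0" if "bump x = 1 / 2" "i < 2" for i x
    using that by (auto simp: less_2_cases_iff)
  then show ?thesis
    using c \<open>0 < c\<close> order
    by (intro bexI[of _ "Complex (if s then - c else c) 0"]) (auto simp: move_box_def)
qed

lemma box_labelling: "box_labelling D slab split_quadruples"
  unfolding box_labelling_def
proof (intro conjI ballI allI impI)
  show "p \<in> open_box" if "is_crossing D p u v \<and> p \<in> move_box" for p u v
    using that crossing_in_open_box by blast
  show "\<exists>q\<in>split_quadruples. crossing_labels slab p u v q"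
    if c: "is_crossing D p u v \<and> p \<in> move_box" for p u v
  proof -
    obtain i j where ij: "i < 2" "j < 2" "h j < h i" "Im p = r2_graph True i (Re p)" "Im p = r2_graph True j (Re p)"
      "u = dir i (Re p)" "v = dir j (Re p)"
      using c box_crossing by blast
    then have "i = ov" "j = un" using over_under by blast+
    then show ?thesis
      using crossing_slab[of p] c ij unfolding split_quadruples_def by blast
  qed
  show "\<exists>p u v. is_crossing D p u v \<and> p \<in> open_box \<and> crossing_labels slab p u v q"
    if q: "q \<in> split_quadruples" for q
  proof -
    obtain s where s: "q = (split s (pair True True), split s (pair False True),
       split s (pair True False), split s (pair False False))"
      using q unfolding split_quadruples_def by blast
    obtain p where p: "p \<in> move_box" "(Re p < 0 \<longleftrightarrow> s)" "Im p = r2_graph True ov (Re p)" "Im p = r2_graph True un (Re p)"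
      using ex_crossing by blast
    then have "is_crossing D p (dir ov (Re p)) (dir un (Re p))" unfolding box_crossing[OF p(1)] using order by blast
    moreover have "crossing_labels slab p (dir ov (Re p)) (dir un (Re p)) q"
      using crossing_slab[OF p(1,3,4)] unfolding s p(2) .
    ultimately show ?thesis using crossing_in_open_box p(1) by blast
  qed
qed (use slab_locally_constant connected_slab_fibre in blast)+

end

text \<open>Forwards, both copies of \<open>mid\<close> keep one old color, so the two crossings
  impose the same face equation, and it determines the color of the bigon. Backwards, the faces at
  the two crossings share their other three corners, so the copies of \<open>mid\<close> have equal
  colors and can be merged.\<close>

lemma r2_transfers:
  fixes X :: "'x set"
  assumes A: "r2_parallel D \<sigma> h ov un" and A': "r2_crossing D' \<sigma> h ov un"
    and outer: "restrict_diagram (- move_box) D = restrict_diagram (- move_box) D'"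
    and X: "tribracket X br"
  shows "transfers (common_region_pairs D D') X br D D'" "transfers (common_region_pairs D' D) X br D' D"
proof -
  interpret A: r2_parallel D \<sigma> h ov un by fact
  interpret A': r2_crossing D' \<sigma> h ov un by fact
  interpret tribracket X br by fact
  have third: "r2_graph False i (Re z) < Im z \<longleftrightarrow> r2_graph True i (Re z) < Im z"
    "r2_graph False i (Re z) = Im z \<longleftrightarrow> r2_graph True i (Re z) = Im z" if "z \<notin> core" for z i
    using that bump_outside[of "Re z"] bump_nonneg[of "Re z"] bump_le_1[of "Re z"]
    by (auto simp: core_def r2_graph_def)
  have cv: "z \<in> curve D \<longleftrightarrow> z \<in> curve D'" if "z \<in> move_box" "z \<notin> core" for z
    unfolding A.box_curve[OF that(1)] A'.box_curve[OF that(1)] using third(2)[OF that(2)] by metis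
  have lab: "A'.lab z = A.lab z" if "z \<notin> core" for z
    using third(1)[OF that] by (simp add: A.lab_def A'.lab_def)
  have replacement: "local_replacement D D' A.lab {} A'.slab A'.split_quadruples"
    "local_replacement D' D A'.slab A'.split_quadruples A.lab {}"
    using A.D A'.D outer cv A.box_labelling A'.box_labelling by (auto simp: local_replacement_def)
  let ?m = "A.mid" and ?n = "A.opposite"
  have pairs: "A.pair t u = ?m \<longleftrightarrow> t = ?m ov \<and> u = ?m un" "A.pair t u = ?n \<longleftrightarrow> t = (\<not> ?m ov) \<and> u = (\<not> ?m un)" for t u
    using A.pair_eq_iff[of t u "?m ov" "?m un"] A.pair_eq_iff[of t u "\<not> ?m ov" "\<not> ?m un"]
    unfolding A.mid_pair[symmetric] A.opposite_pair[symmetric] by blast+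
  have mn: "?m = A.pair (?m ov) (?m un)" "?n = A.pair (\<not> ?m ov) (\<not> ?m un)" by (rule A.mid_pair, rule A.opposite_pair)
  have splits: "A'.split s l = (l, s \<and> l = ?m)" for s l by (simp add: A'.split_def)
  interpret r: local_replacement D D' A.lab "{}" A'.slab A'.split_quadruples by (rule replacement)
  interpret r': local_replacement D' D A'.slab A'.split_quadruples A.lab "{}" by (rule replacement)
  show "transfers (common_region_pairs D D') X br D D'"
  proof (rule r.transfers_common_region_pairs)
    fix G :: "(nat \<Rightarrow> bool) \<Rightarrow> 'x" assume G: "range G \<subseteq> X"
    let ?H = "\<lambda>(t, u). G (A.pair t u)"
    have GX: "G l \<in> X" for l using G by blast
    then have "range ?H \<subseteq> X" by (simp add: image_subset_iff split_def)
    from face_extend[OF this] obtain w where w: "w \<in> X" "face br (?H((\<not> ?m ov, \<not> ?m un) := w))" by blast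
    \<comment> \<open>The Boolean is ignored: both parts between the strands inherit one color, and
      the bigon receives \<open>w\<close>.\<close>
    define G' where "G' ls = (if fst ls = ?n then w else G (fst ls))" for ls :: "(nat \<Rightarrow> bool) \<times> bool"
    have "(\<lambda>(t, u). G' (A'.split s (A.pair t u))) = ?H((\<not> ?m ov, \<not> ?m un) := w)" for s
      by (rule ext) (simp add: G'_def splits pairs split: prod.split)
    then have "satisfies br A'.split_quadruples G'" unfolding A'.satisfies_split_quadruples using w(2) by simp
    moreover have "range G' \<subseteq> X" using GX w(1) by (auto simp: G'_def)
    moreover have "G' (A'.slab z) = G (A.lab z)" if "z \<in> open_box - core - curve D" for z
      using that lab[of z] A.lab_ne_opposite[of z] by (simp add: G'_def A'.slab_def splits)
    ultimately show "\<exists>G'. range G' \<subseteq> X \<and> satisfies br A'.split_quadruples G' \<and>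
        (\<forall>z\<in>open_box - core - curve D. G' (A'.slab z) = G (A.lab z))" by blast
  next
    fix G G' z
    assume G: "range G \<subseteq> X" "satisfies br A'.split_quadruples G" "range G' \<subseteq> X" "satisfies br A'.split_quadruples G'"
      and eq: "\<And>z. z \<in> open_box - core - curve D' \<Longrightarrow> G (A'.slab z) = G' (A'.slab z)"
      and z: "z \<in> open_box - curve D'"
    obtain z1 z2 z3 z4 where zs: "z1 \<in> open_box - core - curve D'" "A'.lab z1 = A.label_of (\<lambda>_. True)"
      "z2 \<in> open_box - core - curve D'" "A'.lab z2 = A.label_of (\<lambda>_. False)"
      "z3 \<in> open_box - core - curve D'" "A'.lab z3 = ?m" "Re z3 < 0"
      "z4 \<in> open_box - core - curve D'" "A'.lab z4 = ?m" "\<not> Re z4 < 0"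
      using A'.outer_labels by blast
    have out: "G (A'.split s l) = G' (A'.split s l)" if "l \<noteq> ?n" "\<exists>z. l = A'.lab z" for s l
    proof -
      have "l = A.label_of (\<lambda>_. True) \<or> l = A.label_of (\<lambda>_. False) \<or> l = ?m"
        using that A'.lab_cases by blast
      then show ?thesis
        using eq[OF zs(1)] eq[OF zs(3)] eq[OF zs(5)] eq[OF zs(8)] zs A.label_distinct
        by (cases s) (auto simp: A'.slab_def splits)
    qed
    have surj: "\<exists>z. A.pair t u = A'.lab z" if "A.pair t u \<noteq> ?n" for t u
    proof -
      have "A.pair t u = A.label_of (\<lambda>_. True) \<or> A.pair t u = A.label_of (\<lambda>_. False) \<or> A.pair t u = ?m"
        using that A.label_of_cases[of "\<lambda>i. A.pair t u i \<longleftrightarrow> \<sigma> i = 1"]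
        unfolding A.pair_label_of[symmetric] by blast
      then show ?thesis using zs by metis
    qed
    have n: "G (A'.split False ?n) = G' (A'.split False ?n)"
    proof -
      let ?K = "\<lambda>G (t, u). G (A'.split False (A.pair t u))"
      have "?K G (\<not> ?m ov, \<not> ?m un) = ?K G' (\<not> ?m ov, \<not> ?m un)"
      proof (rule face_unique)
        show "face br (?K G)" "face br (?K G')"
          using G(2,4) unfolding A'.satisfies_split_quadruples by blast+
        show "range (?K G) \<subseteq> X" "range (?K G') \<subseteq> X" using G(1,3) by auto
        fix l assume l: "l \<noteq> (\<not> ?m ov, \<not> ?m un)"
        obtain t u where tu: "l = (t, u)" by (cases l)
        then have "A.pair t u \<noteq> ?n" using l pairs(2) by auto
        then show "?K G l = ?K G' l" using out[of "A.pair t u" False] surj[of t u] tu by simp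
      qed
      then show ?thesis unfolding prod.case mn(2)[symmetric] .
    qed
    show "G (A'.slab z) = G' (A'.slab z)"
    proof (cases "A'.lab z = ?n")
      case True
      then have "A'.slab z = A'.split False ?n" using A.label_distinct(3)[symmetric] by (simp add: A'.slab_def splits)
      then show ?thesis using n by simp
    next
      case False
      then show ?thesis using out[of "A'.lab z" "Re z < 0"] by (auto simp: A'.slab_def)
    qed
  qed
  show "transfers (common_region_pairs D' D) X br D' D"
  proof (rule r'.transfers_common_region_pairs)
    fix G assume G: "range G \<subseteq> X" "satisfies br A'.split_quadruples G"
    let ?K = "\<lambda>s (t, u). G (A'.split s (A.pair t u))"
    have "?K True (?m ov, ?m un) = ?K False (?m ov, ?m un)"
    proof (rule face_unique)
      show "face br (?K True)" "face br (?K False)"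
        using G(2) unfolding A'.satisfies_split_quadruples by blast+
      show "range (?K True) \<subseteq> X" "range (?K False) \<subseteq> X" using G(1) by auto
      fix l assume l: "l \<noteq> (?m ov, ?m un)"
      obtain t u where tu: "l = (t, u)" by (cases l)
      then have "A.pair t u \<noteq> ?m" using l pairs(1) by auto
      then show "?K True l = ?K False l" by (simp add: tu splits)
    qed
    then have "G (A'.split True ?m) = G (A'.split False ?m)" unfolding prod.case mn(1)[symmetric] .
    then have m: "G (A'.split s l) = G (A'.split False l)" for s l
      by (cases "l = ?m"; cases s) (simp_all add: splits)
    show "\<exists>G'. range G' \<subseteq> X \<and> satisfies br {} G' \<and>
        (\<forall>z\<in>open_box - core - curve D'. G' (A.lab z) = G (A'.slab z))"
    proof (intro exI[of _ "\<lambda>l. G (A'.split False l)"] conjI ballI)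
      fix z assume "z \<in> open_box - core - curve D'"
      then show "G (A'.split False (A.lab z)) = G (A'.slab z)"
        using lab[of z] m[of "Re z < 0" "A.lab z"] by (simp add: A'.slab_def)
    qed (use G(1) in \<open>auto simp: satisfies_def\<close>)
  next
    fix G G' z
    assume eq: "\<And>z. z \<in> open_box - core - curve D \<Longrightarrow> G (A.lab z) = G' (A.lab z)"
    have "A.lab z = A.label_of (\<lambda>_. True) \<or> A.lab z = A.label_of (\<lambda>_. False) \<or> A.lab z = ?m"
      using A.lab_cases A.lab_ne_opposite by blast
    then obtain z' where "z' \<in> open_box - core - curve D" "A.lab z' = A.lab z"
      using A.outer_labels by metis
    then show "G (A.lab z) = G' (A.lab z)" using eq[of z'] by simp
  qed
qed

section \<open>The first Reidemeister move\<close>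

text \<open>
  In the kink the point with parameter \<open>s\<close> has height \<open>bump s\<close> and horizontal coordinate \<open>\<plusminus>\<close> the following
  function of the height.
\<close>

definition kink_width :: "real \<Rightarrow> real" where
  "kink_width y = (let c = sqrt (min 1 (max 0 y)) in sqrt (1 - c) * (3 / 4 - c))"

lemma kink_width_simps:
  "y \<le> 0 \<Longrightarrow> kink_width y = 3 / 4" "1 \<le> y \<Longrightarrow> kink_width y = 0"
  "0 \<le> y \<Longrightarrow> y \<le> 1 \<Longrightarrow> kink_width y = sqrt (1 - sqrt y) * (3 / 4 - sqrt y)"
  by (simp_all add: kink_width_def Let_def)

lemma continuous_kink_width: "continuous_on A kink_width"
  unfolding kink_width_def[abs_def] Let_def by (intro continuous_intros)

lemma abs_kink_width_le: "\<bar>kink_width y\<bar> \<le> 3 / 4"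
proof -
  define c where "c = sqrt (min 1 (max 0 y))"
  have "0 \<le> c" "c \<le> 1" by (simp_all add: c_def)
  then have "\<bar>sqrt (1 - c)\<bar> \<le> 1" by auto
  moreover have "\<bar>3 / 4 - c\<bar> \<le> 3 / 4" using \<open>0 \<le> c\<close> \<open>c \<le> 1\<close> unfolding abs_le_iff by linarith
  ultimately have "\<bar>sqrt (1 - c)\<bar> * \<bar>3 / 4 - c\<bar> \<le> 1 * (3 / 4)" by (intro mult_mono) auto
  then show ?thesis by (simp add: kink_width_def c_def Let_def abs_mult)
qed

lemma sqrt_9_16: "sqrt (9 / 16) = 3 / 4"
  by (rule real_sqrt_unique) (auto simp: power2_eq_square)

text \<open>The double point has parameters \<plusminus>1/2, hence height
  \<open>bump (1 / 2) = 9 / 16\<close>; there the two arms of the kink meet and the width changes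
  sign.\<close>

lemma kink_width_9_16: "kink_width (9 / 16) = 0"
  using sqrt_9_16 by (simp add: kink_width_simps(3))

lemma kink_width_pos: "y < 9 / 16 \<Longrightarrow> 0 < kink_width y"
proof -
  assume y: "y < 9 / 16"
  show ?thesis
  proof (cases "y \<le> 0")
    case False
    then have "sqrt y < 3 / 4" using y real_sqrt_less_mono[OF y] sqrt_9_16 by simp
    then show ?thesis using False y by (simp add: kink_width_simps(3))
  qed (simp add: kink_width_simps)
qed

lemma kink_width_neg: "9 / 16 < y \<Longrightarrow> y < 1 \<Longrightarrow> kink_width y < 0"
proof -
  assume y: "9 / 16 < y" "y < 1"
  then have "3 / 4 < sqrt y" using real_sqrt_less_mono[OF y(1)] sqrt_9_16 by simp
  moreover have "sqrt y < 1" using y by simp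
  ultimately show ?thesis using y by (simp add: kink_width_simps(3) mult_pos_neg)
qed

section \<open>The parametrized kink and its double point\<close>

definition kink :: "real \<Rightarrow> complex" where
  "kink s = Complex (s ^ 3 - s / 4) (bump s)"

lemma bump_inside: "\<bar>s\<bar> \<le> 1 \<Longrightarrow> bump s = (1 - s\<^sup>2)\<^sup>2"
  using abs_square_le_1[of s] by (simp add: bump_def max_def)

lemma cubic_eq: "s ^ 3 - s / 4 = s * (s\<^sup>2 - 1 / 4)" for s :: real
  by (simp add: power3_eq_cube power2_eq_square algebra_simps)

lemma kink_range_aux:
  assumes "3 / 4 \<le> x" "x \<le> 2"
  shows "\<exists>s\<ge>1. s ^ 3 - s / 4 = (x::real)"
proof -
  have "\<exists>s\<ge>1. s \<le> 2 \<and> s ^ 3 - s / 4 = x"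
    by (rule IVT') (use assms in \<open>auto intro!: continuous_intros\<close>)
  then show ?thesis by blast
qed

text \<open>For \<open>\<bar>s\<bar> < 1\<close> the height \<open>y\<close> is the square of
  \<open>1 - s\<^sup>2\<close>, so \<open>s\<^sup>2 = 1 - sqrt y\<close>, and the abscissa
  \<open>s * (s\<^sup>2 - 1 / 4)\<close> becomes \<open>kink_width y\<close> up to sign. For
  \<open>\<bar>s\<bar> \<ge> 1\<close> the kink runs on the real axis from \<plusminus>3/4
  outwards.\<close>

lemma kink_range:
  assumes "\<bar>Re z\<bar> \<le> 2"
  shows "z \<in> range kink \<longleftrightarrow> (Im z = 0 \<and> 3 / 4 \<le> \<bar>Re z\<bar>) \<or> (0 < Im z \<and> Im z \<le> 1 \<and> \<bar>Re z\<bar> = \<bar>kink_width (Im z)\<bar>)"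
proof
  assume "z \<in> range kink"
  then obtain s where s: "Re z = s * (s\<^sup>2 - 1 / 4)" "Im z = bump s" by (auto simp: kink_def cubic_eq)
  show "(Im z = 0 \<and> 3 / 4 \<le> \<bar>Re z\<bar>) \<or> (0 < Im z \<and> Im z \<le> 1 \<and> \<bar>Re z\<bar> = \<bar>kink_width (Im z)\<bar>)"
  proof (cases "1 \<le> \<bar>s\<bar>")
    case True
    then have "1 \<le> s\<^sup>2" using abs_le_square_iff[of 1 s] by simp
    then have "1 * (3 / 4) \<le> \<bar>s\<bar> * \<bar>s\<^sup>2 - 1 / 4\<bar>" using True by (intro mult_mono) auto
    then show ?thesis using s bump_outside[OF True] by (simp add: abs_mult)
  next
    case False
    then have l: "s\<^sup>2 < 1" using abs_square_less_1[of s] by simp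
    have y: "Im z = (1 - s\<^sup>2)\<^sup>2" using s False bump_inside[of s] by simp
    then have sq: "sqrt (Im z) = 1 - s\<^sup>2" using l by (simp add: real_sqrt_unique)
    have "0 < Im z" using y l by simp
    moreover have "Im z \<le> 1" using s bump_le_1 by simp
    ultimately have "kink_width (Im z) = sqrt (1 - (1 - s\<^sup>2)) * (3 / 4 - (1 - s\<^sup>2))"
      unfolding sq[symmetric] by (intro kink_width_simps(3)) simp_all
    also have "\<dots> = \<bar>s\<bar> * (s\<^sup>2 - 1 / 4)" by simp
    finally have "kink_width (Im z) = \<bar>s\<bar> * (s\<^sup>2 - 1 / 4)" .
    then show ?thesis using s(1) \<open>0 < Im z\<close> \<open>Im z \<le> 1\<close> by (simp add: abs_mult)
  qed
next
  assume "(Im z = 0 \<and> 3 / 4 \<le> \<bar>Re z\<bar>) \<or> (0 < Im z \<and> Im z \<le> 1 \<and> \<bar>Re z\<bar> = \<bar>kink_width (Im z)\<bar>)"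
  then show "z \<in> range kink"
  proof
    assume z: "Im z = 0 \<and> 3 / 4 \<le> \<bar>Re z\<bar>"
    then obtain s where s: "1 \<le> s" "s ^ 3 - s / 4 = \<bar>Re z\<bar>" using kink_range_aux[of "\<bar>Re z\<bar>"] assms by blast
    have "bump s = 0" using s by (intro bump_outside) auto
    then have "z = kink s \<or> z = kink (- s)" using s(2) z by (auto simp: kink_def complex_eq_iff abs_if split: if_splits)
    then show ?thesis by blast
  next
    assume z: "0 < Im z \<and> Im z \<le> 1 \<and> \<bar>Re z\<bar> = \<bar>kink_width (Im z)\<bar>"
    define s where "s = sqrt (1 - sqrt (Im z))"
    have s2: "s\<^sup>2 = 1 - sqrt (Im z)" using z by (simp add: s_def)
    have "0 \<le> s" "s \<le> 1" using z by (simp_all add: s_def)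
    then have "bump s = Im z" using bump_inside[of s] s2 z by simp
    moreover have "s * (s\<^sup>2 - 1 / 4) = kink_width (Im z)"
      using z by (simp add: s2 kink_width_simps(3)) (simp add: s_def)
    ultimately have "kink s = Complex (kink_width (Im z)) (Im z)" "kink (- s) = Complex (- kink_width (Im z)) (Im z)"
      unfolding kink_def cubic_eq by simp_all
    moreover have "Re z = kink_width (Im z) \<or> Re z = - kink_width (Im z)" using z by linarith
    ultimately have "z = kink s \<or> z = kink (- s)" by (auto simp: complex_eq_iff)
    then show ?thesis by blast
  qed
qed

lemma kink_half: "kink (1 / 2) = Complex 0 (9 / 16)" "kink (- (1 / 2)) = Complex 0 (9 / 16)"
  by (auto simp: kink_def power3_eq_cube bump_inside power2_eq_square)

text \<open>Equal positive heights force \<open>s' = - s\<close>, and then the odd cubic vanishes at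
  \<open>s\<close>, so that \<open>s\<close> is \<plusminus>1/2. At height 0 the parameters have
  absolute value at least 1, where the cubic is injective.\<close>

lemma kink_eq_iff:
  assumes "s \<noteq> s'"
  shows "kink s = kink s' \<longleftrightarrow> (s = 1 / 2 \<and> s' = - (1 / 2)) \<or> (s = - (1 / 2) \<and> s' = 1 / 2)"
proof
  assume "(s = 1 / 2 \<and> s' = - (1 / 2)) \<or> (s = - (1 / 2) \<and> s' = 1 / 2)"
  then show "kink s = kink s'" by (elim disjE conjE) (simp_all only: kink_half)
next
  assume k: "kink s = kink s'"
  then have x: "s * (s\<^sup>2 - 1 / 4) = s' * (s'\<^sup>2 - 1 / 4)" and y: "bump s = bump s'"
    by (auto simp: kink_def cubic_eq)
  have pos: "0 < bump s \<longleftrightarrow> \<bar>s\<bar> < 1" for s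
    using bump_outside[of s] bump_inside[of s] abs_square_less_1[of s] by (cases "\<bar>s\<bar> < 1") auto
  have "\<bar>s\<bar> < 1"
  proof (rule ccontr)
    assume "\<not> \<bar>s\<bar> < 1"
    then have "1 \<le> \<bar>s\<bar>" "1 \<le> \<bar>s'\<bar>" using y pos by (metis not_less)+
    then have l: "1 \<le> s\<^sup>2" "1 \<le> s'\<^sup>2" using abs_le_square_iff[of 1 s] abs_le_square_iff[of 1 s'] by auto
    \<comment> \<open>The difference of the cubics. When both squares are at least 1 the second
      factor cannot vanish, because the square of \<open>s + s'\<close> is nonnegative.\<close>
    have "(s - s') * (s\<^sup>2 + s * s' + s'\<^sup>2 - 1 / 4) = s * (s\<^sup>2 - 1 / 4) - s' * (s'\<^sup>2 - 1 / 4)"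
      by (simp add: field_simps power2_eq_square)
    then have "(s - s') * (s\<^sup>2 + s * s' + s'\<^sup>2 - 1 / 4) = 0" using x by simp
    then have "s\<^sup>2 + s * s' + s'\<^sup>2 = 1 / 4" using assms by simp
    moreover have "0 \<le> (s + s')\<^sup>2" by simp
    then have "0 \<le> s\<^sup>2 + 2 * (s * s') + s'\<^sup>2" by (simp add: power2_sum)
    ultimately show False using l by linarith
  qed
  moreover from this have "\<bar>s'\<bar> < 1" using y pos by metis
  ultimately have l: "s\<^sup>2 < 1" "s'\<^sup>2 < 1" and sq: "(1 - s\<^sup>2)\<^sup>2 = (1 - s'\<^sup>2)\<^sup>2"
    using y bump_inside[of s] bump_inside[of s'] by (simp_all add: abs_square_less_1)
  from sq have "1 - s\<^sup>2 = 1 - s'\<^sup>2 \<or> 1 - s\<^sup>2 = - (1 - s'\<^sup>2)" by (simp only: power2_eq_iff)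
  then have "s\<^sup>2 = s'\<^sup>2" using l by linarith
  then have "s = s' \<or> s = - s'" by (simp only: power2_eq_iff)
  then have "s' = - s" using assms by auto
  then have "s * (s\<^sup>2 - 1 / 4) = 0" "s \<noteq> 0" using x assms by auto
  then have "s\<^sup>2 = (1 / 2)\<^sup>2" by (simp add: power2_eq_square)
  then have "s = 1 / 2 \<or> s = - (1 / 2)" by (simp only: power2_eq_iff)
  then show "(s = 1 / 2 \<and> s' = - (1 / 2)) \<or> (s = - (1 / 2) \<and> s' = 1 / 2)" using \<open>s' = - s\<close> by auto
qed

locale kink_picture =
  fixes D :: diagram and \<sigma> \<epsilon> :: real
  assumes D: "link_diagram D" and sign: "\<sigma> = 1 \<or> \<sigma> = -1" and eps: "\<epsilon> = 1 \<or> \<epsilon> = -1"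
    and picture: "restrict_diagram move_box D = local_picture 1 (\<lambda>_ t. kink (\<sigma> * t)) (\<lambda>_ t. \<epsilon> * t)"
begin

abbreviation tangent :: "real \<Rightarrow> complex" where
  "tangent t \<equiv> curve_tangent (\<lambda>(_::nat) t. kink (\<sigma> * t)) (0, t)"

text \<open>At the double point the squared parameter is 1/4, so the cubic has slope 1/2 and
  \<open>bump\<close> has slope -3 times its argument; the sign \<sigma> cancels in the second
  coordinate.\<close>

lemma tangent_half:
  assumes "t = 1 / 2 \<or> t = - (1 / 2)"
  shows "tangent t = sgn (Complex (\<sigma> / 2) (- 3 * t))"
proof -
  have d1: "((\<lambda>t. (\<sigma> * t) ^ 3 - \<sigma> * t / 4) has_real_derivative 3 * (\<sigma> * t)\<^sup>2 * \<sigma> - \<sigma> / 4) (at t)"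
    by (auto intro!: derivative_eq_intros)
  have d2: "((\<lambda>t. bump (\<sigma> * t)) has_real_derivative bump' (\<sigma> * t) * \<sigma>) (at t)"
    by (rule DERIV_chain2[OF DERIV_bump]) (auto intro!: derivative_eq_intros)
  have "((\<lambda>t. of_real ((\<sigma> * t) ^ 3 - \<sigma> * t / 4) + \<i> * of_real (bump (\<sigma> * t))) has_vector_derivative
      of_real (3 * (\<sigma> * t)\<^sup>2 * \<sigma> - \<sigma> / 4) + \<i> * of_real (bump' (\<sigma> * t) * \<sigma>)) (at t)"
    by (intro has_vector_derivative_add has_vector_derivative_mult_right has_vector_derivative_of_real d1 d2)
  moreover have "(\<lambda>t. of_real ((\<sigma> * t) ^ 3 - \<sigma> * t / 4) + \<i> * of_real (bump (\<sigma> * t))) = (\<lambda>t. kink (\<sigma> * t))"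
    by (simp add: kink_def Complex_eq fun_eq_iff)
  moreover have "of_real (3 * (\<sigma> * t)\<^sup>2 * \<sigma> - \<sigma> / 4) + \<i> * of_real (bump' (\<sigma> * t) * \<sigma>) = Complex (\<sigma> / 2) (- 3 * t)"
  proof -
    have "t\<^sup>2 = 1 / 4" using assms by (elim disjE) (erule ssubst, simp add: power2_eq_square)+
    then have q: "(\<sigma> * t)\<^sup>2 = 1 / 4" using sign by (auto simp: power_mult_distrib)
    show ?thesis unfolding bump'_def q using sign by (auto simp: complex_eq_iff)
  qed
  ultimately show ?thesis by (simp add: curve_tangent_def vector_derivative_at)
qed

lemma box_tangents:
  assumes "p \<in> move_box"
  shows "(p, u) \<in> tangents D \<longleftrightarrow> (\<exists>t. kink (\<sigma> * t) = p \<and> u = tangent t)"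
proof -
  have "(p, u) \<in> tangents D \<longleftrightarrow> (p, u) \<in> tangents (restrict_diagram move_box D)"
    using assms by (simp add: restrict_diagram_def)
  then show ?thesis
    unfolding picture local_picture_def projection_def using assms by (auto simp: curve_point_def)
qed

lemma box_overs:
  assumes "p \<in> move_box"
  shows "(p, u) \<in> overs D \<longleftrightarrow> (\<exists>t t'. kink (\<sigma> * t) = p \<and> kink (\<sigma> * t') = p \<and> \<epsilon> * t' < \<epsilon> * t \<and> u = tangent t)"
proof -
  have "(p, u) \<in> overs D \<longleftrightarrow> (p, u) \<in> overs (restrict_diagram move_box D)"
    using assms by (simp add: restrict_diagram_def)
  then show ?thesis
    unfolding picture local_picture_def projection_def using assms by (auto simp: curve_point_def Bex_def)
qed

lemma box_curve:
  assumes "z \<in> move_box"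
  shows "z \<in> curve D \<longleftrightarrow> (Im z = 0 \<and> 3 / 4 \<le> \<bar>Re z\<bar>) \<or>
    (0 < Im z \<and> Im z \<le> 1 \<and> \<bar>Re z\<bar> = \<bar>kink_width (Im z)\<bar>)"
proof -
  have "z \<in> curve D \<longleftrightarrow> (\<exists>t. kink (\<sigma> * t) = z)"
    using box_tangents[OF assms] by (force simp: curve_def)
  also have "\<dots> \<longleftrightarrow> z \<in> range kink"
  proof
    assume "z \<in> range kink"
    then obtain s where "z = kink s" by blast
    moreover have "\<sigma> * (\<sigma> * s) = s" using sign by auto
    ultimately show "\<exists>t. kink (\<sigma> * t) = z" by metis
  qed auto
  also have "\<dots> \<longleftrightarrow> (Im z = 0 \<and> 3 / 4 \<le> \<bar>Re z\<bar>) \<or>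
      (0 < Im z \<and> Im z \<le> 1 \<and> \<bar>Re z\<bar> = \<bar>kink_width (Im z)\<bar>)"
    using assms by (intro kink_range) (simp add: move_box_def)
  finally show ?thesis .
qed

lemma same_kink_point:
  assumes "kink (\<sigma> * t) = kink (\<sigma> * t')" "t \<noteq> t'"
  shows "(t = 1 / 2 \<and> t' = - (1 / 2)) \<or> (t = - (1 / 2) \<and> t' = 1 / 2)"
proof -
  have "\<sigma> * t \<noteq> \<sigma> * t'" using assms(2) sign by auto
  then show ?thesis using kink_eq_iff[of "\<sigma> * t" "\<sigma> * t'"] assms(1) sign by auto
qed

abbreviation cross :: complex where
  "cross \<equiv> Complex 0 (9 / 16)"

lemma kink_half': "t = 1 / 2 \<or> t = - (1 / 2) \<Longrightarrow> kink (\<sigma> * t) = cross"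
proof -
  assume "t = 1 / 2 \<or> t = - (1 / 2)"
  then have "\<sigma> * t = 1 / 2 \<or> \<sigma> * t = - (1 / 2)"
    using sign by (elim disjE) (simp_all only: mult_1 mult_minus1 minus_minus simp_thms)
  then show ?thesis by (elim disjE) (simp_all only: kink_half)
qed

lemma box_overs_iff:
  assumes "p \<in> move_box"
  shows "(p, u) \<in> overs D \<longleftrightarrow> p = cross \<and> u = tangent (\<epsilon> / 2)"
proof
  assume "(p, u) \<in> overs D"
  then obtain t t' where t: "kink (\<sigma> * t) = p" "kink (\<sigma> * t') = p" "\<epsilon> * t' < \<epsilon> * t" "u = tangent t"
    using box_overs[OF assms] by blast
  then have h: "(t = 1 / 2 \<and> t' = - (1 / 2)) \<or> (t = - (1 / 2) \<and> t' = 1 / 2)"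
    by (intro same_kink_point) auto
  then have te: "t = \<epsilon> / 2" using t(3) eps by auto
  have "p = cross" using t(1) h kink_half'[of t] by auto
  then show "p = cross \<and> u = tangent (\<epsilon> / 2)" using t(4) unfolding te by blast
next
  assume "p = cross \<and> u = tangent (\<epsilon> / 2)"
  then show "(p, u) \<in> overs D"
    unfolding box_overs[OF assms] using eps kink_half'[of "\<epsilon> / 2"] kink_half'[of "- \<epsilon> / 2"]
    by (intro exI[of _ "\<epsilon> / 2"] exI[of _ "- \<epsilon> / 2"]) auto
qed

lemma sides_tangent:
  assumes "t = 1 / 2 \<or> t = - (1 / 2)"
  shows "w \<in> left_of (tangent t) \<longleftrightarrow> 0 < \<sigma> / 2 * Im w + 3 * t * Re w"
    "w \<in> right_of (tangent t) \<longleftrightarrow> \<sigma> / 2 * Im w + 3 * t * Re w < 0"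
proof -
  have *: "Im (cnj (tangent t) * w) = (\<sigma> / 2 * Im w + 3 * t * Re w) / norm (Complex (\<sigma> / 2) (- 3 * t))"
    unfolding tangent_half[OF assms] Im_cnj_sgn by (simp add: algebra_simps)
  have "0 < norm (Complex (\<sigma> / 2) (- 3 * t))" using sign by (auto simp: complex_eq_iff)
  then show "w \<in> left_of (tangent t) \<longleftrightarrow> 0 < \<sigma> / 2 * Im w + 3 * t * Re w"
    "w \<in> right_of (tangent t) \<longleftrightarrow> \<sigma> / 2 * Im w + 3 * t * Re w < 0"
    unfolding left_of_def right_of_def mem_Collect_eq * by (simp_all only: zero_less_divide_iff divide_less_0_iff) auto
qed

lemma half_eps: "\<epsilon> / 2 = 1 / 2 \<or> \<epsilon> / 2 = - (1 / 2)" "- \<epsilon> / 2 = 1 / 2 \<or> - \<epsilon> / 2 = - (1 / 2)"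
  using eps by auto

lemma box_crossing:
  assumes "p \<in> move_box"
  shows "is_crossing D p u v \<longleftrightarrow> p = cross \<and> u = tangent (\<epsilon> / 2) \<and> v = tangent (- \<epsilon> / 2)"
proof
  assume c: "is_crossing D p u v"
  then have pu: "p = cross" "u = tangent (\<epsilon> / 2)" using box_overs_iff[OF assms] by (auto simp: is_crossing_def)
  obtain t where t: "kink (\<sigma> * t) = p" "v = tangent t"
    using c box_tangents[OF assms] by (auto simp: is_crossing_def)
  have "t \<noteq> \<epsilon> / 2"
  proof
    assume te: "t = \<epsilon> / 2"
    have "(p, v) \<in> overs D" unfolding box_overs_iff[OF assms] using pu(1) t(2) unfolding te by blast
    then show False using c by (simp add: is_crossing_def)
  qed
  moreover have "kink (\<sigma> * t) = kink (\<sigma> * (\<epsilon> / 2))" using t pu kink_half'[OF half_eps(1)] by simp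
  ultimately have te: "t = - \<epsilon> / 2" using same_kink_point[of t "\<epsilon> / 2"] by auto
  show "p = cross \<and> u = tangent (\<epsilon> / 2) \<and> v = tangent (- \<epsilon> / 2)" using pu t(2) unfolding te by blast
next
  assume e: "p = cross \<and> u = tangent (\<epsilon> / 2) \<and> v = tangent (- \<epsilon> / 2)"
  have "tangent (- \<epsilon> / 2) \<noteq> tangent (\<epsilon> / 2)"
  proof
    assume "tangent (- \<epsilon> / 2) = tangent (\<epsilon> / 2)"
    then have "1 \<in> left_of (tangent (- \<epsilon> / 2)) \<longleftrightarrow> 1 \<in> left_of (tangent (\<epsilon> / 2))" by simp
    then show False unfolding sides_tangent(1)[OF half_eps(1)] sides_tangent(1)[OF half_eps(2)] using eps by auto
  qed
  then have "(p, v) \<notin> overs D" using e box_overs_iff[OF assms] by simp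
  moreover have "(p, v) \<in> tangents D" unfolding box_tangents[OF assms] using e kink_half'[OF half_eps(2)] by blast
  moreover have "(p, u) \<in> overs D" unfolding box_overs_iff[OF assms] using e by blast
  ultimately show "is_crossing D p u v" by (simp add: is_crossing_def)
qed

text \<open>The labels \<open>0\<close>, \<open>1\<close>, \<open>2\<close> are those of the regions below, above and within the kink.\<close>

definition below :: "complex set" where
  "below = {z. Im z < 0 \<or> (Im z < 9 / 16 \<and> \<bar>Re z\<bar> < kink_width (Im z))}"

definition kink_disc :: "complex set" where
  "kink_disc = {z. 9 / 16 < Im z \<and> \<bar>Re z\<bar> < - kink_width (Im z)}"

definition above :: "complex set" where
  "above = {z. 0 < Im z \<and> (\<bar>kink_width (Im z)\<bar> < \<bar>Re z\<bar> \<or> 1 < Im z)}"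

definition klab :: "complex \<Rightarrow> nat" where
  "klab z = (if z \<in> below then 0 else if z \<in> kink_disc then 2 else 1)"

lemma continuous_kink_width_Im: "continuous_on UNIV (\<lambda>z. kink_width (Im z))"
  by (rule continuous_on_compose2[OF continuous_kink_width]) (auto intro!: continuous_intros)

lemma open_pieces: "open below" "open kink_disc" "open above"
proof -
  have eq: "below = {z. Im z < 0} \<union> ({z. Im z < 9 / 16} \<inter> {z. \<bar>Re z\<bar> < kink_width (Im z)})"
    by (auto simp: below_def)
  show "open below"
    unfolding eq by (intro open_Un open_Int open_Collect_less continuous_intros continuous_kink_width_Im)
  have eq: "kink_disc = {z. 9 / 16 < Im z} \<inter> {z. \<bar>Re z\<bar> < - kink_width (Im z)}"
    by (auto simp: kink_disc_def)
  show "open kink_disc"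
    unfolding eq by (intro open_Un open_Int open_Collect_less continuous_intros continuous_kink_width_Im)
  have eq: "above = {z. 0 < Im z} \<inter> ({z. \<bar>kink_width (Im z)\<bar> < \<bar>Re z\<bar>} \<union> {z. 1 < Im z})"
    by (auto simp: above_def)
  show "open above"
    unfolding eq by (intro open_Un open_Int open_Collect_less continuous_intros continuous_kink_width_Im)
qed

lemma kink_disc_less_1: "z \<in> kink_disc \<Longrightarrow> Im z < 1"
  using kink_width_simps(2)[of "Im z"] by (fastforce simp: kink_disc_def)

lemma pieces_disjoint:
  "z \<in> above \<Longrightarrow> z \<notin> kink_disc" "z \<in> above \<Longrightarrow> z \<notin> below" "z \<in> kink_disc \<Longrightarrow> z \<notin> below"
  using kink_disc_less_1[of z] by (auto simp: above_def below_def kink_disc_def)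

lemma klab_above: "z \<in> above \<Longrightarrow> klab z = 1"
  by (simp add: klab_def pieces_disjoint)

lemma klab_kink_disc: "z \<in> kink_disc \<Longrightarrow> klab z = 2"
  by (simp add: klab_def pieces_disjoint)

lemma pieces_cover:
  assumes "z \<in> move_box" "z \<notin> curve D"
  shows "z \<in> below \<union> kink_disc \<union> above"
proof -
  consider "Im z < 0" | "Im z = 0" | "0 < Im z" "Im z \<le> 1" | "1 < Im z" by linarith
  then show ?thesis
  proof cases
    case 2
    then show ?thesis using assms box_curve[of z] kink_width_simps(1)[of "Im z"] by (auto simp: below_def)
  next
    case 3
    then have ne: "\<bar>Re z\<bar> \<noteq> \<bar>kink_width (Im z)\<bar>" using assms box_curve[of z] by auto
    show ?thesis
    proof (cases "\<bar>kink_width (Im z)\<bar> < \<bar>Re z\<bar>")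
      case True
      then show ?thesis using 3 by (auto simp: above_def)
    next
      case False
      then have lt: "\<bar>Re z\<bar> < \<bar>kink_width (Im z)\<bar>" using ne by simp
      consider "Im z < 9 / 16" | "Im z = 9 / 16" | "9 / 16 < Im z" "Im z < 1" | "Im z = 1" using 3 by linarith
      then show ?thesis
      proof cases
        case 1 then show ?thesis using lt kink_width_pos[of "Im z"] by (auto simp: below_def)
      next
        case 2
        then have "kink_width (Im z) = 0" by (simp only: kink_width_9_16)
        then show ?thesis using lt by simp
      next
        case 3 then show ?thesis using lt kink_width_neg[of "Im z"] by (auto simp: kink_disc_def)
      next
        case 4 then show ?thesis using lt kink_width_simps(2)[of "Im z"] by simp
      qed
    qed
  qed (auto simp: below_def above_def)
qed

lemma pieces_off_curve:
  assumes "z \<in> move_box" "z \<in> below \<union> kink_disc \<union> above"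
  shows "z \<notin> curve D"
  using assms(2) box_curve[OF assms(1)] kink_width_simps(1)[of "Im z"] kink_width_pos[of "Im z"]
    kink_width_neg[of "Im z"] kink_disc_less_1[of z]
  by (auto simp: below_def kink_disc_def above_def)

lemma klab_locally_constant:
  assumes "z \<in> open_box - curve D"
  shows "\<forall>\<^sub>F w in nhds z. klab w = klab z"
proof -
  have "z \<in> below \<union> kink_disc \<union> above" using pieces_cover assms open_box_subset_move_box by auto
  then consider "z \<in> below" | "z \<in> kink_disc" | "z \<in> above" by blast
  then show ?thesis
  proof cases
    case 1
    then have "\<forall>\<^sub>F w in nhds z. w \<in> below" using open_pieces by (intro eventually_nhds_in_open)
    then show ?thesis by eventually_elim (use 1 in \<open>simp add: klab_def\<close>)
  next
    case 2
    then have "\<forall>\<^sub>F w in nhds z. w \<in> kink_disc" using open_pieces by (intro eventually_nhds_in_open)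
    then show ?thesis by eventually_elim (use 2 klab_kink_disc in simp)
  next
    case 3
    then have "\<forall>\<^sub>F w in nhds z. w \<in> above" using open_pieces by (intro eventually_nhds_in_open)
    then show ?thesis by eventually_elim (use 3 klab_above in simp)
  qed
qed

text \<open>The pieces around the kink are bounded by functions of the height, so the coordinates
  are exchanged.\<close>

lemma connected_flipped_strip:
  fixes lo hi :: "real \<Rightarrow> real"
  assumes "is_interval I" "continuous_on I lo" "continuous_on I hi" "\<And>y. y \<in> I \<Longrightarrow> lo y < hi y"
  shows "connected {z. Im z \<in> I \<and> lo (Im z) < Re z \<and> Re z < hi (Im z)}"
proof -
  let ?S = "{z. Re z \<in> I \<and> lo (Re z) < Im z \<and> Im z < hi (Re z)}"
  have eq: "{z. Im z \<in> I \<and> lo (Im z) < Re z \<and> Re z < hi (Im z)} = (\<lambda>z. Complex (Im z) (Re z)) ` ?S"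
  proof (intro equalityI subsetI)
    fix z assume "z \<in> {z. Im z \<in> I \<and> lo (Im z) < Re z \<and> Re z < hi (Im z)}"
    then show "z \<in> (\<lambda>z. Complex (Im z) (Re z)) ` ?S"
      by (intro image_eqI[of _ _ "Complex (Im z) (Re z)"]) auto
  qed auto
  have "continuous_on ?S (\<lambda>z. Complex (Im z) (Re z))"
    unfolding Complex_eq by (intro continuous_intros)
  then show ?thesis
    unfolding eq by (rule connected_continuous_image[OF _ connected_strip[OF assms]])
qed

lemma connected_below: "connected (open_box \<inter> below)"
proof -
  let ?A = "{z. Im z \<in> {-3<..<0} \<and> - 2 < Re z \<and> Re z < 2}"
  \<comment> \<open>Below the axis \<open>kink_width\<close> is constantly 3/4, so this strip
    continues into \<open>?A\<close> through the gap between the two feet of the kink.\<close>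
  let ?B = "{z. Im z \<in> {-3<..<9 / 16} \<and> - kink_width (Im z) < Re z \<and> Re z < kink_width (Im z)}"
  have "open_box \<inter> below = ?A \<union> ?B"
  proof (rule Set.set_eqI)
    show "z \<in> open_box \<inter> below \<longleftrightarrow> z \<in> ?A \<union> ?B" for z
      using abs_kink_width_le[of "Im z"] by (auto simp: open_box_def below_def)
  qed
  moreover have "connected (?A \<union> ?B)"
  proof (rule connected_Un)
    show "connected ?A" by (rule connected_flipped_strip) (auto simp: is_interval_oo)
    have pos: "- kink_width y < kink_width y" if "y \<in> {-3<..<9 / 16}" for y
      using kink_width_pos[of y] that by auto
    show "connected ?B"
      by (rule connected_flipped_strip[OF is_interval_oo _ _ pos])
        (intro continuous_intros continuous_kink_width)+
    have "Complex 0 (- 1) \<in> ?A \<inter> ?B" by (simp add: kink_width_simps)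
    then show "?A \<inter> ?B \<noteq> {}" by blast
  qed
  ultimately show ?thesis by (simp only:)
qed

lemma connected_kink_disc: "connected (open_box \<inter> kink_disc)"
proof -
  let ?A = "{z. Im z \<in> {9 / 16<..<1} \<and> kink_width (Im z) < Re z \<and> Re z < - kink_width (Im z)}"
  have "open_box \<inter> kink_disc = ?A"
  proof (rule Set.set_eqI)
    show "z \<in> open_box \<inter> kink_disc \<longleftrightarrow> z \<in> ?A" for z
      using abs_kink_width_le[of "Im z"] kink_disc_less_1[of z] by (auto simp: open_box_def kink_disc_def)
  qed
  also have "connected \<dots>"
  proof (rule connected_flipped_strip[OF is_interval_oo])
    show "kink_width y < - kink_width y" if "y \<in> {9 / 16<..<1}" for y
      using kink_width_neg[of y] that by auto
  qed (intro continuous_intros continuous_kink_width)+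
  finally show ?thesis .
qed

lemma connected_above: "connected (open_box \<inter> above)"
proof -
  let ?A = "{z. Im z \<in> {1<..<3} \<and> - 2 < Re z \<and> Re z < 2}"
  \<comment> \<open>The parts to the right and to the left of the kink reach up into the band above
    height 1, where they are joined.\<close>
  let ?B = "{z. Im z \<in> {0<..<3} \<and> \<bar>kink_width (Im z)\<bar> < Re z \<and> Re z < 2}"
  let ?C = "{z. Im z \<in> {0<..<3} \<and> - 2 < Re z \<and> Re z < - \<bar>kink_width (Im z)\<bar>}"
  have w: "\<bar>kink_width y\<bar> < 2" for y using abs_kink_width_le[of y] by linarith
  have "open_box \<inter> above = ?A \<union> ?B \<union> ?C"
  proof (rule Set.set_eqI)
    show "z \<in> open_box \<inter> above \<longleftrightarrow> z \<in> ?A \<union> ?B \<union> ?C" for z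
      using w[of "Im z"] by (auto simp: open_box_def above_def)
  qed
  moreover have "connected (?A \<union> ?B \<union> ?C)"
  proof (intro connected_Un)
    show "connected ?A" by (rule connected_flipped_strip) (auto simp: is_interval_oo)
    show "connected ?B"
      by (rule connected_flipped_strip)
        (use w in \<open>auto simp: is_interval_oo intro!: continuous_intros continuous_kink_width\<close>)
    show "connected ?C"
      by (rule connected_flipped_strip)
        (use w in \<open>auto simp: is_interval_oo less_minus_iff intro!: continuous_intros continuous_kink_width\<close>)
    have "Complex 1 2 \<in> ?A \<inter> ?B" "Complex (- 1) 2 \<in> (?A \<union> ?B) \<inter> ?C" by (simp_all add: kink_width_simps)
    then show "?A \<inter> ?B \<noteq> {}" "(?A \<union> ?B) \<inter> ?C \<noteq> {}" by blast+
  qed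
  ultimately show ?thesis by (simp only:)
qed

lemma klab_fibre:
  "{z \<in> open_box - curve D. klab z = l} =
     (if l = 0 then open_box \<inter> below else if l = 2 then open_box \<inter> kink_disc
      else if l = 1 then open_box \<inter> above else {})"
proof (rule Set.set_eqI)
  fix z
  show "z \<in> {z \<in> open_box - curve D. klab z = l} \<longleftrightarrow> z \<in> (if l = 0 then open_box \<inter> below
      else if l = 2 then open_box \<inter> kink_disc else if l = 1 then open_box \<inter> above else {})"
    using pieces_cover[of z] pieces_off_curve[of z] open_box_subset_move_box pieces_disjoint[of z]
    by (auto simp: klab_def split: if_splits)
qed

text \<open>The disc and the pocket below the crossing are opposite sectors, and both lateral
  sectors belong to the region above. With \<sigma> = 1 the disc is to the left of both passes.
  Exchanging over and under, that is \<epsilon>, swaps the two equal middle entries.\<close>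

definition kink_quadruple :: "nat \<times> nat \<times> nat \<times> nat" where
  "kink_quadruple = (if \<sigma> = 1 then (2, 1, 1, 0) else (0, 1, 1, 2))"

lemma crossing_labels_kink: "crossing_labels klab cross (tangent (\<epsilon> / 2)) (tangent (- \<epsilon> / 2)) kink_quadruple"
proof -
  have small: "\<forall>\<^sub>F e in at_right (0::real). e \<in> {0<..<1 / 16}"
    by (rule eventually_at_right_real) simp
  \<comment> \<open>The vertical directions point into the disc and the pocket, the horizontal ones
    into the region above. By \<open>sides_tangent\<close>, \<sigma> decides the order of the
    vertical pair and \<epsilon> that of the horizontal pair.\<close>
  have "sector_vectors (tangent (\<epsilon> / 2)) (tangent (- \<epsilon> / 2)) (of_real \<sigma> * \<i>) (- of_real \<epsilon>) (of_real \<epsilon>) (- (of_real \<sigma> * \<i>))"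
    unfolding sector_vectors_def Int_iff sides_tangent[OF half_eps(1)] sides_tangent[OF half_eps(2)]
    using sign eps by auto
  moreover have up: "klab (cross + of_real e * \<i>) = 2" and down: "klab (cross + of_real e * (- \<i>)) = 0"
    and side: "klab (cross + of_real e * of_real x) = 1" if "e \<in> {0<..<1 / 16}" "x = 1 \<or> x = -1" for e x :: real
  proof -
    have "Complex 0 (9 / 16 + e) \<in> kink_disc" "Complex 0 (9 / 16 - e) \<in> below" "Complex (e * x) (9 / 16) \<in> above"
      using that kink_width_neg[of "9 / 16 + e"] kink_width_pos[of "9 / 16 - e"] kink_width_9_16
      by (auto simp: kink_disc_def below_def above_def)
    moreover have "cross + of_real e * \<i> = Complex 0 (9 / 16 + e)" "cross + of_real e * (- \<i>) = Complex 0 (9 / 16 - e)"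
      "cross + of_real e * of_real x = Complex (e * x) (9 / 16)"
      by (simp_all add: complex_eq_iff)
    ultimately show "klab (cross + of_real e * \<i>) = 2" "klab (cross + of_real e * (- \<i>)) = 0"
      "klab (cross + of_real e * of_real x) = 1"
      using klab_kink_disc klab_above by (simp_all add: klab_def)
  qed
  have "\<forall>\<^sub>F e in at_right (0::real). klab (cross + of_real e * (of_real \<sigma> * \<i>)) = (if \<sigma> = 1 then 2 else 0) \<and>
      klab (cross + of_real e * (- of_real \<epsilon>)) = 1 \<and> klab (cross + of_real e * of_real \<epsilon>) = 1 \<and>
      klab (cross + of_real e * (- (of_real \<sigma> * \<i>))) = (if \<sigma> = 1 then 0 else 2)"
    using small
  proof eventually_elim
    case (elim e)
    then show ?case
      using sign eps up[of e 1] down[of e 1] side[of e "\<epsilon>"] side[of e "- \<epsilon>"] by auto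
  qed
  ultimately have "crossing_labels klab cross (tangent (\<epsilon> / 2)) (tangent (- \<epsilon> / 2))
      (if \<sigma> = 1 then 2 else 0, 1, 1, if \<sigma> = 1 then 0 else 2)"
    unfolding crossing_labels_def prod.case by blast
  moreover have "kink_quadruple = (if \<sigma> = 1 then 2 else 0, 1, 1, if \<sigma> = 1 then 0 else 2)"
    by (simp add: kink_quadruple_def)
  ultimately show ?thesis by (simp only:)
qed

lemma box_labelling: "box_labelling D klab {kink_quadruple}"
  unfolding box_labelling_def
proof (intro conjI ballI allI impI)
  have c: "cross \<in> open_box" by (simp add: open_box_def)
  then have c': "cross \<in> move_box" using open_box_subset_move_box by blast
  show "connected {z \<in> open_box - curve D. klab z = l}" for l
    unfolding klab_fibre by (auto simp: connected_below connected_kink_disc connected_above)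
  have eq: "p = cross \<and> u = tangent (\<epsilon> / 2) \<and> v = tangent (- \<epsilon> / 2)"
    if "is_crossing D p u v \<and> p \<in> move_box" for p u v
    by (rule iffD1[OF box_crossing[OF conjunct2[OF that]] conjunct1[OF that]])
  show "p \<in> open_box" if "is_crossing D p u v \<and> p \<in> move_box" for p u v
    using c by (simp only: eq[OF that])
  show "\<exists>q\<in>{kink_quadruple}. crossing_labels klab p u v q" if "is_crossing D p u v \<and> p \<in> move_box" for p u v
    by (rule bexI[of _ kink_quadruple]) (simp_all only: eq[OF that] crossing_labels_kink singleton_iff)
  have cr: "is_crossing D cross (tangent (\<epsilon> / 2)) (tangent (- \<epsilon> / 2))"
    by (rule iffD2[OF box_crossing[OF c']]) (intro conjI refl)
  show "\<exists>p u v. is_crossing D p u v \<and> p \<in> open_box \<and> crossing_labels klab p u v q" if "q \<in> {kink_quadruple}" for q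
    unfolding singletonD[OF that] by (intro exI conjI) (rule cr, rule c, rule crossing_labels_kink)
qed (use klab_locally_constant in blast)

end

text \<open>Heights enter a diagram only at double points, and the line has none. So they can be
  made constant along the strand, as \<open>graph_picture\<close> demands.\<close>

lemma r1_line_picture:
  fixes \<epsilon> :: real
  assumes "\<sigma> = 1 \<or> \<sigma> = -1"
  shows "local_picture 1 (\<lambda>_ t. Complex (\<sigma> * t) 0) (\<lambda>_ t. \<epsilon> * t) = local_picture 1 (\<lambda>_ t. Complex (\<sigma> * t) 0) (\<lambda>_ t. 0)"
  unfolding local_picture_def projection_def using assms by (auto simp: curve_point_def)

section \<open>The picture without the kink\<close>

locale line_picture =
  fixes D :: diagram and \<sigma> :: real
  assumes D: "link_diagram D" and sign: "\<sigma> = 1 \<or> \<sigma> = -1"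
    and picture: "restrict_diagram move_box D = local_picture 1 (\<lambda>_ t. Complex (\<sigma> * t) 0) (\<lambda>_ t. 0)"
begin

sublocale graph_picture D "Suc 0" "\<lambda>_ _. 0" "\<lambda>_ _. 0" "\<lambda>_. \<sigma>" "\<lambda>_. 0"
  by unfold_locales (use D sign picture in \<open>auto simp: inj_on_def\<close>)

lemma connected_cell: "connected (cell a)"
proof -
  have "cell a = {z. Re z \<in> {-2<..<2} \<and> (if a 0 then 0 else - 3) < Im z \<and> Im z < (if a 0 then 3 else 0)}"
    unfolding cell_def by auto
  then show ?thesis
    using connected_strip[of "{-2<..<2}" "\<lambda>_. if a 0 then 0 else - 3" "\<lambda>_. if a 0 then 3 else 0"]
    by (auto simp: is_interval_oo)
qed

lemma box_labelling: "box_labelling D lab {}"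
proof -
  have "crossing_quadruples = {}" by (auto simp: crossing_quadruples_def)
  then show ?thesis using box_labelling_lab[OF connected_cell] by simp
qed

lemma lab_line: "lab z = label_of (\<lambda>_. 0 < Im z)"
  by (rule lab_eq)

lemma labels_distinct: "label_of (\<lambda>_. True) \<noteq> label_of (\<lambda>_. False)"
  by (simp add: label_of_eq_iff)

end

text \<open>Apart from the disc, the regions at the crossing of the kink carry the old colors, so
  its equation determines just the color of the disc: as a first argument if \<sigma> = 1 and as a
  value of the bracket if \<sigma> = -1. In the other direction the disc is forgotten.\<close>

lemma r1_transfers:
  fixes X :: "'x set"
  assumes A: "line_picture D \<sigma>" and A': "kink_picture D' \<sigma> \<epsilon>"
    and outer: "restrict_diagram (- move_box) D = restrict_diagram (- move_box) D'"
    and X: "tribracket X br"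
  shows "transfers (common_region_pairs D D') X br D D'" "transfers (common_region_pairs D' D) X br D' D"
proof -
  interpret A: line_picture D \<sigma> by fact
  interpret A': kink_picture D' \<sigma> \<epsilon> by fact
  interpret tribracket X br by fact
  let ?u = "A.label_of (\<lambda>_. True)" and ?d = "A.label_of (\<lambda>_. False)"
  have w: "\<bar>kink_width y\<bar> < 1" for y using abs_kink_width_le[of y] by linarith
  have core: "1 < \<bar>Re z\<bar> \<or> 1 < \<bar>Im z\<bar>" if "z \<notin> core" for z using that by (auto simp: core_def)
  have cv: "z \<in> curve D \<longleftrightarrow> z \<in> curve D'" if "z \<in> move_box" "z \<notin> core" for z
    unfolding A.box_curve[OF that(1)] A'.box_curve[OF that(1)]
    using core[OF that(2)] w[of "Im z"] by auto
  have replacement: "local_replacement D D' A.lab {} A'.klab {A'.kink_quadruple}"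
    "local_replacement D' D A'.klab {A'.kink_quadruple} A.lab {}"
    using A.D A'.D outer cv A.box_labelling A'.box_labelling by (auto simp: local_replacement_def)
  have labs: "A.lab z = (if 0 < Im z then ?u else ?d)" for z by (simp add: A.lab_line)
  have klab: "A'.klab z = (if 0 < Im z then 1 else 0)" if z: "z \<in> open_box - core - curve D" for z
  proof -
    have "Im z \<noteq> 0" using z A.box_curve[of z] open_box_subset_move_box by auto
    then consider "0 < Im z" | "Im z < 0" by linarith
    then show ?thesis
    proof cases
      case 1
      then have "z \<in> A'.above" using core[of z] z w[of "Im z"] by (auto simp: A'.above_def)
      then show ?thesis using 1 A'.klab_above by simp
    next
      case 2
      then show ?thesis by (simp add: A'.klab_def A'.below_def)
    qed
  qed
  interpret r: local_replacement D D' A.lab "{}" A'.klab "{A'.kink_quadruple}" by (rule replacement)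
  interpret r': local_replacement D' D A'.klab "{A'.kink_quadruple}" A.lab "{}" by (rule replacement)
  have pts: "Complex 0 2 \<in> open_box - core - curve D" "Complex 0 (- 2) \<in> open_box - core - curve D"
    using A.box_curve[of "Complex 0 2"] A.box_curve[of "Complex 0 (- 2)"]
    by (auto simp: open_box_def core_def move_box_def)
  have off: "z \<in> open_box - core - curve D \<longleftrightarrow> z \<in> open_box - core - curve D'" for z
    using cv open_box_subset_move_box by blast
  show "transfers (common_region_pairs D D') X br D D'"
  proof (rule r.transfers_common_region_pairs)
    fix G :: "(nat \<Rightarrow> bool) \<Rightarrow> 'x" assume G: "range G \<subseteq> X"
    then have GX: "G l \<in> X" for l by blast
    obtain w where w: "w \<in> X" "if \<sigma> = 1 then br w (G ?u) (G ?u) = G ?d else br (G ?d) (G ?u) (G ?u) = w"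
      using solve_fst[OF GX GX GX, of ?u ?u ?d] closed[OF GX GX GX, of ?d ?u ?u] by (cases "\<sigma> = 1") auto
    define G' where "G' n = (if n = 0 then G ?d else if n = 1 then G ?u else w)" for n :: nat
    have "satisfies br {A'.kink_quadruple} G'"
      using w(2) by (simp add: satisfies_def A'.kink_quadruple_def G'_def split: if_splits)
    moreover have "range G' \<subseteq> X" using GX w(1) by (auto simp: G'_def)
    moreover have "G' (A'.klab z) = G (A.lab z)" if "z \<in> open_box - core - curve D" for z
      using klab[OF that] labs[of z] by (simp add: G'_def)
    ultimately show "\<exists>G'. range G' \<subseteq> X \<and> satisfies br {A'.kink_quadruple} G' \<and>
        (\<forall>z\<in>open_box - core - curve D. G' (A'.klab z) = G (A.lab z))" by blast
  next
    fix G G' :: "nat \<Rightarrow> 'x" and z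
    assume G: "range G \<subseteq> X" "satisfies br {A'.kink_quadruple} G" "range G' \<subseteq> X" "satisfies br {A'.kink_quadruple} G'"
      and eq: "\<And>z. z \<in> open_box - core - curve D' \<Longrightarrow> G (A'.klab z) = G' (A'.klab z)"
    have "G 1 = G' 1" "G 0 = G' 0"
      using eq[of "Complex 0 2"] eq[of "Complex 0 (- 2)"] klab[OF pts(1)] klab[OF pts(2)] pts off by simp_all
    moreover have "G n \<in> X" "G' n \<in> X" for n using G(1,3) by blast+
    moreover have "if \<sigma> = 1 then br (G 2) (G 1) (G 1) = G 0 else br (G 0) (G 1) (G 1) = G 2"
      "if \<sigma> = 1 then br (G' 2) (G' 1) (G' 1) = G' 0 else br (G' 0) (G' 1) (G' 1) = G' 2"
      using G(2,4) by (auto simp: satisfies_def A'.kink_quadruple_def split: if_splits)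
    ultimately have "G 2 = G' 2" using cancel_fst[of "G 2" "G' 1" "G' 1" "G' 2"] by (auto split: if_splits)
    then show "G (A'.klab z) = G' (A'.klab z)" using \<open>G 1 = G' 1\<close> \<open>G 0 = G' 0\<close> by (simp add: A'.klab_def)
  qed
  show "transfers (common_region_pairs D' D) X br D' D"
  proof (rule r'.transfers_common_region_pairs)
    fix G :: "nat \<Rightarrow> 'x" assume G: "range G \<subseteq> X"
    show "\<exists>G'. range G' \<subseteq> X \<and> satisfies br {} G' \<and>
        (\<forall>z\<in>open_box - core - curve D'. G' (A.lab z) = G (A'.klab z))"
    proof (intro exI[of _ "\<lambda>l. if l = ?u then G 1 else G 0"] conjI ballI)
      fix z assume "z \<in> open_box - core - curve D'"
      then have "z \<in> open_box - core - curve D" using off by blast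
      then show "(if A.lab z = ?u then G 1 else G 0) = G (A'.klab z)"
        using klab[of z] labs[of z] A.labels_distinct by simp
    qed (use G in \<open>auto simp: satisfies_def\<close>)
  next
    fix G G' :: "(nat \<Rightarrow> bool) \<Rightarrow> 'x" and z
    assume eq: "\<And>z. z \<in> open_box - core - curve D \<Longrightarrow> G (A.lab z) = G' (A.lab z)"
    show "G (A.lab z) = G' (A.lab z)"
      using eq[OF pts(1)] eq[OF pts(2)] by (auto simp: labs)
  qed
qed

section \<open>Colorings by the module tribracket\<close>

lemma ex1_bij_betw:
  assumes "\<And>f. f \<in> A \<Longrightarrow> \<exists>!f'. f' \<in> B \<and> P f f'" and "\<And>f'. f' \<in> B \<Longrightarrow> \<exists>!f. f \<in> A \<and> P f f'"
  shows "\<exists>\<phi>. bij_betw \<phi> A B \<and> (\<forall>f\<in>A. P f (\<phi> f))"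
proof -
  have "\<forall>f\<in>A. \<exists>f'. f' \<in> B \<and> P f f'" using assms(1) by blast
  then obtain \<phi> where \<phi>: "\<And>f. f \<in> A \<Longrightarrow> \<phi> f \<in> B \<and> P f (\<phi> f)" using bchoice by metis
  have "inj_on \<phi> A"
  proof (rule inj_onI)
    fix f g assume fg: "f \<in> A" "g \<in> A" "\<phi> f = \<phi> g"
    then have "P f (\<phi> f)" "P g (\<phi> f)" "\<phi> f \<in> B" using \<phi>[of f] \<phi>[of g] by auto
    then show "f = g" using assms(2)[of "\<phi> f"] fg by blast
  qed
  moreover have "\<phi> ` A = B"
  proof (intro equalityI subsetI)
    fix f' assume f': "f' \<in> B"
    then obtain f where f: "f \<in> A" "P f f'" using assms(2) by blast
    then have "\<phi> f = f'" using assms(1)[OF f(1)] \<phi>[OF f(1)] f' by blast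
    then show "f' \<in> \<phi> ` A" using f by blast
  qed (use \<phi> in blast)
  ultimately show ?thesis using \<phi> unfolding bij_betw_def by blast
qed

section \<open>Ranks of modules of functions\<close>

context cring
begin

definition lincomb :: "'i set \<Rightarrow> ('i \<Rightarrow> 'a) set \<Rightarrow> (('i \<Rightarrow> 'a) \<Rightarrow> 'a) \<Rightarrow> 'i \<Rightarrow> 'a" where
  "lincomb A F c = (\<lambda>\<rho>\<in>A. \<Oplus>s\<in>F. c s \<otimes> s \<rho>)"

text \<open>An independent set is transported along the bijection given by agreement. A vanishing
  combination of the images agrees both with the same combination of the originals and with zero;
  these lie in \<open>M\<close>, so uniqueness makes them equal. In this way independence is
  inherited without first proving the bijection linear.\<close>

lemma module_rank_le:
  assumes M: "M \<subseteq> A \<rightarrow>\<^sub>E carrier R" and M': "M' \<subseteq> A' \<rightarrow>\<^sub>E carrier R" and Z: "Z \<subseteq> A \<times> A'"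
    and comb: "\<And>F c. finite F \<Longrightarrow> F \<subseteq> M \<Longrightarrow> c \<in> F \<rightarrow> carrier R \<Longrightarrow> lincomb A F c \<in> M"
    and comb': "\<And>F c. finite F \<Longrightarrow> F \<subseteq> M' \<Longrightarrow> c \<in> F \<rightarrow> carrier R \<Longrightarrow> lincomb A' F c \<in> M'"
    and ex: "\<And>s. s \<in> M \<Longrightarrow> \<exists>!s'. s' \<in> M' \<and> agree Z s s'"
    and ex': "\<And>s'. s' \<in> M' \<Longrightarrow> \<exists>!s. s \<in> M \<and> agree Z s s'"
  shows "module_rank R A M \<le> module_rank R A' M'"
proof -
  obtain \<phi> where \<phi>: "bij_betw \<phi> M M'" "\<And>s. s \<in> M \<Longrightarrow> agree Z s (\<phi> s)"
    using ex1_bij_betw[of M M' "agree Z"] ex ex' by blast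
  have "\<exists>S'\<in>{S. S \<subseteq> M' \<and> linearly_independent R A' S}. ecard S \<le> ecard S'"
    if S: "S \<subseteq> M" "linearly_independent R A S" for S
  proof (intro bexI CollectI conjI)
    have inj: "inj_on \<phi> S" using \<phi>(1) S(1) by (meson bij_betw_def inj_on_subset)
    show "ecard S \<le> ecard (\<phi> ` S)"
      using finite_image_iff[OF inj] card_image[OF inj] by (simp add: ecard_def)
    show "\<phi> ` S \<subseteq> M'" using \<phi>(1) S(1) by (auto simp: bij_betw_def)
    show "linearly_independent R A' (\<phi> ` S)"
      unfolding linearly_independent_def
    proof (intro allI impI ballI)
      fix F' c s' assume F': "finite F' \<and> F' \<subseteq> \<phi> ` S \<and> c \<in> F' \<rightarrow> carrier R \<and>
        (\<forall>\<rho>\<in>A'. (\<Oplus>s\<in>F'. c s \<otimes> s \<rho>) = \<zero>)" and s': "s' \<in> F'"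
      obtain F where F: "F \<subseteq> S" "F' = \<phi> ` F" "finite F"
        using F' finite_subset_image[of F' \<phi> S] by blast
      have FM: "F \<subseteq> M" using F S by blast
      have injF: "inj_on \<phi> F" using inj F inj_on_subset by blast
      have cF: "(\<lambda>s. c (\<phi> s)) \<in> F \<rightarrow> carrier R" using F' F(2) by auto
      let ?t = "lincomb A F (\<lambda>s. c (\<phi> s))"
      have tM: "?t \<in> M" using comb F FM cF by blast
      have F'M': "F' \<subseteq> M'" using F FM \<phi>(1) by (auto simp: bij_betw_def)
      have t'M': "lincomb A' F' c \<in> M'" using comb' F' F'M' by blast
      have t'0: "lincomb A' F' c = (\<lambda>\<rho>\<in>A'. \<zero>)" using F' unfolding lincomb_def by (intro restrict_ext) auto
      have closed: "s \<rho> \<in> carrier R" if "s \<in> M" "\<rho> \<in> A" for s \<rho> using M that by (auto simp: PiE_iff)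
      have closed': "s \<rho> \<in> carrier R" if "s \<in> M'" "\<rho> \<in> A'" for s \<rho> using M' that by (auto simp: PiE_iff)
      have "agree Z ?t (lincomb A' F' c)"
        unfolding agree_def
      proof clarify
        fix \<rho> \<rho>' assume z: "(\<rho>, \<rho>') \<in> Z"
        then have r: "\<rho> \<in> A" "\<rho>' \<in> A'" using Z by auto
        have "(\<Oplus>s\<in>\<phi> ` F. c s \<otimes> s \<rho>') = (\<Oplus>s\<in>F. c (\<phi> s) \<otimes> \<phi> s \<rho>')"
        proof (rule add.finprod_reindex[OF _ injF])
          show "(\<lambda>s. c s \<otimes> s \<rho>') \<in> \<phi> ` F \<rightarrow> carrier R"
            using F' F(2) F'M' closed' r by (auto intro!: m_closed)
        qed
        also have "\<dots> = (\<Oplus>s\<in>F. c (\<phi> s) \<otimes> s \<rho>)"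
        proof (rule add.finprod_cong')
          show "(\<lambda>s. c (\<phi> s) \<otimes> s \<rho>) \<in> F \<rightarrow> carrier R" using cF FM closed r by (auto intro!: m_closed)
          show "c (\<phi> s) \<otimes> \<phi> s \<rho>' = c (\<phi> s) \<otimes> s \<rho>" if "s \<in> F" for s
            using \<phi>(2)[of s] that FM z by (fastforce simp: agree_def)
        qed simp
        finally show "?t \<rho> = lincomb A' F' c \<rho>'" using r F(2) by (simp add: lincomb_def)
      qed
      moreover have zero: "(\<lambda>\<rho>\<in>A. \<zero>) \<in> M" using comb[of "{}" "\<lambda>_. \<zero>"] by (simp add: lincomb_def)
      moreover have "agree Z (\<lambda>\<rho>\<in>A. \<zero>) (lincomb A' F' c)" unfolding t'0 using Z by (auto simp: agree_def)
      ultimately have t0: "?t = (\<lambda>\<rho>\<in>A. \<zero>)" using ex'[OF t'M'] tM by blast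
      have "(\<Oplus>s\<in>F. c (\<phi> s) \<otimes> s \<rho>) = \<zero>" if "\<rho> \<in> A" for \<rho>
        using fun_cong[OF t0, of \<rho>] that by (simp add: lincomb_def)
      then have "\<forall>s\<in>F. c (\<phi> s) = \<zero>"
        using S(2) F cF unfolding linearly_independent_def by blast
      then show "c s' = \<zero>" using s' F(2) by blast
    qed
  qed
  then show ?thesis unfolding module_rank_def by (intro SUP_mono) auto
qed

end

section \<open>Kernel elements as second coordinates of colorings\<close>

context tribracket_module
begin

lemma sticker_kernel_iff:
  assumes f: "f \<in> colorings X br D"
  shows "s \<in> sticker_kernel R x y D f \<longleftrightarrow> s \<in> regions D \<rightarrow>\<^sub>E carrier R \<and>
    (\<forall>\<rho>1 \<rho>2 \<rho>3 \<rho>4. regions_at_crossing D \<rho>1 \<rho>2 \<rho>3 \<rho>4 \<longrightarrow>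
      s \<rho>4 = (\<ominus> (x (f \<rho>1) (f \<rho>2) (f \<rho>3) \<otimes> y (f \<rho>1) (f \<rho>2) (f \<rho>3) \<otimes> s \<rho>1)) \<oplus>
        x (f \<rho>1) (f \<rho>2) (f \<rho>3) \<otimes> s \<rho>2 \<oplus> y (f \<rho>1) (f \<rho>2) (f \<rho>3) \<otimes> s \<rho>3)" (is "_ \<longleftrightarrow> _ \<and> ?eqs")
proof (cases "s \<in> regions D \<rightarrow>\<^sub>E carrier R")
  case True
  have "(\<ominus> (x (f \<rho>1) (f \<rho>2) (f \<rho>3) \<otimes> y (f \<rho>1) (f \<rho>2) (f \<rho>3) \<otimes> s \<rho>1)) \<oplus> x (f \<rho>1) (f \<rho>2) (f \<rho>3) \<otimes> s \<rho>2 \<oplus>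
        y (f \<rho>1) (f \<rho>2) (f \<rho>3) \<otimes> s \<rho>3 \<ominus> s \<rho>4 = \<zero> \<longleftrightarrow>
      s \<rho>4 = (\<ominus> (x (f \<rho>1) (f \<rho>2) (f \<rho>3) \<otimes> y (f \<rho>1) (f \<rho>2) (f \<rho>3) \<otimes> s \<rho>1)) \<oplus>
        x (f \<rho>1) (f \<rho>2) (f \<rho>3) \<otimes> s \<rho>2 \<oplus> y (f \<rho>1) (f \<rho>2) (f \<rho>3) \<otimes> s \<rho>3"
    if "regions_at_crossing D \<rho>1 \<rho>2 \<rho>3 \<rho>4" for \<rho>1 \<rho>2 \<rho>3 \<rho>4
  proof -
    have r: "\<rho>1 \<in> regions D" "\<rho>2 \<in> regions D" "\<rho>3 \<in> regions D" "\<rho>4 \<in> regions D"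
      using that by (auto simp: regions_at_crossing_def quadrant_region_def)
    then have "s \<rho>1 \<in> carrier R" "s \<rho>2 \<in> carrier R" "s \<rho>3 \<in> carrier R" "s \<rho>4 \<in> carrier R"
      "f \<rho>1 \<in> X" "f \<rho>2 \<in> X" "f \<rho>3 \<in> X"
      using True f by (auto simp: colorings_def PiE_iff)
    then show ?thesis by (subst r_right_minus_eq) (auto simp: x_closed y_closed)
  qed
  then show ?thesis using True unfolding sticker_kernel_def Let_def by blast
qed (auto simp: sticker_kernel_def)

definition pairing :: "diagram \<Rightarrow> (complex set \<Rightarrow> 'a) \<Rightarrow> (complex set \<Rightarrow> 'b) \<Rightarrow> complex set \<Rightarrow> 'a \<times> 'b" where
  "pairing D f s = (\<lambda>\<rho>\<in>regions D. (f \<rho>, s \<rho>))"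

lemma pairing_coloring_iff:
  assumes f: "f \<in> colorings X br D" and s: "s \<in> regions D \<rightarrow>\<^sub>E carrier R"
  shows "pairing D f s \<in> colorings (X \<times> carrier R) (module_br R br x y) D \<longleftrightarrow> s \<in> sticker_kernel R x y D f"
proof -
  have P: "pairing D f s \<in> regions D \<rightarrow>\<^sub>E X \<times> carrier R"
    using f s by (auto simp: pairing_def colorings_def PiE_iff)
  have "module_br R br x y (pairing D f s \<rho>1) (pairing D f s \<rho>2) (pairing D f s \<rho>3) = pairing D f s \<rho>4 \<longleftrightarrow>
      s \<rho>4 = (\<ominus> (x (f \<rho>1) (f \<rho>2) (f \<rho>3) \<otimes> y (f \<rho>1) (f \<rho>2) (f \<rho>3) \<otimes> s \<rho>1)) \<oplus>
        x (f \<rho>1) (f \<rho>2) (f \<rho>3) \<otimes> s \<rho>2 \<oplus> y (f \<rho>1) (f \<rho>2) (f \<rho>3) \<otimes> s \<rho>3"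
    if c: "regions_at_crossing D \<rho>1 \<rho>2 \<rho>3 \<rho>4" for \<rho>1 \<rho>2 \<rho>3 \<rho>4
  proof -
    have r: "\<rho>1 \<in> regions D" "\<rho>2 \<in> regions D" "\<rho>3 \<in> regions D" "\<rho>4 \<in> regions D"
      using c by (auto simp: regions_at_crossing_def quadrant_region_def)
    have "br (f \<rho>1) (f \<rho>2) (f \<rho>3) = f \<rho>4" using f c by (auto simp: colorings_def)
    then show ?thesis using r by (auto simp: pairing_def module_br_def)
  qed
  then show ?thesis
    using P s unfolding sticker_kernel_iff[OF f] colorings_def mem_Collect_eq by blast
qed

lemma module_coloringE:
  assumes g: "g \<in> colorings (X \<times> carrier R) (module_br R br x y) D"
  obtains f s where "f \<in> colorings X br D" "s \<in> sticker_kernel R x y D f" "g = pairing D f s"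
proof -
  define f where "f = (\<lambda>\<rho>\<in>regions D. fst (g \<rho>))"
  define s where "s = (\<lambda>\<rho>\<in>regions D. snd (g \<rho>))"
  have gP: "g \<in> regions D \<rightarrow>\<^sub>E X \<times> carrier R" using g by (simp add: colorings_def)
  have gp: "g = pairing D f s"
    by (rule extensionalityI[of _ "regions D"]) (use gP in \<open>auto simp: PiE_iff pairing_def f_def s_def\<close>)
  have fP: "f \<in> regions D \<rightarrow>\<^sub>E X" and sP: "s \<in> regions D \<rightarrow>\<^sub>E carrier R"
    using gP by (auto simp: PiE_iff f_def s_def mem_Times_iff)
  have "br (f \<rho>1) (f \<rho>2) (f \<rho>3) = f \<rho>4" if c: "regions_at_crossing D \<rho>1 \<rho>2 \<rho>3 \<rho>4" for \<rho>1 \<rho>2 \<rho>3 \<rho>4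
  proof -
    have r: "\<rho>1 \<in> regions D" "\<rho>2 \<in> regions D" "\<rho>3 \<in> regions D" "\<rho>4 \<in> regions D"
      using c by (auto simp: regions_at_crossing_def quadrant_region_def)
    have "module_br R br x y (g \<rho>1) (g \<rho>2) (g \<rho>3) = g \<rho>4" using g c by (auto simp: colorings_def)
    then show ?thesis unfolding gp using r by (auto simp: pairing_def module_br_def)
  qed
  then have "f \<in> colorings X br D" using fP by (simp add: colorings_def)
  moreover from this have "s \<in> sticker_kernel R x y D f" using pairing_coloring_iff sP g gp by blast
  ultimately show ?thesis using that gp by blast
qed

lemma sticker_kernel_subset: "sticker_kernel R x y D f \<subseteq> regions D \<rightarrow>\<^sub>E carrier R"
  by (auto simp: sticker_kernel_def)

lemma agree_pairing:
  assumes "Z \<subseteq> regions D \<times> regions D'"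
  shows "agree Z (pairing D f s) (pairing D' f' s') \<longleftrightarrow> agree Z f f' \<and> agree Z s s'"
  using assms by (fastforce simp: agree_def pairing_def)

text \<open>Transferring the pair \<open>(f, s)\<close> yields some \<open>(f'', s')\<close>. Since
  the same \<open>Z\<close> transfers the colorings by \<open>X\<close>, uniqueness there forces
  \<open>f'' = f'\<close>, so \<open>s'\<close> lies in the intended kernel.\<close>

lemma kernel_transfer:
  assumes Z: "Z \<subseteq> regions D \<times> regions D'"
    and T: "transfers Z X br D D'" "transfers Z (X \<times> carrier R) (module_br R br x y) D D'"
    and f: "f \<in> colorings X br D" "f' \<in> colorings X br D'" "agree Z f f'"
    and s: "s \<in> sticker_kernel R x y D f"
  shows "\<exists>!s'. s' \<in> sticker_kernel R x y D' f' \<and> agree Z s s'"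
proof -
  have sP: "s \<in> regions D \<rightarrow>\<^sub>E carrier R" using s sticker_kernel_subset by blast
  have "pairing D f s \<in> colorings (X \<times> carrier R) (module_br R br x y) D"
    using pairing_coloring_iff[OF f(1) sP] s by blast
  then have ex1: "\<exists>!g'. g' \<in> colorings (X \<times> carrier R) (module_br R br x y) D' \<and> agree Z (pairing D f s) g'"
    using T(2) unfolding transfers_def by blast
  then obtain g' where g': "g' \<in> colorings (X \<times> carrier R) (module_br R br x y) D'" "agree Z (pairing D f s) g'"
    by blast
  obtain f'' s' where fs: "f'' \<in> colorings X br D'" "s' \<in> sticker_kernel R x y D' f''" "g' = pairing D' f'' s'"
    using module_coloringE[OF g'(1)] by blast
  then have a: "agree Z f f''" "agree Z s s'" using g'(2) agree_pairing[OF Z] by blast+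
  have "\<exists>!h. h \<in> colorings X br D' \<and> agree Z f h" using T(1) f(1) unfolding transfers_def by blast
  then have "f'' = f'" using f a fs by blast
  show ?thesis
  proof (rule ex1I)
    show "s' \<in> sticker_kernel R x y D' f' \<and> agree Z s s'" using fs a \<open>f'' = f'\<close> by simp
    fix t assume t: "t \<in> sticker_kernel R x y D' f' \<and> agree Z s t"
    then have tP: "t \<in> regions D' \<rightarrow>\<^sub>E carrier R" using sticker_kernel_subset by blast
    have "pairing D' f' t \<in> colorings (X \<times> carrier R) (module_br R br x y) D'"
      using pairing_coloring_iff[OF f(2) tP] t by blast
    moreover have "agree Z (pairing D f s) (pairing D' f' t)" using agree_pairing[OF Z] f(3) t by blast
    ultimately have "pairing D' f' t = pairing D' f' s'" using ex1 g' fs(3) \<open>f'' = f'\<close> by blast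
    then have e: "t \<rho> = s' \<rho>" if "\<rho> \<in> regions D'" for \<rho>
      using that by (auto simp: pairing_def dest!: fun_cong[where x = \<rho>])
    have s'P: "s' \<in> regions D' \<rightarrow>\<^sub>E carrier R" using fs(2) sticker_kernel_subset by blast
    show "t = s'"
      by (rule extensionalityI[of _ "regions D'"]) (use tP s'P e in \<open>auto simp: PiE_iff\<close>)
  qed
qed

text \<open>Scaling and addition in one step, in the form that the induction over a linear
  combination consumes.\<close>

lemma sticker_kernel_combine:
  assumes f: "f \<in> colorings X br D" and r: "r \<in> carrier R"
    and s: "s \<in> sticker_kernel R x y D f" and t: "t \<in> sticker_kernel R x y D f"
  shows "(\<lambda>\<rho>\<in>regions D. r \<otimes> s \<rho> \<oplus> t \<rho>) \<in> sticker_kernel R x y D f"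
  unfolding sticker_kernel_iff[OF f]
proof (intro conjI allI impI)
  have sP: "s \<in> regions D \<rightarrow>\<^sub>E carrier R" and tP: "t \<in> regions D \<rightarrow>\<^sub>E carrier R"
    using s t sticker_kernel_subset by blast+
  then show "(\<lambda>\<rho>\<in>regions D. r \<otimes> s \<rho> \<oplus> t \<rho>) \<in> regions D \<rightarrow>\<^sub>E carrier R" using r by (auto simp: PiE_iff)
  fix \<rho>1 \<rho>2 \<rho>3 \<rho>4 assume c: "regions_at_crossing D \<rho>1 \<rho>2 \<rho>3 \<rho>4"
  have reg: "\<rho>1 \<in> regions D" "\<rho>2 \<in> regions D" "\<rho>3 \<in> regions D" "\<rho>4 \<in> regions D"
    using c by (auto simp: regions_at_crossing_def quadrant_region_def)
  then have F: "f \<rho>1 \<in> X" "f \<rho>2 \<in> X" "f \<rho>3 \<in> X" using f by (auto simp: colorings_def PiE_iff)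
  define a where "a = x (f \<rho>1) (f \<rho>2) (f \<rho>3)"
  define b where "b = y (f \<rho>1) (f \<rho>2) (f \<rho>3)"
  have C: "a \<in> carrier R" "b \<in> carrier R" using F by (simp_all add: a_def b_def x_closed y_closed)
  have S: "s \<rho> \<in> carrier R" "t \<rho> \<in> carrier R" if "\<rho> \<in> regions D" for \<rho> using sP tP that by (auto simp: PiE_iff)
  note S = S[OF reg(1)] S[OF reg(2)] S[OF reg(3)] S[OF reg(4)]
  have es: "s \<rho>4 = (\<ominus> (a \<otimes> b \<otimes> s \<rho>1)) \<oplus> a \<otimes> s \<rho>2 \<oplus> b \<otimes> s \<rho>3"
    using s c unfolding sticker_kernel_iff[OF f] a_def b_def by blast
  have et: "t \<rho>4 = (\<ominus> (a \<otimes> b \<otimes> t \<rho>1)) \<oplus> a \<otimes> t \<rho>2 \<oplus> b \<otimes> t \<rho>3"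
    using t c unfolding sticker_kernel_iff[OF f] a_def b_def by blast
  have "r \<otimes> s \<rho>4 \<oplus> t \<rho>4 = (\<ominus> (a \<otimes> b \<otimes> (r \<otimes> s \<rho>1 \<oplus> t \<rho>1))) \<oplus>
      a \<otimes> (r \<otimes> s \<rho>2 \<oplus> t \<rho>2) \<oplus> b \<otimes> (r \<otimes> s \<rho>3 \<oplus> t \<rho>3)"
    unfolding es et using S C r
    by (simp add: r_distr l_distr m_ac a_minus_def r_minus l_minus a_ac minus_add)
  then show "(\<lambda>\<rho>\<in>regions D. r \<otimes> s \<rho> \<oplus> t \<rho>) \<rho>4 =
      (\<ominus> (x (f \<rho>1) (f \<rho>2) (f \<rho>3) \<otimes> y (f \<rho>1) (f \<rho>2) (f \<rho>3) \<otimes> (\<lambda>\<rho>\<in>regions D. r \<otimes> s \<rho> \<oplus> t \<rho>) \<rho>1)) \<oplus>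
      x (f \<rho>1) (f \<rho>2) (f \<rho>3) \<otimes> (\<lambda>\<rho>\<in>regions D. r \<otimes> s \<rho> \<oplus> t \<rho>) \<rho>2 \<oplus>
      y (f \<rho>1) (f \<rho>2) (f \<rho>3) \<otimes> (\<lambda>\<rho>\<in>regions D. r \<otimes> s \<rho> \<oplus> t \<rho>) \<rho>3"
    unfolding a_def[symmetric] b_def[symmetric] using reg by simp
qed

lemma sticker_kernel_zero:
  assumes f: "f \<in> colorings X br D"
  shows "(\<lambda>\<rho>\<in>regions D. \<zero>) \<in> sticker_kernel R x y D f"
  unfolding sticker_kernel_iff[OF f]
proof (intro conjI allI impI)
  fix \<rho>1 \<rho>2 \<rho>3 \<rho>4 assume c: "regions_at_crossing D \<rho>1 \<rho>2 \<rho>3 \<rho>4"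
  have reg: "\<rho>1 \<in> regions D" "\<rho>2 \<in> regions D" "\<rho>3 \<in> regions D" "\<rho>4 \<in> regions D"
    using c by (auto simp: regions_at_crossing_def quadrant_region_def)
  then have "f \<rho>1 \<in> X" "f \<rho>2 \<in> X" "f \<rho>3 \<in> X" using f by (auto simp: colorings_def PiE_iff)
  then show "(\<lambda>\<rho>\<in>regions D. \<zero>) \<rho>4 =
      (\<ominus> (x (f \<rho>1) (f \<rho>2) (f \<rho>3) \<otimes> y (f \<rho>1) (f \<rho>2) (f \<rho>3) \<otimes> (\<lambda>\<rho>\<in>regions D. \<zero>) \<rho>1)) \<oplus>
      x (f \<rho>1) (f \<rho>2) (f \<rho>3) \<otimes> (\<lambda>\<rho>\<in>regions D. \<zero>) \<rho>2 \<oplus>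
      y (f \<rho>1) (f \<rho>2) (f \<rho>3) \<otimes> (\<lambda>\<rho>\<in>regions D. \<zero>) \<rho>3"
    using reg by (simp add: x_closed y_closed)
qed auto

lemma sticker_kernel_lincomb:
  assumes f: "f \<in> colorings X br D"
    and F: "finite F" "F \<subseteq> sticker_kernel R x y D f" "c \<in> F \<rightarrow> carrier R"
  shows "lincomb (regions D) F c \<in> sticker_kernel R x y D f"
  using F
proof (induction F rule: finite_induct)
  case empty
  then show ?case using sticker_kernel_zero[OF f] by (simp add: lincomb_def restrict_def)
next
  case (insert s F)
  have IH: "lincomb (regions D) F c \<in> sticker_kernel R x y D f" using insert by auto
  have "lincomb (regions D) (insert s F) c = (\<lambda>\<rho>\<in>regions D. c s \<otimes> s \<rho> \<oplus> lincomb (regions D) F c \<rho>)"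
    unfolding lincomb_def
  proof (rule restrict_ext)
    fix \<rho> assume \<rho>: "\<rho> \<in> regions D"
    have "t \<rho> \<in> carrier R" if "t \<in> insert s F" for t
      using that insert.prems(1) sticker_kernel_subset[of D f] \<rho> by (auto simp: PiE_iff subset_iff)
    then show "(\<Oplus>s\<in>insert s F. c s \<otimes> s \<rho>) =
        c s \<otimes> s \<rho> \<oplus> (\<lambda>\<rho>\<in>regions D. \<Oplus>s\<in>F. c s \<otimes> s \<rho>) \<rho>"
      using insert.hyps insert.prems(2) \<rho> by (subst finsum_insert) auto
  qed
  moreover have "c s \<in> carrier R" "s \<in> sticker_kernel R x y D f" using insert.prems by auto
  ultimately show ?case using sticker_kernel_combine[OF f _ _ IH, of "c s" s] by metis
qed

lemma kernel_size_transfer: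
  assumes Z: "Z \<subseteq> regions D \<times> regions D'"
    and T: "transfers Z X br D D'" "transfers Z (X \<times> carrier R) (module_br R br x y) D D'"
    and T': "transfers (Z\<inverse>) X br D' D" "transfers (Z\<inverse>) (X \<times> carrier R) (module_br R br x y) D' D"
    and f: "f \<in> colorings X br D" "f' \<in> colorings X br D'" "agree Z f f'"
  shows "kernel_size R x y D f = kernel_size R x y D' f'"
proof -
  let ?M = "sticker_kernel R x y D f" and ?M' = "sticker_kernel R x y D' f'"
  have Z': "Z\<inverse> \<subseteq> regions D' \<times> regions D" using Z by auto
  have f': "agree (Z\<inverse>) f' f" using f by simp
  have ex: "\<exists>!s'. s' \<in> ?M' \<and> agree Z s s'" if "s \<in> ?M" for s
    by (rule kernel_transfer[OF Z T f that])
  have ex': "\<exists>!s. s \<in> ?M \<and> agree Z s s'" if "s' \<in> ?M'" for s'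
    using kernel_transfer[OF Z' T' f(2,1) f' that] by simp
  have "ecard ?M = ecard ?M'"
  proof -
    obtain \<phi> where "bij_betw \<phi> ?M ?M'" using ex1_bij_betw[of ?M ?M' "agree Z"] ex ex' by blast
    then show ?thesis using bij_betw_finite bij_betw_same_card by (metis ecard_def)
  qed
  moreover have "module_rank R (regions D) ?M = module_rank R (regions D') ?M'"
  proof (rule antisym)
    show "module_rank R (regions D) ?M \<le> module_rank R (regions D') ?M'"
      by (rule module_rank_le[OF sticker_kernel_subset sticker_kernel_subset Z
            sticker_kernel_lincomb[OF f(1)] sticker_kernel_lincomb[OF f(2)] ex ex'])
    show "module_rank R (regions D') ?M' \<le> module_rank R (regions D) ?M"
      by (rule module_rank_le[OF sticker_kernel_subset sticker_kernel_subset Z'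
            sticker_kernel_lincomb[OF f(2)] sticker_kernel_lincomb[OF f(1)]])
        (simp_all add: ex ex')
  qed
  ultimately show ?thesis by (simp add: kernel_size_def)
qed

lemma enhancements_transfer:
  assumes Z: "Z \<subseteq> regions D \<times> regions D'"
    and T: "transfers Z X br D D'" "transfers Z (X \<times> carrier R) (module_br R br x y) D D'"
    and T': "transfers (Z\<inverse>) X br D' D" "transfers (Z\<inverse>) (X \<times> carrier R) (module_br R br x y) D' D"
  shows "multiset_enhancement X br R x y D = multiset_enhancement X br R x y D'"
    and "polynomial_enhancement X br R x y D = polynomial_enhancement X br R x y D'"
proof -
  have "\<exists>!f'. f' \<in> colorings X br D' \<and> agree Z f f'" if "f \<in> colorings X br D" for f
    using T(1) that unfolding transfers_def by blast
  moreover have "\<exists>!f. f \<in> colorings X br D \<and> agree Z f f'" if "f' \<in> colorings X br D'" for f'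
    using T'(1) that unfolding transfers_def agree_converse by blast
  ultimately obtain \<phi> where \<phi>: "bij_betw \<phi> (colorings X br D) (colorings X br D')"
      "\<And>f. f \<in> colorings X br D \<Longrightarrow> agree Z f (\<phi> f)"
    using ex1_bij_betw[of "colorings X br D" "colorings X br D'" "agree Z"] by blast
  have size: "kernel_size R x y D' (\<phi> f) = kernel_size R x y D f" if "f \<in> colorings X br D" for f
    using kernel_size_transfer[OF Z T T' that _ \<phi>(2)[OF that]] bij_betwE[OF \<phi>(1)] that by simp
  have "cardinal {f \<in> colorings X br D. kernel_size R x y D f = m} =
      cardinal {f \<in> colorings X br D'. kernel_size R x y D' f = m}" for m
  proof -
    have "bij_betw \<phi> {f \<in> colorings X br D. kernel_size R x y D f = m}
        {f \<in> colorings X br D'. kernel_size R x y D' f = m}"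
    proof (rule bij_betw_subset[OF \<phi>(1)])
      have "\<phi> ` colorings X br D = colorings X br D'" using \<phi>(1) by (simp add: bij_betw_def)
      then show "\<phi> ` {f \<in> colorings X br D. kernel_size R x y D f = m} =
          {f \<in> colorings X br D'. kernel_size R x y D' f = m}"
        using size by (auto simp: image_iff) (metis image_iff)
    qed auto
    then have "{f \<in> colorings X br D. kernel_size R x y D f = m} \<approx> {f \<in> colorings X br D'. kernel_size R x y D' f = m}"
      unfolding eqpoll_def by blast
    then show ?thesis unfolding cardinal_def by (meson eqpoll_sym eqpoll_trans)
  qed
  then show "multiset_enhancement X br R x y D = multiset_enhancement X br R x y D'"
    by (simp add: multiset_enhancement_def)
  show "polynomial_enhancement X br R x y D = polynomial_enhancement X br R x y D'"
    unfolding polynomial_enhancement_def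
    by (subst sum.reindex_bij_betw[OF \<phi>(1), symmetric]) (simp add: size cong: sum.cong)
qed

end

section \<open>Invariance\<close>

lemma r1_step_transfers:
  fixes X :: "'x set"
  assumes D: "link_diagram D" "link_diagram D'" and R: "reidemeister1 D D'" and X: "tribracket X br"
  shows "transfers (common_region_pairs D D') X br D D'" "transfers (common_region_pairs D' D) X br D' D"
proof -
  obtain \<sigma> \<epsilon> where s: "\<sigma> = 1 \<or> \<sigma> = -1" "\<epsilon> = 1 \<or> \<epsilon> = -1" and move: "local_move
      (local_picture 1 (\<lambda>_ t. Complex (\<sigma> * t) 0) (\<lambda>_ t. \<epsilon> * t))
      (local_picture 1 (\<lambda>_ t. Complex ((\<sigma> * t) ^ 3 - \<sigma> * t / 4) (bump (\<sigma> * t))) (\<lambda>_ t. \<epsilon> * t)) D D'"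
    using R unfolding reidemeister1_def by blast
  note move = move[unfolded local_move_def r1_line_picture[OF s(1)] kink_def[symmetric]]
  have "line_picture D \<sigma>" using move by (intro line_picture.intro D s) blast
  moreover have "kink_picture D' \<sigma> \<epsilon>" using move by (intro kink_picture.intro D s) blast
  moreover have "restrict_diagram (- move_box) D = restrict_diagram (- move_box) D'" using move by blast
  ultimately
  show "transfers (common_region_pairs D D') X br D D'" "transfers (common_region_pairs D' D) X br D' D"
    by (rule r1_transfers[OF _ _ _ X])+
qed

lemma r2_step_transfers:
  fixes X :: "'x set"
  assumes D: "link_diagram D" "link_diagram D'" and R: "reidemeister2 D D'" and X: "tribracket X br"
  shows "transfers (common_region_pairs D D') X br D D'" "transfers (common_region_pairs D' D) X br D' D"
proof -
  define P where "P c \<sigma> h = local_picture 2 (\<lambda>i t. ([\<lambda>t. Complex t 0, c] ! i) (\<sigma> i * t)) (\<lambda>i (t::real). h i)"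
    for c :: "real \<Rightarrow> complex" and \<sigma> h :: "nat \<Rightarrow> real"
  obtain \<sigma> h where s: "\<And>i. i < 2 \<Longrightarrow> \<sigma> i \<in> {1, -1}" and inj: "inj_on h {..<2}" and
    move: "local_move (P (\<lambda>t. Complex t 1) \<sigma> h) (P (\<lambda>t. Complex t (1 - 2 * bump t)) \<sigma> h) D D'"
    using R unfolding reidemeister2_def Let_def P_def by blast
  have P: "P (\<lambda>t. Complex t 1) \<sigma> h =
      local_picture 2 (\<lambda>i t. Complex (\<sigma> i * t) (r2_graph False i (\<sigma> i * t))) (\<lambda>i t. h i)"
    "P (\<lambda>t. Complex t (1 - 2 * bump t)) \<sigma> h =
      local_picture 2 (\<lambda>i t. Complex (\<sigma> i * t) (r2_graph True i (\<sigma> i * t))) (\<lambda>i t. h i)"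
    unfolding P_def by (rule local_picture_cong; auto simp: r2_graph_def less_2_cases_iff)+
  obtain ov un where ou: "ov < 2" "un < 2" "h un < h ov"
  proof (cases "h 0 < h 1")
    case False
    moreover have "h 0 \<noteq> h 1" using inj_onD[OF inj, of 0 1] by auto
    ultimately show ?thesis using that[of 0 1] by simp
  qed (use that[of 1 0] in simp)
  note move = move[unfolded local_move_def P]
  have "r2_parallel D \<sigma> h ov un"
    using move by (intro r2_parallel.intro r2_picture.intro D s inj ou) blast
  moreover have "r2_crossing D' \<sigma> h ov un"
    using move by (intro r2_crossing.intro r2_picture.intro D s inj ou) blast
  moreover have "restrict_diagram (- move_box) D = restrict_diagram (- move_box) D'" using move by blast
  ultimately
  show "transfers (common_region_pairs D D') X br D D'" "transfers (common_region_pairs D' D) X br D' D"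
    by (rule r2_transfers[OF _ _ _ X])+
qed

lemma r3_step_transfers:
  fixes X :: "'x set"
  assumes D: "link_diagram D" "link_diagram D'" and R: "reidemeister3 D D'" and X: "tribracket X br"
  shows "transfers (common_region_pairs D D') X br D D'" "transfers (common_region_pairs D' D) X br D' D"
proof -
  define P where "P c \<sigma> h = local_picture 3
      (\<lambda>i t. ([\<lambda>t. Complex t t, \<lambda>t. Complex t (- t), c] ! i) (\<sigma> i * t)) (\<lambda>i (t::real). h i)"
    for c :: "real \<Rightarrow> complex" and \<sigma> h :: "nat \<Rightarrow> real"
  obtain \<sigma> h where s: "\<And>i. i < 3 \<Longrightarrow> \<sigma> i \<in> {1, -1}" and inj: "inj_on h {..<3}" and
    move: "local_move (P (\<lambda>t. Complex t (bump t)) \<sigma> h) (P (\<lambda>t. Complex t (- bump t)) \<sigma> h) D D'"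
    using R unfolding reidemeister3_def Let_def P_def by blast
  have cases: "i < 3 \<longleftrightarrow> i = 0 \<or> i = 1 \<or> i = 2" for i :: nat by auto
  have P: "P (\<lambda>t. Complex t (bump t)) \<sigma> h =
      local_picture 3 (\<lambda>i t. Complex (\<sigma> i * t) (r3_graph 1 i (\<sigma> i * t))) (\<lambda>i t. h i)"
    "P (\<lambda>t. Complex t (- bump t)) \<sigma> h =
      local_picture 3 (\<lambda>i t. Complex (\<sigma> i * t) (r3_graph (- 1) i (\<sigma> i * t))) (\<lambda>i t. h i)"
    unfolding P_def by (rule local_picture_cong; auto simp: r3_graph_def cases)+
  have ne: "h 0 \<noteq> h 1" "h 0 \<noteq> h 2" "h 1 \<noteq> h 2"
    using inj_onD[OF inj, of 0 1] inj_onD[OF inj, of 0 2] inj_onD[OF inj, of 1 2] by auto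
  have "\<exists>T M B. T < 3 \<and> M < 3 \<and> B < 3 \<and> h B < h M \<and> h M < h T"
    using ne unfolding cases by (metis linorder_cases)
  then obtain T M B where "T < 3" "M < 3" "B < 3" "h B < h M" "h M < h T" by blast
  then have r3: "r3_picture D 1 \<sigma> h T M B" "r3_picture D' (- 1) \<sigma> h T M B"
    using move inj s D unfolding local_move_def P by (auto intro!: r3_picture.intro)
  have outer: "restrict_diagram (- move_box) D = restrict_diagram (- move_box) D'"
    using move unfolding local_move_def by blast
  show "transfers (common_region_pairs D D') X br D D'" by (rule r3_transfers[OF r3 outer X])
  \<comment> \<open>The inverse move is the same statement with the sign reversed, so \<epsilon> = 1
    has to be presented as \<open>- (- 1)\<close>.\<close>
  have "r3_picture D (- (- 1)) \<sigma> h T M B" using r3(1) by simp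
  then show "transfers (common_region_pairs D' D) X br D' D" by (rule r3_transfers[OF r3(2) _ outer[symmetric] X])
qed

lemma reidemeister_transfers:
  fixes X :: "'x set"
  assumes "link_diagram D" "link_diagram D'" "reidemeister1 D D' \<or> reidemeister2 D D' \<or> reidemeister3 D D'"
    and "tribracket X br"
  shows "transfers (common_region_pairs D D') X br D D'" "transfers ((common_region_pairs D D')\<inverse>) X br D' D"
proof -
  from assms(3) have "transfers (common_region_pairs D D') X br D D' \<and> transfers (common_region_pairs D' D) X br D' D"
  proof (elim disjE)
    assume "reidemeister1 D D'"
    from r1_step_transfers[OF assms(1,2) this assms(4)] show ?thesis ..
  next
    assume "reidemeister2 D D'"
    from r2_step_transfers[OF assms(1,2) this assms(4)] show ?thesis ..
  next
    assume "reidemeister3 D D'"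
    from r3_step_transfers[OF assms(1,2) this assms(4)] show ?thesis ..
  qed
  then show "transfers (common_region_pairs D D') X br D D'" "transfers ((common_region_pairs D D')\<inverse>) X br D' D"
    by (simp_all add: common_region_pairs_swap[of D' D])
qed

lemma (in tribracket_module) diagram_step_enhancements:
  assumes "diagram_step D D'"
  shows "multiset_enhancement X br R x y D = multiset_enhancement X br R x y D'"
    and "polynomial_enhancement X br R x y D = polynomial_enhancement X br R x y D'"
proof -
  have D: "link_diagram D" "link_diagram D'" using assms by (simp_all add: diagram_step_def)
  obtain Z where Z: "Z \<subseteq> regions D \<times> regions D'"
    and T: "transfers Z X br D D'" "transfers Z (X \<times> carrier R) (module_br R br x y) D D'"
    and T': "transfers (Z\<inverse>) X br D' D" "transfers (Z\<inverse>) (X \<times> carrier R) (module_br R br x y) D' D"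
  proof (cases "planar_isotopic D D'")
    case True
    then obtain g g' where "diagram_diffeo D D' g g'" using planar_isotopic_transfers[OF D] by blast
    then interpret diagram_diffeo D D' g g' .
    have "region_pairs \<subseteq> regions D \<times> regions D'" by (auto simp: region_pairs_def regions_image)
    then show ?thesis by (rule that) (rule transfers_diffeo)+
  next
    case False
    then have R: "reidemeister1 D D' \<or> reidemeister2 D D' \<or> reidemeister3 D D'"
      using assms by (simp add: diagram_step_def)
    have "common_region_pairs D D' \<subseteq> regions D \<times> regions D'" by (auto simp: common_region_pairs_def)
    then show ?thesis
      by (rule that) (rule reidemeister_transfers[OF D R tribracket_axioms] reidemeister_transfers[OF D R module_tribracket])+
  qed
  from enhancements_transfer[OF Z T T']
  show "multiset_enhancement X br R x y D = multiset_enhancement X br R x y D'"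
    and "polynomial_enhancement X br R x y D = polynomial_enhancement X br R x y D'" .
qed

theorem proposition2:
  fixes X :: "'x set" and br :: "'x \<Rightarrow> 'x \<Rightarrow> 'x \<Rightarrow> 'x"
    and R :: "('r, 'm) ring_scheme" and x y :: "'x \<Rightarrow> 'x \<Rightarrow> 'x \<Rightarrow> 'r"
    and L L' :: diagram
  assumes "tribracket X br"
    and "cring R"
    and "tribracket_module X br R x y"
    and "link_diagram L" and "link_diagram L'"
    and "link_equivalent L L'"
  shows "multiset_enhancement X br R x y L = multiset_enhancement X br R x y L' \<and>
    (finite X \<longrightarrow> polynomial_enhancement X br R x y L = polynomial_enhancement X br R x y L')"
proof -
  interpret tribracket_module X br R x y by fact
  have "multiset_enhancement X br R x y L = multiset_enhancement X br R x y L' \<and>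
    polynomial_enhancement X br R x y L = polynomial_enhancement X br R x y L'"
    using assms(6) unfolding link_equivalent_def
  proof (induction rule: equivclp_induct)
    case (step D D')
    from step(2) show ?case
    proof
      assume "diagram_step D D'"
      from diagram_step_enhancements[OF this] step(3) show ?case by metis
    next
      assume "diagram_step D' D"
      from diagram_step_enhancements[OF this] step(3) show ?case by metis
    qed
  qed simp
  then show ?thesis by blast
qed

end
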